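(* Let $\Omega\subseteq\mathbb H$ be open and let $f\in\mathcal{SR}_{loc}(\Omega)$. Assume that the open ball $B(a,r)$ with centre $a\in\Omega$ and radius $r$ has closure $\overline{B(a,r)}$ contained in $\Omega$. Then $$f(a)=\int_{\mathbb S^3}f(a+r\zeta)\,d\sigma(\zeta)-r\int_{\mathbb S^3}\overline\zeta\;\overline\partial f(a+r\zeta)\,d\sigma(\zeta).$$
   Context: $\mathbb H\simeq\mathbb R^4$ is the skew field of quaternions, $x=x_0+ix_1+jx_2+kx_3$ with conjugate $\overline x$, $\mathbb S_{\mathbb H}$ the sphere of imaginary units, $\mathbb C_I=\mathrm{span}(1,I)$ for $I\in\mathbb S_{\mathbb H}$, $\mathbb S_x=\alpha+\beta\,\mathbb S_{\mathbb H}$ if $x=\alpha+\beta I$, and $\overline\partial=\frac12(\partial_0+i\partial_1+j\partial_2+k\partial_3)$ is the Cauchy-Riemann-Fueter operator. $\mathbb S^3$ is the unit sphere of $\mathbb H\simeq\mathbb R^4$ and $\sigma$ its normalized rotation-invariant surface measure, $\sigma(\mathbb S^3)=1$. $\mathcal{SR}_{loc}(\Omega)$ (locally slice-regular functions) is the set of $\mathcal C^1$ functions $f:\Omega\to\mathbb H$ such that (i) for every $I\in\mathbb S_{\mathbb H}$ with $\Omega\cap\mathbb C_I\ne\emptyset$, $f|_{\Omega\cap\mathbb C_I}$ is holomorphic w.r.t. the complex structures given by left multiplication by $I$, and (ii) $\overline\partial f$ and $\overline\partial(xf)$ are locally constant on $\mathbb S_y\cap\Omega$ for every $y\in\Omega$.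 *)

theory Defs
  imports "HOL-Analysis.Analysis"
begin

codatatype quat = Quat (qRe: real) (qI: real) (qJ: real) (qK: real)

lemma quat_eq_iff: "x = y \<longleftrightarrow> qRe x = qRe y \<and> qI x = qI y \<and> qJ x = qJ y \<and> qK x = qK y"
  by (auto intro: quat.expand)

instantiation quat :: ab_group_add
begin

primcorec zero_quat where
  "qRe 0 = 0" | "qI 0 = 0" | "qJ 0 = 0" | "qK 0 = 0"

primcorec plus_quat where
  "qRe (x + y) = qRe x + qRe y"
| "qI (x + y) = qI x + qI y"
| "qJ (x + y) = qJ x + qJ y"
| "qK (x + y) = qK x + qK y"

primcorec uminus_quat where
  "qRe (- x) = - qRe x"
| "qI (- x) = - qI x"
| "qJ (- x) = - qJ x"
| "qK (- x) = - qK x"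

primcorec minus_quat where
  "qRe (x - y) = qRe x - qRe y"
| "qI (x - y) = qI x - qI y"
| "qJ (x - y) = qJ x - qJ y"
| "qK (x - y) = qK x - qK y"

instance
  by standard (simp_all add: quat_eq_iff)

end

instantiation quat :: ring_1
begin

primcorec one_quat where
  "qRe 1 = 1" | "qI 1 = 0" | "qJ 1 = 0" | "qK 1 = 0"

primcorec times_quat where
  "qRe (x * y) = qRe x * qRe y - qI x * qI y - qJ x * qJ y - qK x * qK y"
| "qI (x * y) = qRe x * qI y + qI x * qRe y + qJ x * qK y - qK x * qJ y"
| "qJ (x * y) = qRe x * qJ y - qI x * qK y + qJ x * qRe y + qK x * qI y"
| "qK (x * y) = qRe x * qK y + qI x * qJ y - qJ x * qI y + qK x * qRe y"

instance
  by standard (simp_all add: quat_eq_iff algebra_simps)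

end

instantiation quat :: real_algebra_1
begin

primcorec scaleR_quat where
  "qRe (r *\<^sub>R x) = r * qRe x"
| "qI (r *\<^sub>R x) = r * qI x"
| "qJ (r *\<^sub>R x) = r * qJ x"
| "qK (r *\<^sub>R x) = r * qK x"

instance
  by standard (simp_all add: quat_eq_iff algebra_simps)

end

primcorec qcnj :: "quat \<Rightarrow> quat" where
  "qRe (qcnj x) = qRe x"
| "qI (qcnj x) = - qI x"
| "qJ (qcnj x) = - qJ x"
| "qK (qcnj x) = - qK x"

definition ii :: quat where "ii = Quat 0 1 0 0"
definition jj :: quat where "jj = Quat 0 0 1 0"
definition kk :: quat where "kk = Quat 0 0 0 1"

lemmas quat_units_def = ii_def jj_def kk_def

lemma quat_units_relations:
  "ii * ii = - 1" "jj * jj = - 1" "kk * kk = - 1"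
  "ii * jj = kk" "jj * kk = ii" "kk * ii = jj"
  "jj * ii = - kk" "kk * jj = - ii" "ii * kk = - jj"
  by (simp_all add: quat_eq_iff quat_units_def)

instantiation quat :: real_inner
begin

definition inner_quat :: "quat \<Rightarrow> quat \<Rightarrow> real" where
  "x \<bullet> y = qRe x * qRe y + qI x * qI y + qJ x * qJ y + qK x * qK y"

definition norm_quat :: "quat \<Rightarrow> real" where
  "norm x = sqrt ((qRe x)\<^sup>2 + (qI x)\<^sup>2 + (qJ x)\<^sup>2 + (qK x)\<^sup>2)"

definition sgn_quat :: "quat \<Rightarrow> quat" where
  "sgn x = x /\<^sub>R norm x" for x :: quat

definition dist_quat :: "quat \<Rightarrow> quat \<Rightarrow> real" where
  "dist x y = norm (x - y)" for x y :: quat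

definition uniformity_quat :: "(quat \<times> quat) filter" where
  "uniformity = (INF e\<in>{0 <..}. principal {(x :: quat, y). dist x y < e})"

definition open_quat :: "quat set \<Rightarrow> bool" where
  "open U \<longleftrightarrow> (\<forall>x\<in>U. eventually (\<lambda>(x', y). x' = x \<longrightarrow> y \<in> U) uniformity)"
  for U :: "quat set"

instance
proof
  fix x y z :: quat and r :: real
  show "x \<bullet> y = y \<bullet> x" "(x + y) \<bullet> z = x \<bullet> z + y \<bullet> z" "(r *\<^sub>R x) \<bullet> y = r * (x \<bullet> y)" "0 \<le> x \<bullet> x"
    by (simp_all add: inner_quat_def algebra_simps)
  have "x \<bullet> x = 0 \<Longrightarrow> x = 0"
  proof -
    assume "x \<bullet> x = 0"
    then have "qRe x * qRe x + qI x * qI x + qJ x * qJ x + qK x * qK x = 0"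
      by (simp add: inner_quat_def)
    moreover have "0 \<le> qRe x * qRe x" "0 \<le> qI x * qI x" "0 \<le> qJ x * qJ x" "0 \<le> qK x * qK x"
      by simp_all
    ultimately have "qRe x * qRe x = 0" "qI x * qI x = 0" "qJ x * qJ x = 0" "qK x * qK x = 0"
      by linarith+
    then show "x = 0" by (simp add: quat_eq_iff)
  qed
  then show "x \<bullet> x = 0 \<longleftrightarrow> x = 0"
    by (auto simp: inner_quat_def)
  show "norm x = sqrt (x \<bullet> x)"
    by (simp add: norm_quat_def inner_quat_def power2_eq_square)
qed (rule sgn_quat_def dist_quat_def open_quat_def uniformity_quat_def)+

end

instantiation quat :: euclidean_space
begin

definition Basis_quat :: "quat set" where
  "Basis = {1, ii, jj, kk}"

instance
proof
  fix u v x :: quat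
  show "(Basis :: quat set) \<noteq> {}" "finite (Basis :: quat set)"
    by (simp_all add: Basis_quat_def)
  show "u \<bullet> v = (if u = v then 1 else 0)" if "u \<in> Basis" "v \<in> Basis"
    using that by (auto simp: Basis_quat_def inner_quat_def quat_units_def quat_eq_iff)
  show "(\<forall>u\<in>Basis. x \<bullet> u = 0) \<longleftrightarrow> x = 0"
    by (simp add: Basis_quat_def inner_quat_def quat_units_def) (auto simp: quat_eq_iff)
qed

end

instantiation quat :: real_normed_div_algebra
begin

definition inverse_quat :: "quat \<Rightarrow> quat" where
  "inverse x = qcnj x /\<^sub>R (norm x)\<^sup>2"

definition divide_quat :: "quat \<Rightarrow> quat \<Rightarrow> quat" where
  "x div y = x * inverse y" for x y :: quat

instance
proof
  fix x y :: quat
  have n: "(norm z)\<^sup>2 = (qRe z)\<^sup>2 + (qI z)\<^sup>2 + (qJ z)\<^sup>2 + (qK z)\<^sup>2" for z :: quat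
    by (simp add: norm_quat_def)
  have c: "qcnj z * z = of_real ((norm z)\<^sup>2)" "z * qcnj z = of_real ((norm z)\<^sup>2)" for z
    unfolding of_real_def n by (simp_all add: quat_eq_iff power2_eq_square algebra_simps)
  show "inverse x * x = 1" "x * inverse x = 1" if "x \<noteq> 0"
    using that by (simp_all add: inverse_quat_def c of_real_def)
  show "x div y = x * inverse y" by (rule divide_quat_def)
  show "inverse (0::quat) = 0"
    by (simp add: inverse_quat_def)
  show "norm (x * y) = norm x * norm y"
    by (simp add: norm_quat_def real_sqrt_mult [symmetric] power2_eq_square algebra_simps)
qed

end

definition imag_units :: "quat set" where
  "imag_units = {I. I\<^sup>2 = - 1}"

definition slice_plane :: "quat \<Rightarrow> quat set" where
  "slice_plane I = span {1, I}"

text \<open>For a real point \<open>x\<close> this is the singleton \<open>{x}\<close>; otherwise it is a two-sphere.\<close>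
definition sphere_through :: "quat \<Rightarrow> quat set" where
  "sphere_through x = {of_real \<alpha> + \<beta> *\<^sub>R J | \<alpha> \<beta> I J.
     I \<in> imag_units \<and> J \<in> imag_units \<and> x = of_real \<alpha> + \<beta> *\<^sub>R I}"

definition partial_deriv :: "quat \<Rightarrow> (quat \<Rightarrow> quat) \<Rightarrow> quat \<Rightarrow> quat" where
  "partial_deriv v f x = vector_derivative (\<lambda>t::real. f (x + t *\<^sub>R v)) (at 0)"

definition dbar :: "(quat \<Rightarrow> quat) \<Rightarrow> quat \<Rightarrow> quat" where
  "dbar f x = (1/2) *\<^sub>R (partial_deriv 1 f x + ii * partial_deriv ii f x
     + jj * partial_deriv jj f x + kk * partial_deriv kk f x)"

definition C1_on :: "quat set \<Rightarrow> (quat \<Rightarrow> quat) \<Rightarrow> bool" where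
  "C1_on \<Omega> f \<longleftrightarrow> (\<exists>f' :: quat \<Rightarrow> quat \<Rightarrow>\<^sub>L quat.
     (\<forall>x\<in>\<Omega>. (f has_derivative blinfun_apply (f' x)) (at x)) \<and> continuous_on \<Omega> f')"

text \<open>Differentiability along \<open>S \<subseteq> slice_plane I\<close> with a differential that commutes with left
  multiplication by \<open>I\<close>, both on the plane and on the target. Only the values of the witness \<open>D\<close>
  on \<open>slice_plane I\<close> matter.\<close>
definition slice_holomorphic_on :: "quat \<Rightarrow> quat set \<Rightarrow> (quat \<Rightarrow> quat) \<Rightarrow> bool" where
  "slice_holomorphic_on I S f \<longleftrightarrow> (\<forall>z\<in>S. \<exists>D. (f has_derivative D) (at z within S) \<and>
     (\<forall>v\<in>slice_plane I. D (I * v) = I * D v))"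

definition locally_constant_on :: "quat set \<Rightarrow> (quat \<Rightarrow> quat) \<Rightarrow> bool" where
  "locally_constant_on S g \<longleftrightarrow>
     (\<forall>x\<in>S. \<exists>U. openin (top_of_set S) U \<and> x \<in> U \<and> g constant_on U)"

text \<open>Only the values of the functions on \<open>\<Omega>\<close> matter when \<open>\<Omega>\<close> is open.\<close>
definition SR_loc :: "quat set \<Rightarrow> (quat \<Rightarrow> quat) set" where
  "SR_loc \<Omega> = {f. C1_on \<Omega> f \<and>
     (\<forall>I\<in>imag_units. \<Omega> \<inter> slice_plane I \<noteq> {} \<longrightarrow>
        slice_holomorphic_on I (\<Omega> \<inter> slice_plane I) f) \<and>
     (\<forall>y\<in>\<Omega>. locally_constant_on (sphere_through y \<inter> \<Omega>) (dbar f) \<and>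
        locally_constant_on (sphere_through y \<inter> \<Omega>) (dbar (\<lambda>x. x * f x)))}"

text \<open>The normalized cone measure: a Borel set \<open>A\<close> of the unit sphere gets the proportion of the
  volume of the unit ball taken up by the rays from the origin through \<open>A\<close>. The lemmas below
  show that it is the unique rotation-invariant Borel probability measure on the sphere.\<close>
definition sphere_measure :: "quat measure" where
  "sphere_measure =
     restrict_space (distr (uniform_measure lborel (ball 0 1)) borel sgn) (sphere 0 1)"

lemma space_sphere_measure: "space sphere_measure = sphere 0 1"
  by (simp add: sphere_measure_def space_restrict_space)

lemma sets_sphere_measure: "sets sphere_measure = sets (restrict_space borel (sphere 0 1))"
  by (simp add: sphere_measure_def sets_restrict_space)

lemma emeasure_sphere_measure:
  assumes "A \<in> sets borel" "A \<subseteq> sphere 0 1"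
  shows "emeasure sphere_measure A =
    emeasure lborel {x \<in> ball 0 1. sgn x \<in> A} / emeasure lborel (ball (0::quat) 1)"
proof -
  have [measurable]: "(sgn :: quat \<Rightarrow> quat) \<in> borel_measurable borel"
    by (simp add: sgn_div_norm[abs_def])
  have eq: "ball 0 1 \<inter> sgn -` A = {x \<in> ball 0 1. sgn x \<in> A}" by auto
  have "sgn -` A \<in> sets (borel :: quat measure)"
    using measurable_sets[of sgn borel borel A] assms(1) by simp
  then show ?thesis
    using assms
    by (simp add: sphere_measure_def emeasure_restrict_space emeasure_distr emeasure_uniform_measure
        Int_absorb2 eq)
qed

lemma emeasure_sphere_measure_sphere: "emeasure sphere_measure (sphere 0 1) = 1"
proof -
  let ?B = "ball (0::quat) 1"
  have "unit_ball_vol (real DIM(quat)) \<noteq> 0"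
    using unit_ball_vol_pos[of "real DIM(quat)"] by linarith
  then have pos: "emeasure lborel ?B \<noteq> 0" "emeasure lborel ?B \<noteq> \<infinity>"
    by (simp_all add: emeasure_ball)
  have "{x \<in> ?B. sgn x \<in> sphere 0 1} = ?B - {0}"
    by (auto simp: norm_sgn)
  moreover have "emeasure lborel (?B - {0}) = emeasure lborel ?B"
    by (rule emeasure_Diff_null_set) (auto simp: null_sets_def)
  ultimately show ?thesis
    using pos by (simp add: emeasure_sphere_measure ennreal_divide_self less_top)
qed

definition quat_of_vec :: "real ^ 4 \<Rightarrow> quat" where
  "quat_of_vec v = Quat (v $ 1) (v $ 2) (v $ 3) (v $ 4)"

definition vec_of_quat :: "quat \<Rightarrow> real ^ 4" where
  "vec_of_quat x = vector [qRe x, qI x, qJ x, qK x]"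

lemma vec_of_quat_nth [simp]:
  "vec_of_quat x $ 1 = qRe x" "vec_of_quat x $ 2 = qI x"
  "vec_of_quat x $ 3 = qJ x" "vec_of_quat x $ 4 = qK x"
  by (simp_all add: vec_of_quat_def vector_def)

lemma quat_of_vec_inverse [simp]: "vec_of_quat (quat_of_vec v) = v"
  by (simp add: vec_eq_iff forall_4 quat_of_vec_def)

lemma vec_of_quat_inverse [simp]: "quat_of_vec (vec_of_quat x) = x"
  by (simp add: quat_eq_iff quat_of_vec_def)

lemma linear_quat_of_vec: "linear quat_of_vec"
  by (rule linearI) (simp_all add: quat_of_vec_def quat_eq_iff)

lemma linear_vec_of_quat: "linear vec_of_quat"
  by (rule linearI) (simp_all add: vec_eq_iff forall_4)

lemma inner_vec_of_quat: "vec_of_quat x \<bullet> vec_of_quat y = x \<bullet> y"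
  by (simp add: inner_vec_def sum_4 inner_quat_def)

lemma inner_quat_of_vec: "quat_of_vec x \<bullet> quat_of_vec y = x \<bullet> y"
  by (simp add: inner_vec_def sum_4 inner_quat_def quat_of_vec_def)

lemma borel_measurable_linear:
  fixes T :: "'a::euclidean_space \<Rightarrow> 'b::euclidean_space"
  shows "linear T \<Longrightarrow> T \<in> borel_measurable borel"
  by (simp add: borel_measurable_continuous_onI linear_continuous_on linear_conv_bounded_linear)

lemma lborel_distr_quat_of_vec: "distr lborel borel quat_of_vec = lborel"
proof (rule lborel_eqI[symmetric])
  fix l u :: quat
  assume le: "\<And>b. b \<in> Basis \<Longrightarrow> l \<bullet> b \<le> u \<bullet> b"
  have le': "qRe l \<le> qRe u" "qI l \<le> qI u" "qJ l \<le> qJ u" "qK l \<le> qK u"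
    using le[of 1] le[of ii] le[of jj] le[of kk]
    by (simp_all add: Basis_quat_def inner_quat_def quat_units_def)
  have "quat_of_vec -` box l u = box (vec_of_quat l) (vec_of_quat u)"
    by (auto simp: mem_box_cart forall_4 mem_box Basis_quat_def inner_quat_def quat_units_def
        quat_of_vec_def)
  then have "emeasure (distr lborel borel quat_of_vec) (box l u) =
      emeasure lborel (box (vec_of_quat l) (vec_of_quat u))"
    by (simp add: emeasure_distr borel_measurable_linear linear_quat_of_vec)
  also have "\<dots> = (\<Prod>b\<in>Basis. (vec_of_quat u - vec_of_quat l) \<bullet> b)"
  proof (rule emeasure_lborel_box)
    have "\<forall>i. vec_of_quat l $ i \<le> vec_of_quat u $ i"
      using le' by (simp add: forall_4)
    then show "vec_of_quat l \<bullet> b \<le> vec_of_quat u \<bullet> b" if "b \<in> Basis" for b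
      using that by (auto simp: Basis_vec_def inner_axis)
  qed
  also have "(\<Prod>b\<in>Basis. (vec_of_quat u - vec_of_quat l) \<bullet> b) =
      (\<Prod>b\<in>range (\<lambda>i::4. axis i 1). (vec_of_quat u - vec_of_quat l) \<bullet> b)"
    by (rule prod.cong) (auto simp: Basis_vec_def)
  also have "\<dots> = (\<Prod>i\<in>(UNIV::4 set). (vec_of_quat u - vec_of_quat l) $ i)"
    by (subst prod.reindex) (simp_all add: inj_on_def axis_eq_axis inner_axis)
  also have "\<dots> = (qRe u - qRe l) * (qI u - qI l) * (qJ u - qJ l) * (qK u - qK l)"
    unfolding UNIV_4 by (simp add: ac_simps)
  also have "\<dots> = (\<Prod>b\<in>Basis. (u - l) \<bullet> b)"
  proof -
    have "1 \<notin> {ii, jj, kk}" "ii \<notin> {jj, kk}" "jj \<notin> {kk}"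
      by (simp_all add: quat_eq_iff quat_units_def)
    then have "(\<Prod>b\<in>Basis. (u - l) \<bullet> b) =
        ((u - l) \<bullet> 1) * (((u - l) \<bullet> ii) * (((u - l) \<bullet> jj) * ((u - l) \<bullet> kk)))"
      by (simp add: Basis_quat_def)
    then show ?thesis
      by (simp add: inner_quat_def quat_units_def)
  qed
  finally show "emeasure (distr lborel borel quat_of_vec) (box l u) = (\<Prod>b\<in>Basis. (u - l) \<bullet> b)" .
qed simp

lemma lborel_distr_orthogonal_vec:
  fixes T :: "real ^ ('n::{finite,wellorder}) \<Rightarrow> real ^ 'n::_"
  assumes T: "orthogonal_transformation T"
  shows "distr lborel borel T = lborel"
proof (rule lborel_eqI[symmetric])
  fix l u :: "real ^ 'n::_"
  assume le: "\<And>b. b \<in> Basis \<Longrightarrow> l \<bullet> b \<le> u \<bullet> b"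
  have inv: "orthogonal_transformation (inv T)"
    using T by (rule orthogonal_transformation_inv)
  have meas: "T \<in> borel_measurable borel"
    using T by (simp add: borel_measurable_linear orthogonal_transformation_linear)
  have eq: "T -` box l u = inv T ` box l u"
    using orthogonal_transformation_bij[OF T] by (simp add: bij_vimage_eq_inv_image)
  have "inv T ` box l u \<in> lmeasurable"
    using inv by (intro measurable_orthogonal_image) auto
  then have fin: "emeasure lebesgue (inv T ` box l u) = measure lebesgue (inv T ` box l u)"
    by (rule emeasure_eq_measure2)
  have "T -` box l u \<in> sets lborel"
    using measurable_sets[OF meas, of "box l u"] by simp
  then have "emeasure (distr lborel borel T) (box l u) = emeasure lebesgue (inv T ` box l u)"
    using meas by (simp add: emeasure_distr eq)
  also have "\<dots> = measure lebesgue (box l u)"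
    unfolding fin by (subst measure_orthogonal_image[OF inv]) auto
  also have "\<dots> = (\<Prod>b\<in>Basis. (u - l) \<bullet> b)"
    using le by simp
  finally show "emeasure (distr lborel borel T) (box l u) = (\<Prod>b\<in>Basis. (u - l) \<bullet> b)" .
qed simp

lemma lborel_distr_orthogonal_quat:
  fixes T :: "quat \<Rightarrow> quat"
  assumes T: "orthogonal_transformation T"
  shows "distr lborel borel T = lborel"
proof -
  define T' where "T' = (\<lambda>v. vec_of_quat (T (quat_of_vec v)))"
  have lin: "linear T"
    using T by (rule orthogonal_transformation_linear)
  have lin': "linear T'"
    unfolding T'_def
    using linear_compose[OF linear_compose[OF linear_quat_of_vec lin] linear_vec_of_quat]
    by (simp add: o_def)
  have orth': "orthogonal_transformation T'"
    using T lin' by (simp add: orthogonal_transformation_def T'_def inner_vec_of_quat inner_quat_of_vec)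
  note [measurable] = borel_measurable_linear[OF lin] borel_measurable_linear[OF lin']
    borel_measurable_linear[OF linear_quat_of_vec]
  have "distr lborel borel T = distr (distr lborel borel quat_of_vec) borel T"
    by (simp add: lborel_distr_quat_of_vec)
  also have "\<dots> = distr lborel borel (T \<circ> quat_of_vec)"
    by (subst distr_distr) simp_all
  also have "T \<circ> quat_of_vec = quat_of_vec \<circ> T'"
    by (simp add: fun_eq_iff T'_def)
  also have "distr lborel borel (quat_of_vec \<circ> T') = distr (distr lborel borel T') borel quat_of_vec"
    by (subst distr_distr) simp_all
  also have "\<dots> = lborel"
    by (simp add: lborel_distr_orthogonal_vec[OF orth'] lborel_distr_quat_of_vec)
  finally show ?thesis .
qed

lemma measurable_orthogonal_sphere:
  fixes T :: "quat \<Rightarrow> quat"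
  assumes T: "orthogonal_transformation T"
  shows "T \<in> restrict_space borel (sphere 0 1) \<rightarrow>\<^sub>M restrict_space borel (sphere 0 1)"
  using borel_measurable_linear[OF orthogonal_transformation_linear[OF T]] T
  by (auto intro!: measurable_restrict_space3 simp: orthogonal_transformation)

theorem sphere_measure_rotation_invariant:
  fixes T :: "quat \<Rightarrow> quat"
  assumes T: "orthogonal_transformation T"
  shows "distr sphere_measure sphere_measure T = sphere_measure"
proof (rule measure_eqI)
  fix A assume "A \<in> sets (distr sphere_measure sphere_measure T)"
  then have A: "A \<in> sets sphere_measure" by simp
  then have A': "A \<in> sets borel" "A \<subseteq> sphere 0 1"
    by (auto simp: sets_sphere_measure sets_restrict_space)
  have meas: "T \<in> borel_measurable borel"
    using T by (simp add: borel_measurable_linear orthogonal_transformation_linear)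
  have measS: "T \<in> sphere_measure \<rightarrow>\<^sub>M sphere_measure"
    using measurable_orthogonal_sphere[OF T]
    by (simp add: sets_sphere_measure cong: measurable_cong_sets)
  have sgn_T: "sgn (T x) = T (sgn x)" "norm (T x) = norm x" for x
    using T by (simp_all add: sgn_div_norm orthogonal_transformation orthogonal_transformation_scaleR linear_cmul)
  let ?C = "\<lambda>A. {x \<in> ball 0 1. sgn x \<in> A}"
  have [measurable]: "(sgn :: quat \<Rightarrow> quat) \<in> borel_measurable borel"
    by (simp add: sgn_div_norm[abs_def])
  have C: "?C A \<in> sets borel"
    using measurable_sets[of sgn borel borel A] A' by (simp add: vimage_def)
  have pre: "T -` A \<inter> sphere 0 1 \<in> sets borel"
    using measurable_sets[OF meas A'(1)] by simp
  have eq: "?C (T -` A \<inter> sphere 0 1) = T -` ?C A"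
  proof -
    have "norm (sgn x) = 1" if "T (sgn x) \<in> A" for x
      using that A'(2) sgn_T(2)[of "sgn x"] by auto
    then show ?thesis by (auto simp: sgn_T)
  qed
  have "emeasure (distr sphere_measure sphere_measure T) A =
      emeasure sphere_measure (T -` A \<inter> sphere 0 1)"
    using A measS by (simp add: emeasure_distr space_sphere_measure)
  also have "\<dots> = emeasure lborel (T -` ?C A) / emeasure lborel (ball (0::quat) 1)"
    using emeasure_sphere_measure[OF pre] unfolding eq by simp
  also have "emeasure lborel (T -` ?C A) = emeasure (distr lborel borel T) (?C A)"
    using C meas by (simp add: emeasure_distr)
  also have "\<dots> = emeasure lborel (?C A)"
    by (simp add: lborel_distr_orthogonal_quat[OF T])
  also have "\<dots> / emeasure lborel (ball (0::quat) 1) = emeasure sphere_measure A"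
    using A' by (simp add: emeasure_sphere_measure)
  finally show "emeasure (distr sphere_measure sphere_measure T) A = emeasure sphere_measure A" .
qed simp

lemma orthogonal_transformation_quat_mult:
  fixes u :: quat
  assumes "norm u = 1"
  shows "orthogonal_transformation (\<lambda>x. u * x)" "orthogonal_transformation (\<lambda>x. x * u)"
  using assms by (simp_all add: orthogonal_transformation norm_mult linear_iff algebra_simps)

theorem sphere_measure_unique:
  assumes sets: "sets \<mu> = sets (restrict_space borel (sphere (0::quat) 1))"
    and prob: "emeasure \<mu> (sphere 0 1) = 1"
    and inv: "\<And>T. orthogonal_transformation T \<Longrightarrow> distr \<mu> \<mu> T = \<mu>"
  shows "\<mu> = sphere_measure"
proof (rule measure_eqI)
  let ?S = "restrict_space borel (sphere (0::quat) 1)"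
  show "sets \<mu> = sets sphere_measure"
    by (simp add: sets sets_sphere_measure)
  have space: "space \<mu> = sphere 0 1"
    using sets_eq_imp_space_eq[OF sets] by (simp add: space_restrict_space)
  interpret M: finite_measure \<mu>
    by (rule finite_measureI) (simp add: space prob)
  interpret S: finite_measure sphere_measure
    by (rule finite_measureI) (simp add: space_sphere_measure emeasure_sphere_measure_sphere)
  interpret P: pair_sigma_finite \<mu> sphere_measure ..
  fix A assume A: "A \<in> sets \<mu>"
  have A': "A \<in> sets sphere_measure" "A \<in> sets ?S"
    using A by (simp_all add: sets sets_sphere_measure)
  have translate: "(\<integral>\<^sup>+ x. indicator A (T x) \<partial>\<nu>) = emeasure \<nu> A"
    if "sets \<nu> = sets ?S" "distr \<nu> \<nu> T = \<nu>" "orthogonal_transformation T" for \<nu> and T :: "quat \<Rightarrow> quat"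
  proof -
    have [measurable]: "T \<in> \<nu> \<rightarrow>\<^sub>M \<nu>" "A \<in> sets \<nu>"
      using measurable_orthogonal_sphere[OF that(3)] A'(2) that(1)
      by (simp_all cong: measurable_cong_sets)
    have "emeasure \<nu> A = (\<integral>\<^sup>+ x. indicator A x \<partial>distr \<nu> \<nu> T)"
      by (simp add: that(2))
    also have "\<dots> = (\<integral>\<^sup>+ x. indicator A (T x) \<partial>\<nu>)"
      by (rule nn_integral_distr) simp_all
    finally show ?thesis ..
  qed
  have mult: "(\<lambda>p. fst p * snd p) \<in> \<mu> \<Otimes>\<^sub>M sphere_measure \<rightarrow>\<^sub>M ?S"
  proof (rule measurable_restrict_space2)
    show "(\<lambda>p. fst p * snd p) \<in> space (\<mu> \<Otimes>\<^sub>M sphere_measure) \<rightarrow> sphere 0 1"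
      by (auto simp: space_pair_measure space space_sphere_measure norm_mult)
    have [measurable]: "(\<lambda>x. x) \<in> borel_measurable \<mu>" "(\<lambda>x. x) \<in> borel_measurable sphere_measure"
      by (simp_all add: sets sets_sphere_measure measurable_restrict_space1 cong: measurable_cong_sets)
    have [measurable]: "fst \<in> borel_measurable (\<mu> \<Otimes>\<^sub>M sphere_measure)"
      "snd \<in> borel_measurable (\<mu> \<Otimes>\<^sub>M sphere_measure)"
      using measurable_compose[OF measurable_fst, of "\<lambda>x. x" \<mu> borel sphere_measure]
        measurable_compose[OF measurable_snd, of "\<lambda>x. x" sphere_measure borel \<mu>] by simp_all
    show "(\<lambda>p. fst p * snd p) \<in> borel_measurable (\<mu> \<Otimes>\<^sub>M sphere_measure)"
      by measurable
  qed
  have "emeasure \<mu> A = (\<integral>\<^sup>+ v. emeasure \<mu> A \<partial>sphere_measure)"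
    by (simp add: space_sphere_measure emeasure_sphere_measure_sphere)
  also have "\<dots> = (\<integral>\<^sup>+ v. (\<integral>\<^sup>+ u. indicator A (u * v) \<partial>\<mu>) \<partial>sphere_measure)"
    by (intro nn_integral_cong translate[symmetric] inv orthogonal_transformation_quat_mult sets)
      (simp_all add: space_sphere_measure)
  also have "\<dots> = (\<integral>\<^sup>+ u. (\<integral>\<^sup>+ v. indicator A (u * v) \<partial>sphere_measure) \<partial>\<mu>)"
    by (rule P.Fubini')
      (use measurable_compose[OF mult borel_measurable_indicator[OF A'(2)]] in \<open>simp add: case_prod_unfold\<close>)
  also have "\<dots> = (\<integral>\<^sup>+ u. emeasure sphere_measure A \<partial>\<mu>)"
    by (intro nn_integral_cong translate sets_sphere_measure sphere_measure_rotation_invariant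
        orthogonal_transformation_quat_mult) (simp_all add: space)
  also have "\<dots> = emeasure sphere_measure A"
    by (simp add: space prob)
  finally show "emeasure \<mu> A = emeasure sphere_measure A" .
qed

end

theory Submission
  imports Defs "HOL-Complex_Analysis.Cauchy_Integral_Formula"
begin

text \<open>
  Write \<open>D = \<partial>\<^sub>0 + i\<partial>\<^sub>1 + j\<partial>\<^sub>2 + k\<partial>\<^sub>3\<close>, let \<open>D'\<close> be its conjugate, \<open>g = D f / 2\<close> and \<open>k = D' g\<close>.
  If \<open>f\<close>, \<open>g\<close>, \<open>k\<close> are \<open>C\<^sup>1\<close> and \<open>D k = 0\<close>, the formula follows by differentiating spherical means in
  the radius \<open>t\<close>. On the unit sphere \<open>D\<close> is a radial derivative plus derivatives along the flows
  \<open>z \<mapsto> z e\<^sup>s\<^sup>u\<close> and \<open>z \<mapsto> e\<^sup>s\<^sup>u z\<close>, whose means vanish by rotation invariance. With \<open>M\<close>, \<open>N\<close> the means of \<open>f\<close>, \<open>k\<close>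
  and \<open>h\<close> the mean of \<open>qcnj z * g\<close> this gives \<open>M' = 2 h\<close>, \<open>(t\<^sup>3 h)' = t\<^sup>3 N\<close> and \<open>N' = 0\<close>; hence
  \<open>h = t k(a) / 4\<close> and \<open>M = f(a) + t\<^sup>2 k(a) / 4 = f(a) + t h\<close>.

  The regularity comes from slice holomorphy. It yields \<open>f = qcnj x * g - h'\<close> with \<open>h' = dbar (x f)\<close>, and
  since \<open>g\<close> and \<open>h'\<close> are locally constant on spheres, locally \<open>f(\<alpha> + \<beta> I) = A(\<alpha>, \<beta>) + I B(\<alpha>, \<beta>)\<close>. Here \<open>A\<close> and \<open>B\<close>
  are determined by \<open>f\<close> on two slices, so that the components of \<open>A + \<i> B\<close> are holomorphic. Then
  \<open>g = - B / \<beta>\<close>, and everything is smooth and explicit off the real axis. Across the real axis \<open>g\<close> and \<open>k\<close>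
  are the averages of \<open>- f'\<close> and \<open>- 2 t f''\<close> (slice derivatives) over the segment from \<open>qcnj x\<close> to \<open>x\<close>.
\<close>

section \<open>Integration over the sphere\<close>

text \<open>Dominated convergence: the remainder of the first-order expansion, divided by the
  increment, tends to zero pointwise. The mean value inequality bounds it by a constant, which is
  integrable because the measure is finite.\<close>

lemma has_vector_derivative_integral:
  fixes F :: "real \<Rightarrow> 'b \<Rightarrow> 'a::{banach,second_countable_topology}"
  assumes fin: "finite_measure M" and T: "open T" "convex T" "t0 \<in> T"
    and int: "\<And>t. t \<in> T \<Longrightarrow> integrable M (F t)" and int': "integrable M (F' t0)"
    and der: "\<And>t z. t \<in> T \<Longrightarrow> z \<in> space M \<Longrightarrow> ((\<lambda>t. F t z) has_vector_derivative F' t z) (at t)"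
    and bd: "\<And>t z. t \<in> T \<Longrightarrow> z \<in> space M \<Longrightarrow> norm (F' t z) \<le> C"
  shows "((\<lambda>t. \<integral>z. F t z \<partial>M) has_vector_derivative (\<integral>z. F' t0 z \<partial>M)) (at t0)"
proof -
  interpret finite_measure M by fact
  define q where "q t z = (F t z - F t0 z - (t - t0) *\<^sub>R F' t0 z) /\<^sub>R norm (t - t0)" for t z
  have q_lim: "((\<lambda>t. q t z) \<longlongrightarrow> 0) (at t0)" if "z \<in> space M" for z
  proof -
    have "((\<lambda>t. ((F t z - F t0 z) - (t - t0) *\<^sub>R F' t0 z) /\<^sub>R norm (t - t0)) \<longlongrightarrow> 0) (at t0)"
      using der[OF T(3) that] unfolding has_vector_derivative_def has_derivative_def
      by (simp add: Lim_ident_at)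
    then show ?thesis unfolding q_def .
  qed
  have q_bd: "norm (q t z) \<le> 2 * \<bar>C\<bar>" if "t \<in> T" "t \<noteq> t0" "z \<in> space M" for t z
  proof -
    have "norm (F t z - F t0 z) \<le> C * norm (t - t0)"
    proof (rule differentiable_bound[OF T(2)])
      show "((\<lambda>t. F t z) has_derivative (\<lambda>h. h *\<^sub>R F' s z)) (at s within T)" if "s \<in> T" for s
        using der[OF that \<open>z \<in> space M\<close>]
        unfolding has_vector_derivative_def by (rule has_derivative_at_withinI)
      show "onorm (\<lambda>h. h *\<^sub>R F' s z) \<le> C" if "s \<in> T" for s
        using bd[OF that \<open>z \<in> space M\<close>]
        by (intro onorm_le) (simp add: mult.commute[of C] mult_left_mono)
    qed (use that T in auto)
    moreover have "norm ((t - t0) *\<^sub>R F' t0 z) \<le> C * norm (t - t0)"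
      using bd[OF T(3) that(3)] by (simp add: mult.commute[of C] mult_left_mono)
    ultimately have "norm (F t z - F t0 z - (t - t0) *\<^sub>R F' t0 z) \<le> 2 * \<bar>C\<bar> * norm (t - t0)"
    proof -
      have "norm (F t z - F t0 z - (t - t0) *\<^sub>R F' t0 z) \<le> C * norm (t - t0) + C * norm (t - t0)"
        using norm_triangle_ineq4[of "F t z - F t0 z" "(t - t0) *\<^sub>R F' t0 z"]
          \<open>norm (F t z - F t0 z) \<le> C * norm (t - t0)\<close>
          \<open>norm ((t - t0) *\<^sub>R F' t0 z) \<le> C * norm (t - t0)\<close>
        by (simp add: algebra_simps)
      also have "\<dots> \<le> 2 * \<bar>C\<bar> * norm (t - t0)"
        by (simp add: mult_right_mono)
      finally show ?thesis .
    qed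
    then have "norm (F t z - F t0 z - (t - t0) *\<^sub>R F' t0 z) / norm (t - t0) \<le> 2 * \<bar>C\<bar>"
      using that by (intro mult_imp_div_pos_le) auto
    then show ?thesis
      by (simp add: q_def divide_inverse mult.commute del: scaleR_diff_left)
  qed
  have ev: "eventually (\<lambda>t. t \<in> T \<and> t \<noteq> t0) (at t0)"
    using eventually_at_in_open[OF T(1,3)] by (simp add: eventually_conj_iff)
  have "((\<lambda>t. \<integral>z. q t z \<partial>M) \<longlongrightarrow> (\<integral>z. 0 \<partial>M)) (at t0)"
    unfolding tendsto_at_iff_sequentially comp_def
  proof (intro allI impI)
    fix X :: "nat \<Rightarrow> real"
    assume X: "\<forall>i. X i \<in> UNIV - {t0}" "X \<longlonglongrightarrow> t0"
    then have flt: "filterlim X (at t0) sequentially"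
      by (simp add: filterlim_at)
    have "eventually (\<lambda>n. X n \<in> T \<and> X n \<noteq> t0) sequentially"
      using eventually_compose_filterlim[OF ev flt] .
    then obtain N where N: "\<And>n. n \<ge> N \<Longrightarrow> X n \<in> T \<and> X n \<noteq> t0"
      by (auto simp: eventually_sequentially)
    \<comment> \<open>Shifting by \<open>N\<close> puts every term of the sequence into
      \<open>T\<close>, where \<open>q_bd\<close> applies; \<open>LIMSEQ_offset\<close> removes the
      shift.\<close>
    have "(\<lambda>n. \<integral>z. q (X (n + N)) z \<partial>M) \<longlonglongrightarrow> (\<integral>z. 0 \<partial>M)"
    proof (rule integral_dominated_convergence[where w = "\<lambda>_. 2 * \<bar>C\<bar>"])
      show "q (X (n + N)) \<in> borel_measurable M" for n
        unfolding q_def using int[of "X (n+N)"] int[OF T(3)] int' N[of "n+N"]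
        by (intro borel_measurable_scaleR borel_measurable_diff borel_measurable_add borel_measurable_const
            borel_measurable_integrable) auto
      show "AE z in M. (\<lambda>n. q (X (n + N)) z) \<longlonglongrightarrow> 0"
      proof (rule AE_I2)
        fix z assume "z \<in> space M"
        show "(\<lambda>n. q (X (n + N)) z) \<longlonglongrightarrow> 0"
          using LIMSEQ_ignore_initial_segment[OF filterlim_compose[OF q_lim[OF \<open>z \<in> space M\<close>] flt], of N] .
      qed
      show "AE z in M. norm (q (X (n + N)) z) \<le> 2 * \<bar>C\<bar>" for n
        using N[of "n+N"] q_bd by (intro AE_I2) auto
    qed auto
    then show "(\<lambda>n. \<integral>z. q (X n) z \<partial>M) \<longlonglongrightarrow> (\<integral>z. 0 \<partial>M)"
      by (rule LIMSEQ_offset)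
  qed
  moreover have "eventually (\<lambda>t. (\<integral>z. q t z \<partial>M) =
      ((\<integral>z. F t z \<partial>M) - (\<integral>z. F t0 z \<partial>M) - (t - t0) *\<^sub>R (\<integral>z. F' t0 z \<partial>M)) /\<^sub>R norm (t - t0)) (at t0)"
    using ev
  proof eventually_elim
    case (elim t)
    have [simp]: "integrable M (F t)" "integrable M (F t0)" "integrable M (F' t0)"
      using elim T int int' by auto
    show ?case unfolding q_def by simp
  qed
  ultimately have "((\<lambda>t. ((\<integral>z. F t z \<partial>M) - (\<integral>z. F t0 z \<partial>M) - (t - t0) *\<^sub>R (\<integral>z. F' t0 z \<partial>M))
      /\<^sub>R norm (t - t0)) \<longlongrightarrow> (\<integral>z. 0 \<partial>M)) (at t0)"
    by (rule Lim_transform_eventually)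
  then show ?thesis
    unfolding has_vector_derivative_def has_derivative_at_within
    by (simp only: bounded_linear_scaleR_left Bochner_Integration.integral_zero simp_thms)
qed

section \<open>Integrals over the unit sphere and their invariance under rotations\<close>

lemma finite_measure_sphere_measure: "finite_measure sphere_measure"
  by (rule finite_measureI) (simp add: space_sphere_measure emeasure_sphere_measure_sphere)

lemma integrable_sphere_measure:
  fixes F :: "quat \<Rightarrow> 'a::{banach,second_countable_topology}"
  assumes "continuous_on (sphere 0 1) F"
  shows "integrable sphere_measure F"
proof -
  interpret finite_measure sphere_measure
    by (rule finite_measure_sphere_measure)
  have "bounded (F ` sphere 0 1)"
    using assms by (intro compact_imp_bounded compact_continuous_image) auto
  then obtain B where "\<And>z. z \<in> sphere 0 1 \<Longrightarrow> norm (F z) \<le> B"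
    unfolding bounded_iff by blast
  moreover have "F \<in> borel_measurable sphere_measure"
    using borel_measurable_continuous_on_restrict[OF assms] sets_sphere_measure
    by (simp cong: measurable_cong_sets)
  ultimately show ?thesis
    by (intro integrable_const_bound[of _ B]) (auto simp: space_sphere_measure)
qed

lemma integral_sphere_measure_orthogonal:
  fixes F :: "quat \<Rightarrow> 'a::{banach,second_countable_topology}"
  assumes T: "orthogonal_transformation T" and F: "continuous_on (sphere 0 1) F"
  shows "(\<integral>z. F (T z) \<partial>sphere_measure) = (\<integral>z. F z \<partial>sphere_measure)"
proof -
  have "T \<in> sphere_measure \<rightarrow>\<^sub>M sphere_measure"
    using measurable_orthogonal_sphere[OF T]
    by (simp add: sets_sphere_measure cong: measurable_cong_sets)
  moreover have "F \<in> borel_measurable sphere_measure"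
    by (rule borel_measurable_integrable[OF integrable_sphere_measure[OF F]])
  ultimately show ?thesis
    using integral_distr[of T sphere_measure sphere_measure F]
    unfolding sphere_measure_rotation_invariant[OF T] by metis
qed

lemma measure_sphere_measure [simp]: "measure sphere_measure (space sphere_measure) = 1"
  by (simp add: space_sphere_measure measure_def emeasure_sphere_measure_sphere)

text \<open>By rotation invariance the mean of \<open>H\<close> composed with \<open>T t\<close>
  does not depend on \<open>t\<close>, so its derivative at time zero vanishes. \<open>X\<close> is
  the velocity field of the flow \<open>T\<close>.\<close>

lemma integral_sphere_measure_rotation_derivative:
  fixes H :: "quat \<Rightarrow> quat" and H' :: "quat \<Rightarrow> quat \<Rightarrow>\<^sub>L quat" and T :: "real \<Rightarrow> quat \<Rightarrow> quat"
  assumes orth: "\<And>t. orthogonal_transformation (T t)" and T0: "\<And>z. T 0 z = z"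
    and dT: "\<And>t z. ((\<lambda>t. T t z) has_vector_derivative X (T t z)) (at t)"
    and X: "continuous_on UNIV X"
    and H: "\<And>z. z \<in> sphere 0 1 \<Longrightarrow> (H has_derivative H' z) (at z)"
    and H': "continuous_on (sphere 0 1) H'"
  shows "(\<integral>z. H' z (X z) \<partial>sphere_measure) = 0"
proof -
  have cont: "continuous_on (sphere 0 1) H"
    using H has_derivative_continuous by (intro continuous_at_imp_continuous_on) blast
  have cont': "continuous_on (sphere 0 1) (\<lambda>z. H' z (X z))"
    using H' X by (intro continuous_intros) (auto intro: continuous_on_subset)
  have T_sphere: "T t z \<in> sphere 0 1" if "z \<in> sphere 0 1" for t z
    using orth[of t] that by (simp add: orthogonal_transformation)
  have contT: "continuous_on A (T t)" for t A
    using orth[of t] by (simp add: linear_continuous_on linear_linear orthogonal_transformation_linear)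
  have "bounded ((\<lambda>z. H' z (X z)) ` sphere 0 1)"
    using cont' by (intro compact_imp_bounded compact_continuous_image) auto
  then obtain C where C: "\<And>z. z \<in> sphere 0 1 \<Longrightarrow> norm (H' z (X z)) \<le> C"
    unfolding bounded_iff by blast
  have "((\<lambda>t. \<integral>z. H (T t z) \<partial>sphere_measure) has_vector_derivative
      (\<integral>z. H' (T 0 z) (X (T 0 z)) \<partial>sphere_measure)) (at 0)"
  proof (rule has_vector_derivative_integral[where T = UNIV and C = C])
    show "integrable sphere_measure (\<lambda>z. H (T t z))" for t
      using T_sphere by (intro integrable_sphere_measure continuous_on_compose2[OF cont contT]) auto
    show "integrable sphere_measure (\<lambda>z. H' (T 0 z) (X (T 0 z)))"
      unfolding T0 by (rule integrable_sphere_measure[OF cont'])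
    show "((\<lambda>t. H (T t z)) has_vector_derivative H' (T t z) (X (T t z))) (at t)"
      if "z \<in> space sphere_measure" for t z
      using has_derivative_compose[OF dT[unfolded has_vector_derivative_def] H[OF T_sphere]] that
      by (simp add: space_sphere_measure has_vector_derivative_def blinfun.scaleR_right)
    show "norm (H' (T t z) (X (T t z))) \<le> C" if "z \<in> space sphere_measure" for t z
      using that T_sphere C by (simp add: space_sphere_measure)
  qed (simp_all add: finite_measure_sphere_measure)
  moreover have "(\<lambda>t. \<integral>z. H (T t z) \<partial>sphere_measure) = (\<lambda>t. \<integral>z. H z \<partial>sphere_measure)"
    by (simp add: integral_sphere_measure_orthogonal[OF orth cont])
  ultimately have "((\<lambda>t::real. \<integral>z. H z \<partial>sphere_measure) has_vector_derivative
      (\<integral>z. H' z (X z) \<partial>sphere_measure)) (at 0)"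
    by (simp add: T0)
  then show ?thesis
    by (rule vector_derivative_unique_at) (rule has_vector_derivative_const)
qed

section \<open>The flows of left and right multiplication by e^(t u)\<close>

definition rot :: "quat \<Rightarrow> real \<Rightarrow> quat" where
  "rot u t = of_real (cos t) + sin t *\<^sub>R u"

lemma quat_of_real_sel [simp]:
  "qRe (of_real r) = r" "qI (of_real r) = 0" "qJ (of_real r) = 0" "qK (of_real r) = 0"
  by (simp_all add: of_real_def)

lemma norm_quat_squared: "(norm x)\<^sup>2 = (qRe x)\<^sup>2 + (qI x)\<^sup>2 + (qJ x)\<^sup>2 + (qK x)\<^sup>2"
  for x :: quat
  by (simp add: norm_quat_def)

lemma rot_0 [simp]: "rot u 0 = 1"
  by (simp add: rot_def)

lemma norm_rot:
  assumes "qRe u = 0" "norm u = 1"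
  shows "norm (rot u t) = 1"
proof -
  have "(norm (rot u t))\<^sup>2 = (cos t)\<^sup>2 + (sin t)\<^sup>2 * (norm u)\<^sup>2"
    unfolding norm_quat_squared by (simp add: rot_def assms(1) distrib_left power_mult_distrib)
  also have "\<dots> = 1\<^sup>2"
    by (simp add: assms(2))
  finally show ?thesis
    by (rule power2_eq_imp_eq) simp_all
qed

text \<open>Both forms agree since \<open>u\<close> commutes with \<open>rot u t\<close>. The first
  serves left multiplication, the second right multiplication: each expresses the velocity through
  the moving point.\<close>

lemma rot_has_vector_derivative:
  assumes "u * u = - 1"
  shows "(rot u has_vector_derivative u * rot u t) (at t)"
    and "(rot u has_vector_derivative rot u t * u) (at t)"
proof -
  have "(rot u has_vector_derivative (- sin t) *\<^sub>R 1 + cos t *\<^sub>R u) (at t)"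
    unfolding rot_def[abs_def] of_real_def
    by (auto intro!: derivative_eq_intros)
  moreover have "u * rot u t = (- sin t) *\<^sub>R 1 + cos t *\<^sub>R u"
    "rot u t * u = (- sin t) *\<^sub>R 1 + cos t *\<^sub>R u"
    using assms by (simp_all add: rot_def of_real_def algebra_simps)
  ultimately show "(rot u has_vector_derivative u * rot u t) (at t)"
    "(rot u has_vector_derivative rot u t * u) (at t)" by simp_all
qed

lemma
  fixes H :: "quat \<Rightarrow> quat" and H' :: "quat \<Rightarrow> quat \<Rightarrow>\<^sub>L quat"
  assumes u: "u * u = - 1" "qRe u = 0" "norm u = 1"
    and H: "\<And>z. z \<in> sphere 0 1 \<Longrightarrow> (H has_derivative H' z) (at z)"
    and H': "continuous_on (sphere 0 1) H'"
  shows integral_sphere_measure_left_rotation: "(\<integral>z. H' z (u * z) \<partial>sphere_measure) = 0"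
    and integral_sphere_measure_right_rotation: "(\<integral>z. H' z (z * u) \<partial>sphere_measure) = 0"
proof -
  show "(\<integral>z. H' z (u * z) \<partial>sphere_measure) = 0"
    by (rule integral_sphere_measure_rotation_derivative[where T = "\<lambda>t z. rot u t * z" and H = H])
      (use u H H' in \<open>auto intro!: orthogonal_transformation_quat_mult norm_rot continuous_intros
        has_vector_derivative_mult_left rot_has_vector_derivative simp: mult.assoc[symmetric]\<close>)
  show "(\<integral>z. H' z (z * u) \<partial>sphere_measure) = 0"
    by (rule integral_sphere_measure_rotation_derivative[where T = "\<lambda>t z. z * rot u t" and H = H])
      (use u H H' in \<open>auto intro!: orthogonal_transformation_quat_mult norm_rot continuous_intros
        has_vector_derivative_mult_right rot_has_vector_derivative simp: mult.assoc\<close>)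
qed

section \<open>The operators \<open>D\<close> and \<open>D'\<close> as functionals of a
  differential, in frames adapted to the unit sphere\<close>

definition fueter :: "(quat \<Rightarrow> quat) \<Rightarrow> quat" where
  "fueter L = L 1 + ii * L ii + jj * L jj + kk * L kk"

definition fueter_cnj :: "(quat \<Rightarrow> quat) \<Rightarrow> quat" where
  "fueter_cnj L = L 1 - ii * L ii - jj * L jj - kk * L kk"

lemma quat_unit_sel [simp]:
  "qRe ii = 0" "qI ii = 1" "qJ ii = 0" "qK ii = 0"
  "qRe jj = 0" "qI jj = 0" "qJ jj = 1" "qK jj = 0"
  "qRe kk = 0" "qI kk = 0" "qJ kk = 0" "qK kk = 1"
  by (simp_all add: quat_units_def)

lemma quat_numeral_sel [simp]:
  "qRe (numeral n) = numeral n" "qI (numeral n) = 0" "qJ (numeral n) = 0" "qK (numeral n) = 0"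
  using quat_of_real_sel[of "numeral n"] by simp_all

lemma norm_quat_units [simp]: "norm ii = 1" "norm jj = 1" "norm kk = 1"
  by (simp_all add: norm_quat_def)

lemma norm_qcnj [simp]: "norm (qcnj x) = norm x"
  by (simp add: norm_quat_def)

lemma linear_quat_expand:
  assumes "linear L"
  shows "L v = qRe v *\<^sub>R L 1 + qI v *\<^sub>R L ii + qJ v *\<^sub>R L jj + qK v *\<^sub>R L kk"
proof -
  have "v = qRe v *\<^sub>R 1 + qI v *\<^sub>R ii + qJ v *\<^sub>R jj + qK v *\<^sub>R kk"
    by (simp add: quat_eq_iff)
  then have "L v = L (qRe v *\<^sub>R 1 + qI v *\<^sub>R ii + qJ v *\<^sub>R jj + qK v *\<^sub>R kk)"
    by simp
  then show ?thesis
    by (simp add: linear_add[OF assms] linear_scale[OF assms])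
qed

text \<open>The sum of \<open>e * L e\<close> over an orthonormal basis does not depend on the
  basis. For unit \<open>z\<close> one such basis is \<open>z\<close>, \<open>z * ii\<close>,
  \<open>z * jj\<close>, \<open>z * kk\<close>: the radial direction and the velocities of three
  right rotations. Other \<open>z\<close> follow by homogeneity.\<close>

lemma qcnj_mult_fueter:
  assumes L: "linear L"
  shows "qcnj z * fueter L = L z + ii * L (z * ii) + jj * L (z * jj) + kk * L (z * kk)"
  unfolding linear_quat_expand[OF L, of z] linear_quat_expand[OF L, of "z * ii"]
    linear_quat_expand[OF L, of "z * jj"] linear_quat_expand[OF L, of "z * kk"] fueter_def
  by (simp add: quat_eq_iff algebra_simps)

text \<open>The same change of basis for the sum of \<open>qcnj e * L e\<close>, with the frame
  \<open>z\<close>, \<open>ii * z\<close>, \<open>jj * z\<close>, \<open>kk * z\<close> of left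
  rotations. This order puts the factor \<open>qcnj z\<close> outermost, as the weight in the means
  of \<open>qcnj z * g\<close> requires.\<close>

lemma norm_squared_fueter_cnj:
  assumes L: "linear L"
  shows "(norm z)\<^sup>2 *\<^sub>R fueter_cnj L =
    qcnj z * L z - qcnj z * ii * L (ii * z) - qcnj z * jj * L (jj * z) - qcnj z * kk * L (kk * z)"
  unfolding linear_quat_expand[OF L, of z] linear_quat_expand[OF L, of "ii * z"]
    linear_quat_expand[OF L, of "jj * z"] linear_quat_expand[OF L, of "kk * z"] fueter_cnj_def
    norm_quat_squared
  by (simp add: quat_eq_iff algebra_simps power2_eq_square)

lemma bounded_linear_qcnj: "bounded_linear qcnj"
  by (rule bounded_linear_intro[where K = 1])
    (simp_all add: quat_eq_iff)

lemmas continuous_on_qcnj [continuous_intros] = bounded_linear.continuous_on[OF bounded_linear_qcnj]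

section \<open>Spherical means as functions of the radius\<close>

lemma sphere_in_cball: "norm z = 1 \<Longrightarrow> \<bar>t\<bar> \<le> R \<Longrightarrow> a + t *\<^sub>R z \<in> cball a R"
  for a z :: "'a::real_normed_vector"
  by (simp add: dist_norm)

lemma weighted_sphere_mean_derivative:
  fixes F w :: "quat \<Rightarrow> quat" and F' :: "quat \<Rightarrow> quat \<Rightarrow>\<^sub>L quat"
  assumes F: "\<And>x. x \<in> cball a R \<Longrightarrow> (F has_derivative F' x) (at x)"
    and F': "continuous_on (cball a R) F'" and w: "continuous_on (sphere 0 1) w" and t: "\<bar>t\<bar> < R"
  shows "((\<lambda>t. \<integral>z. w z * F (a + t *\<^sub>R z) \<partial>sphere_measure) has_vector_derivative
    (\<integral>z. w z * F' (a + t *\<^sub>R z) z \<partial>sphere_measure)) (at t)"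
proof -
  have contF: "continuous_on (cball a R) F"
    using F has_derivative_continuous by (intro continuous_at_imp_continuous_on) blast
  obtain W where W: "\<And>z. z \<in> sphere 0 1 \<Longrightarrow> norm (w z) \<le> W"
    using compact_imp_bounded[OF compact_continuous_image[OF w compact_sphere]]
    unfolding bounded_iff by blast
  obtain B where B: "\<And>x. x \<in> cball a R \<Longrightarrow> norm (F' x) \<le> B"
    using compact_imp_bounded[OF compact_continuous_image[OF F' compact_cball]]
    unfolding bounded_iff by blast
  show ?thesis
  proof (rule has_vector_derivative_integral[where T = "{-R<..<R}" and C = "W * B"])
    show "integrable sphere_measure (\<lambda>z. w z * F (a + s *\<^sub>R z))" if "s \<in> {-R<..<R}" for s
      using w that
      by (intro integrable_sphere_measure continuous_on_mult continuous_on_compose2[OF contF])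
        (auto intro!: continuous_intros sphere_in_cball simp del: mem_cball)
    have "continuous_on (sphere 0 1) (\<lambda>z. F' (a + t *\<^sub>R z))"
      using t by (intro continuous_on_compose2[OF F'])
        (auto intro!: continuous_intros sphere_in_cball simp del: mem_cball)
    then show "integrable sphere_measure (\<lambda>z. w z * F' (a + t *\<^sub>R z) z)"
      using w by (intro integrable_sphere_measure continuous_intros)
    show "((\<lambda>t. w z * F (a + t *\<^sub>R z)) has_vector_derivative w z * F' (a + s *\<^sub>R z) z) (at s)"
      if "s \<in> {-R<..<R}" "z \<in> space sphere_measure" for s z
    proof -
      have "a + s *\<^sub>R z \<in> cball a R"
        using that by (auto simp: space_sphere_measure intro!: sphere_in_cball simp del: mem_cball)
      from F[OF this] have "((\<lambda>t. F (a + t *\<^sub>R z)) has_derivative (\<lambda>h. F' (a + s *\<^sub>R z) (h *\<^sub>R z))) (at s)"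
        by (rule has_derivative_compose[rotated]) (auto intro!: derivative_eq_intros)
      then show ?thesis
        by (intro has_vector_derivative_mult_right)
          (simp add: has_vector_derivative_def blinfun.scaleR_right)
    qed
    show "norm (w z * F' (a + s *\<^sub>R z) z) \<le> W * B"
      if "s \<in> {-R<..<R}" "z \<in> space sphere_measure" for s z
    proof -
      have *: "a + s *\<^sub>R z \<in> cball a R" "norm z = 1"
        using that by (auto simp: space_sphere_measure intro!: sphere_in_cball simp del: mem_cball)
      have "norm (F' (a + s *\<^sub>R z) z) \<le> B"
        using norm_blinfun[of "F' (a + s *\<^sub>R z)" z] B[OF *(1)] *(2) by simp
      then show ?thesis
        using W[of z] * order_trans[OF norm_ge_zero W[of z]]
        unfolding norm_mult by (intro mult_mono) auto
    qed
  qed (use t in \<open>auto simp: finite_measure_sphere_measure\<close>)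
qed

lemma integrable_sphere_blinfun:
  fixes F' :: "quat \<Rightarrow> quat \<Rightarrow>\<^sub>L quat"
  assumes F': "continuous_on (cball a R) F'" and t: "\<bar>t\<bar> \<le> R"
    and w: "continuous_on (sphere 0 1) w" and v: "continuous_on (sphere 0 1) v"
  shows "integrable sphere_measure (\<lambda>z. w z * F' (a + t *\<^sub>R z) (v z))"
proof -
  have "continuous_on (sphere 0 1) (\<lambda>z. F' (a + t *\<^sub>R z))"
    using t by (intro continuous_on_compose2[OF F'])
      (auto intro!: continuous_intros sphere_in_cball simp del: mem_cball)
  then show ?thesis
    using w v by (intro integrable_sphere_measure continuous_intros)
qed

text \<open>By \<open>qcnj_mult_fueter\<close> the integrand is the radial derivative of
  \<open>F\<close> plus three derivatives along right rotations, whose means vanish.\<close>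

lemma sphere_mean_derivative_fueter:
  fixes F :: "quat \<Rightarrow> quat" and F' :: "quat \<Rightarrow> quat \<Rightarrow>\<^sub>L quat"
  assumes F: "\<And>x. x \<in> cball a R \<Longrightarrow> (F has_derivative F' x) (at x)"
    and F': "continuous_on (cball a R) F'" and t: "0 < t" "t < R"
  shows "((\<lambda>t. \<integral>z. F (a + t *\<^sub>R z) \<partial>sphere_measure) has_vector_derivative
    (\<integral>z. qcnj z * fueter (F' (a + t *\<^sub>R z)) \<partial>sphere_measure)) (at t)"
proof -
  have zero: "(\<integral>z. u * F' (a + t *\<^sub>R z) (z * u) \<partial>sphere_measure) = 0"
    and int: "integrable sphere_measure (\<lambda>z. u * F' (a + t *\<^sub>R z) (z * u))"
    if u: "u * u = - 1" "qRe u = 0" "norm u = 1" for u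
  proof -
    show "integrable sphere_measure (\<lambda>z. u * F' (a + t *\<^sub>R z) (z * u))"
      using t by (intro integrable_sphere_blinfun[OF F'] continuous_intros) auto
    have int1: "integrable sphere_measure (\<lambda>z. F' (a + t *\<^sub>R z) (z * u))"
      using t integrable_sphere_blinfun[OF F', of t "\<lambda>_. 1" "\<lambda>z. z * u"]
      by (simp add: continuous_intros)
    \<comment> \<open>The function on the unit sphere is \<open>F\<close> composed with scaling by
      \<open>t\<close>, so its differential carries a factor \<open>t\<close>; this cancels because
      \<open>t\<close> is positive.\<close>
    have "(\<integral>z. (t *\<^sub>R F' (a + t *\<^sub>R z)) (z * u) \<partial>sphere_measure) = 0"
    proof (rule integral_sphere_measure_right_rotation[OF u, where H = "\<lambda>z. F (a + t *\<^sub>R z)"])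
      show "((\<lambda>z. F (a + t *\<^sub>R z)) has_derivative blinfun_apply (t *\<^sub>R F' (a + t *\<^sub>R z))) (at z)"
        if "z \<in> sphere 0 1" for z
      proof -
        have "a + t *\<^sub>R z \<in> cball a R"
          using that t by (auto intro!: sphere_in_cball simp del: mem_cball)
        from F[OF this] have "((\<lambda>z. F (a + t *\<^sub>R z)) has_derivative (\<lambda>h. F' (a + t *\<^sub>R z) (t *\<^sub>R h))) (at z)"
          by (rule has_derivative_compose[rotated]) (auto intro!: derivative_eq_intros)
        then show ?thesis
          by (simp add: blinfun.scaleR_right scaleR_blinfun.rep_eq)
      qed
      show "continuous_on (sphere 0 1) (\<lambda>z. t *\<^sub>R F' (a + t *\<^sub>R z))"
        using t by (intro continuous_intros continuous_on_compose2[OF F'])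
          (auto intro!: continuous_intros sphere_in_cball simp del: mem_cball)
    qed
    then have "(\<integral>z. F' (a + t *\<^sub>R z) (z * u) \<partial>sphere_measure) = 0"
      using t by (simp add: blinfun.scaleR_left)
    then show "(\<integral>z. u * F' (a + t *\<^sub>R z) (z * u) \<partial>sphere_measure) = 0"
      using int1 by simp
  qed
  have int0: "integrable sphere_measure (\<lambda>z. F' (a + t *\<^sub>R z) z)"
    using t integrable_sphere_blinfun[OF F', of t "\<lambda>_. 1" "\<lambda>z. z"] by simp
  have "(\<integral>z. qcnj z * fueter (F' (a + t *\<^sub>R z)) \<partial>sphere_measure) =
      (\<integral>z. F' (a + t *\<^sub>R z) z + ii * F' (a + t *\<^sub>R z) (z * ii) + jj * F' (a + t *\<^sub>R z) (z * jj)
        + kk * F' (a + t *\<^sub>R z) (z * kk) \<partial>sphere_measure)"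
    by (simp add: qcnj_mult_fueter bounded_linear.linear[OF blinfun.bounded_linear_right])
  also have "\<dots> = (\<integral>z. F' (a + t *\<^sub>R z) z \<partial>sphere_measure)"
    using int0 int[of ii] int[of jj] int[of kk] zero[of ii] zero[of jj] zero[of kk]
    by (simp add: quat_units_relations)
  finally show ?thesis
    using weighted_sphere_mean_derivative[OF F F', of "\<lambda>_. 1" t] t by simp
qed

text \<open>By \<open>norm_squared_fueter_cnj\<close> the two integrals containing \<open>F'\<close>
  differ by means along three left rotations. Here the weight varies too, and the product rule turns
  each of these means into -1/t times the mean of \<open>qcnj z * F\<close>.\<close>

lemma weighted_sphere_mean_fueter_cnj:
  fixes F :: "quat \<Rightarrow> quat" and F' :: "quat \<Rightarrow> quat \<Rightarrow>\<^sub>L quat"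
  assumes F: "\<And>x. x \<in> cball a R \<Longrightarrow> (F has_derivative F' x) (at x)"
    and F': "continuous_on (cball a R) F'" and t: "0 < t" "t < R"
  shows "(\<integral>z. qcnj z * F' (a + t *\<^sub>R z) z \<partial>sphere_measure) =
    (\<integral>z. fueter_cnj (F' (a + t *\<^sub>R z)) \<partial>sphere_measure)
      - (3 / t) *\<^sub>R (\<integral>z. qcnj z * F (a + t *\<^sub>R z) \<partial>sphere_measure)"
proof -
  let ?h = "\<integral>z. qcnj z * F (a + t *\<^sub>R z) \<partial>sphere_measure"
  have contF: "continuous_on (cball a R) F"
    using F has_derivative_continuous by (intro continuous_at_imp_continuous_on) blast
  have contF't: "continuous_on (sphere 0 1) (\<lambda>z. F' (a + t *\<^sub>R z))"
    using t by (intro continuous_on_compose2[OF F'])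
      (auto intro!: continuous_intros sphere_in_cball simp del: mem_cball)
  have contFt: "continuous_on (sphere 0 1) (\<lambda>z. F (a + t *\<^sub>R z))"
    using t by (intro continuous_on_compose2[OF contF])
      (auto intro!: continuous_intros sphere_in_cball simp del: mem_cball)
  have inth: "integrable sphere_measure (\<lambda>z. qcnj z * F (a + t *\<^sub>R z))"
    by (intro integrable_sphere_measure continuous_intros contFt)
  have int: "integrable sphere_measure (\<lambda>z. qcnj z * u * F' (a + t *\<^sub>R z) (u * z))" for u
    using t by (intro integrable_sphere_blinfun[OF F'] continuous_intros) auto
  have rot: "(\<integral>z. qcnj z * u * F' (a + t *\<^sub>R z) (u * z) \<partial>sphere_measure) = - (1 / t) *\<^sub>R ?h"
    if u: "u * u = - 1" "qRe u = 0" "norm u = 1" for u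
  proof -
    define H' where "H' z = Blinfun (\<lambda>h. qcnj z * u * F' (a + t *\<^sub>R z) (t *\<^sub>R h) + qcnj h * u * F (a + t *\<^sub>R z))" for z
    have bl: "bounded_linear (\<lambda>h. qcnj z * u * F' (a + t *\<^sub>R z) (t *\<^sub>R h) + qcnj h * u * F (a + t *\<^sub>R z))" for z
      by (intro bounded_linear_add bounded_linear_const_mult bounded_linear_mult_const bounded_linear_qcnj
          bounded_linear_compose[OF blinfun.bounded_linear_right] bounded_linear_scaleR_right)
    note H'_apply = bounded_linear_Blinfun_apply[OF bl, folded H'_def]
    have "(\<integral>z. H' z (u * z) \<partial>sphere_measure) = 0"
    proof (rule integral_sphere_measure_left_rotation[OF u, where H = "\<lambda>z. qcnj z * u * F (a + t *\<^sub>R z)"])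
      show "((\<lambda>z. qcnj z * u * F (a + t *\<^sub>R z)) has_derivative H' z) (at z)"
        if "z \<in> sphere 0 1" for z
      proof -
        have "a + t *\<^sub>R z \<in> cball a R"
          using that t by (auto intro!: sphere_in_cball simp del: mem_cball)
        from F[OF this] have "((\<lambda>z. F (a + t *\<^sub>R z)) has_derivative (\<lambda>h. F' (a + t *\<^sub>R z) (t *\<^sub>R h))) (at z)"
          by (rule has_derivative_compose[rotated]) (auto intro!: derivative_eq_intros)
        moreover have "((\<lambda>z. qcnj z * u) has_derivative (\<lambda>h. qcnj h * u)) (at z)"
          by (intro bounded_linear_imp_has_derivative bounded_linear_mult_const bounded_linear_qcnj)
        ultimately show ?thesis
          unfolding H'_apply by (rule has_derivative_mult[rotated])
      qed
      show "continuous_on (sphere 0 1) H'"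
        using contF't contFt
        by (intro continuous_on_blinfun_componentwise) (simp add: H'_apply, intro continuous_intros)
    qed
    \<comment> \<open>Along the rotation the varying weight contributes
      \<open>qcnj (u * z) * u\<close>, which is \<open>qcnj z\<close> again because
      \<open>qcnj u = - u\<close> and \<open>u * u = - 1\<close>.\<close>
    moreover have "H' z (u * z) = t *\<^sub>R (qcnj z * u * F' (a + t *\<^sub>R z) (u * z)) + qcnj z * F (a + t *\<^sub>R z)" for z
    proof -
      have "qcnj (u * z) * u = qcnj z * (qcnj u * u)"
        by (simp add: quat_eq_iff algebra_simps)
      also have "qcnj u = - u"
        using u(2) by (simp add: quat_eq_iff)
      finally have "qcnj (u * z) * u = qcnj z"
        using u(1) by simp
      then show ?thesis
        by (simp add: H'_apply blinfun.scaleR_right)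
    qed
    ultimately have "t *\<^sub>R (\<integral>z. qcnj z * u * F' (a + t *\<^sub>R z) (u * z) \<partial>sphere_measure) + ?h = 0"
      using int[of u] inth by simp
    then have "t *\<^sub>R (\<integral>z. qcnj z * u * F' (a + t *\<^sub>R z) (u * z) \<partial>sphere_measure) = - ?h"
      by (simp add: eq_neg_iff_add_eq_0)
    then have "(1 / t) *\<^sub>R t *\<^sub>R (\<integral>z. qcnj z * u * F' (a + t *\<^sub>R z) (u * z) \<partial>sphere_measure) = - (1 / t) *\<^sub>R ?h"
      by (metis scaleR_minus_left scaleR_minus_right)
    then show ?thesis
      using t by simp
  qed
  have "(\<integral>z. fueter_cnj (F' (a + t *\<^sub>R z)) \<partial>sphere_measure) =
    (\<integral>z. qcnj z * F' (a + t *\<^sub>R z) z - qcnj z * ii * F' (a + t *\<^sub>R z) (ii * z)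
      - qcnj z * jj * F' (a + t *\<^sub>R z) (jj * z) - qcnj z * kk * F' (a + t *\<^sub>R z) (kk * z) \<partial>sphere_measure)"
  proof (rule Bochner_Integration.integral_cong[OF refl])
    fix z assume "z \<in> space sphere_measure"
    then have "norm z = 1" by (simp add: space_sphere_measure)
    then show "fueter_cnj (F' (a + t *\<^sub>R z)) = qcnj z * F' (a + t *\<^sub>R z) z - qcnj z * ii * F' (a + t *\<^sub>R z) (ii * z)
      - qcnj z * jj * F' (a + t *\<^sub>R z) (jj * z) - qcnj z * kk * F' (a + t *\<^sub>R z) (kk * z)"
      using norm_squared_fueter_cnj[OF bounded_linear.linear[OF blinfun.bounded_linear_right], of z "F' (a + t *\<^sub>R z)"] by simp
  qed
  also have "\<dots> = (\<integral>z. qcnj z * F' (a + t *\<^sub>R z) z \<partial>sphere_measure) + (3 / t) *\<^sub>R ?h"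
    using int[of 1] int[of ii] int[of jj] int[of kk] rot[of ii] rot[of jj] rot[of kk]
    by (simp add: quat_units_relations flip: scaleR_add_left)
  finally show ?thesis by simp
qed

text \<open>Formally \<open>D' D\<close> is the Laplacian, so the three relations make
  \<open>f\<close> biharmonic. They give linear differential equations for three means in the
  radius, which are solved from the values at radius zero.\<close>

lemma fueter_biharmonic_mean_value:
  fixes f g k :: "quat \<Rightarrow> quat" and f' g' k' :: "quat \<Rightarrow> quat \<Rightarrow>\<^sub>L quat"
  assumes r: "0 < r" "r < R"
    and f: "\<And>x. x \<in> cball a R \<Longrightarrow> (f has_derivative f' x) (at x)" "continuous_on (cball a R) f'"
    and g: "\<And>x. x \<in> cball a R \<Longrightarrow> (g has_derivative g' x) (at x)" "continuous_on (cball a R) g'"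
    and k: "\<And>x. x \<in> cball a R \<Longrightarrow> (k has_derivative k' x) (at x)" "continuous_on (cball a R) k'"
    and fg: "\<And>x. x \<in> cball a R \<Longrightarrow> fueter (f' x) = 2 *\<^sub>R g x"
    and gk: "\<And>x. x \<in> cball a R \<Longrightarrow> fueter_cnj (g' x) = k x"
    and k0: "\<And>x. x \<in> cball a R \<Longrightarrow> fueter (k' x) = 0"
  shows "f a = (\<integral>z. f (a + r *\<^sub>R z) \<partial>sphere_measure)
    - r *\<^sub>R (\<integral>z. qcnj z * g (a + r *\<^sub>R z) \<partial>sphere_measure)"
proof -
  define M where "M = (\<lambda>t. \<integral>z. f (a + t *\<^sub>R z) \<partial>sphere_measure)"
  define h where "h = (\<lambda>t. \<integral>z. qcnj z * g (a + t *\<^sub>R z) \<partial>sphere_measure)"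
  define N where "N = (\<lambda>t. \<integral>z. k (a + t *\<^sub>R z) \<partial>sphere_measure)"
  have in_cball: "a + t *\<^sub>R z \<in> cball a R" if "0 < t" "t < R" "z \<in> space sphere_measure" for t z
    using that by (auto simp: space_sphere_measure intro!: sphere_in_cball simp del: mem_cball)
  \<comment> \<open>The derivative needs to vanish only at positive radii; differentiability at zero
    enters through continuity.\<close>
  have const: "X t = X 0"
    if X: "\<And>t. \<bar>t\<bar> < R \<Longrightarrow> (X has_vector_derivative X' t) (at t)"
      "\<And>t. 0 < t \<Longrightarrow> t < R \<Longrightarrow> X' t = 0" "0 \<le> t" "t < R" for X X' :: "real \<Rightarrow> quat" and t
  proof (cases "t = 0")
    case False
    have "continuous_on {0..t} X"
      using X(3,4)
      by (intro continuous_at_imp_continuous_on ballI has_vector_derivative_continuous[OF X(1)]) auto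
    moreover have "(X has_derivative (\<lambda>h. 0)) (at s within {0..t})" if "s \<in> {0..t} - {0, t}" for s
      using X(1)[of s] X(2)[of s] that X(3,4)
      by (auto simp: has_vector_derivative_def intro!: has_derivative_at_withinI)
    ultimately show ?thesis
      using X(3) False
      by (intro has_derivative_zero_unique_strong_interval[of "{0, t}"]) auto
  qed simp
  have derM: "(M has_vector_derivative (\<integral>z. f' (a + t *\<^sub>R z) z \<partial>sphere_measure)) (at t)" if "\<bar>t\<bar> < R" for t
    using weighted_sphere_mean_derivative[OF f, of "\<lambda>_. 1" t] that by (simp add: M_def)
  have derN: "(N has_vector_derivative (\<integral>z. k' (a + t *\<^sub>R z) z \<partial>sphere_measure)) (at t)" if "\<bar>t\<bar> < R" for t
    using weighted_sphere_mean_derivative[OF k, of "\<lambda>_. 1" t] that by (simp add: N_def)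
  have derh: "(h has_vector_derivative (\<integral>z. qcnj z * g' (a + t *\<^sub>R z) z \<partial>sphere_measure)) (at t)" if "\<bar>t\<bar> < R" for t
    using weighted_sphere_mean_derivative[OF g, of qcnj t] that
    by (simp add: h_def continuous_on_qcnj)
  have M': "(\<integral>z. f' (a + t *\<^sub>R z) z \<partial>sphere_measure) = 2 *\<^sub>R h t" if t: "0 < t" "t < R" for t
  proof -
    have "(M has_vector_derivative (\<integral>z. qcnj z * fueter (f' (a + t *\<^sub>R z)) \<partial>sphere_measure)) (at t)"
      unfolding M_def by (rule sphere_mean_derivative_fueter[OF f t])
    moreover have "(\<integral>z. qcnj z * fueter (f' (a + t *\<^sub>R z)) \<partial>sphere_measure) =
        (\<integral>z. 2 *\<^sub>R (qcnj z * g (a + t *\<^sub>R z)) \<partial>sphere_measure)"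
      using fg in_cball[OF t] by (intro Bochner_Integration.integral_cong) auto
    ultimately show ?thesis
      using vector_derivative_unique_at[OF derM[of t]] t by (simp add: h_def)
  qed
  have N': "(\<integral>z. k' (a + t *\<^sub>R z) z \<partial>sphere_measure) = 0" if t: "0 < t" "t < R" for t
  proof -
    have "(N has_vector_derivative (\<integral>z. qcnj z * fueter (k' (a + t *\<^sub>R z)) \<partial>sphere_measure)) (at t)"
      unfolding N_def by (rule sphere_mean_derivative_fueter[OF k t])
    moreover have "(\<integral>z. qcnj z * fueter (k' (a + t *\<^sub>R z)) \<partial>sphere_measure) = (\<integral>z. 0 \<partial>sphere_measure)"
      using k0 in_cball[OF t] by (intro Bochner_Integration.integral_cong) auto
    ultimately show ?thesis
      using vector_derivative_unique_at[OF derN[of t]] t by simp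
  qed
  have N_const: "N t = k a" if t: "0 < t" "t < R" for t
    using const[OF derN N', of t] t by (simp add: N_def)
  have h': "(\<integral>z. qcnj z * g' (a + t *\<^sub>R z) z \<partial>sphere_measure) = k a - (3 / t) *\<^sub>R h t"
    if t: "0 < t" "t < R" for t
  proof -
    have "(\<integral>z. fueter_cnj (g' (a + t *\<^sub>R z)) \<partial>sphere_measure) = N t"
      unfolding N_def using gk in_cball[OF t] by (intro Bochner_Integration.integral_cong) auto
    then show ?thesis
      using weighted_sphere_mean_fueter_cnj[OF g t] N_const[OF t] by (simp add: h_def)
  qed
  have h_eq: "h t = (t / 4) *\<^sub>R k a" if t: "0 < t" "t < R" for t
  proof -
    \<comment> \<open>The equation \<open>h' = k a - 3 h / t\<close> has the integrating factor
      \<open>t ^ 3\<close>. \<open>X\<close> compares the resulting antiderivatives and is zero at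
      radius zero.\<close>
    define X where "X t = t ^ 3 *\<^sub>R h t - (t ^ 4 / 4) *\<^sub>R k a" for t
    have "X t = X 0"
    proof (rule const[where X' = "\<lambda>t. t ^ 3 *\<^sub>R (\<integral>z. qcnj z * g' (a + t *\<^sub>R z) z \<partial>sphere_measure)
        + (3 * t ^ 2) *\<^sub>R h t - (t ^ 3) *\<^sub>R k a"])
      fix s :: real assume "\<bar>s\<bar> < R"
      then show "(X has_vector_derivative s ^ 3 *\<^sub>R (\<integral>z. qcnj z * g' (a + s *\<^sub>R z) z \<partial>sphere_measure)
        + (3 * s ^ 2) *\<^sub>R h s - (s ^ 3) *\<^sub>R k a) (at s)"
        unfolding X_def
        by (auto intro!: derivative_eq_intros derh[of s])
    next
      fix s :: real assume s: "0 < s" "s < R"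
      have "s ^ 3 * (3 / s) = 3 * s ^ 2"
        using s by (simp add: power3_eq_cube power2_eq_square)
      then show "s ^ 3 *\<^sub>R (\<integral>z. qcnj z * g' (a + s *\<^sub>R z) z \<partial>sphere_measure)
        + (3 * s ^ 2) *\<^sub>R h s - (s ^ 3) *\<^sub>R k a = 0"
        unfolding h'[OF s] scaleR_diff_right scaleR_scaleR by simp
    qed (use t in auto)
    then have "t ^ 3 *\<^sub>R h t = t ^ 3 *\<^sub>R (t / 4) *\<^sub>R k a"
      by (simp add: X_def power4_eq_xxxx power3_eq_cube)
    moreover have "t ^ 3 \<noteq> 0"
      using t by simp
    ultimately show ?thesis
      by (rule scaleR_left_imp_eq[rotated])
  qed
  \<comment> \<open>\<open>M\<close> grows at rate twice \<open>h\<close>, which is now known, so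
    \<open>Y\<close> is constant; its value at zero is \<open>f a\<close>. At \<open>r\<close> the
    subtracted term equals \<open>r\<close> times \<open>h r\<close>, which eliminates
    \<open>k a\<close>.\<close>
  define Y where "Y t = M t - (t\<^sup>2 / 4) *\<^sub>R k a" for t
  have "Y r = Y 0"
  proof (rule const[where X' = "\<lambda>t. (\<integral>z. f' (a + t *\<^sub>R z) z \<partial>sphere_measure) - (t / 2) *\<^sub>R k a"])
    fix s :: real assume "\<bar>s\<bar> < R"
    then show "(Y has_vector_derivative (\<integral>z. f' (a + s *\<^sub>R z) z \<partial>sphere_measure) - (s / 2) *\<^sub>R k a) (at s)"
      unfolding Y_def by (auto intro!: derivative_eq_intros derM[of s])
  qed (use r M' h_eq in auto)
  then have "M r - r *\<^sub>R h r = f a"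
    using r h_eq[of r] by (simp add: Y_def M_def power2_eq_square)
  then show ?thesis
    by (simp add: M_def h_def)
qed

section \<open>Functions of the slice coordinates\<close>

definition qim :: "quat \<Rightarrow> quat" where
  "qim x = x - of_real (qRe x)"

text \<open>Values lie in the closed upper half-plane, and the fibres are the spheres \<alpha> +
  \<beta> S, reduced to one point when \<beta> is zero.\<close>

definition slice_coord :: "quat \<Rightarrow> complex" where
  "slice_coord x = Complex (qRe x) (norm (qim x))"

definition slice_emb :: "quat \<Rightarrow> complex \<Rightarrow> quat" where
  "slice_emb I w = of_real (Re w) + Im w *\<^sub>R I"

text \<open>Since \<open>sgn 0 = 0\<close>, only \<open>U\<close> contributes at real
  points.\<close>

definition axial :: "(complex \<Rightarrow> real) \<Rightarrow> (complex \<Rightarrow> real) \<Rightarrow> quat \<Rightarrow> quat" where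
  "axial U V x = of_real (U (slice_coord x)) + V (slice_coord x) *\<^sub>R sgn (qim x)"

lemma slice_coord_sel [simp]: "Re (slice_coord x) = qRe x" "Im (slice_coord x) = norm (qim x)"
  by (simp_all add: slice_coord_def)

lemma qim_sel [simp]: "qRe (qim x) = 0" "qI (qim x) = qI x" "qJ (qim x) = qJ x" "qK (qim x) = qK x"
  by (simp_all add: qim_def)

lemma bounded_linear_qRe: "bounded_linear qRe"
  by (rule bounded_linear_intro[where K = 1])
    (simp_all add: norm_quat_def real_le_rsqrt)

lemma bounded_linear_qim: "bounded_linear qim"
  unfolding qim_def[abs_def]
  by (intro bounded_linear_sub bounded_linear_ident
      bounded_linear_compose[OF bounded_linear_of_real bounded_linear_qRe])

lemmas continuous_on_qRe [continuous_intros] = bounded_linear.continuous_on[OF bounded_linear_qRe]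
lemmas continuous_on_qim [continuous_intros] = bounded_linear.continuous_on[OF bounded_linear_qim]
lemmas qRe_has_derivative [derivative_intros] = bounded_linear.has_derivative[OF bounded_linear_qRe]
lemmas qim_has_derivative [derivative_intros] = bounded_linear.has_derivative[OF bounded_linear_qim]

lemma continuous_on_zt [continuous_intros]: "continuous_on A slice_coord"
  unfolding slice_coord_def[abs_def] by (intro continuous_intros)

lemma qim_eq_0_iff: "qim x = 0 \<longleftrightarrow> x = of_real (qRe x)"
  by (simp add: qim_def)

lemma qRe_sgn_qim [simp]: "qRe (sgn (qim x)) = 0"
  by (simp add: sgn_quat_def)

lemma inner_qim: "qRe u = 0 \<Longrightarrow> qim v \<bullet> u = v \<bullet> u"
  by (simp add: inner_quat_def)

section \<open>Differentials of the slice coordinate and of axial functions\<close>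

lemma norm_qim_has_derivative:
  assumes "qim x \<noteq> 0"
  shows "((\<lambda>x. norm (qim x)) has_derivative (\<lambda>v. v \<bullet> sgn (qim x))) (at x)"
proof -
  have "((\<lambda>x. norm (qim x)) has_derivative (\<lambda>v. qim v \<bullet> sgn (qim x))) (at x)"
    using has_derivative_compose[OF qim_has_derivative[OF has_derivative_ident] has_derivative_norm[OF assms]] .
  then show ?thesis
    by (simp add: inner_qim)
qed

lemma sgn_qim_has_derivative:
  assumes "qim x \<noteq> 0"
  shows "((\<lambda>x. sgn (qim x)) has_derivative
    (\<lambda>v. (1 / norm (qim x)) *\<^sub>R (qim v - (v \<bullet> sgn (qim x)) *\<^sub>R sgn (qim x)))) (at x)"
proof -
  have "((\<lambda>x. inverse (norm (qim x)) *\<^sub>R qim x) has_derivative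
    (\<lambda>v. inverse (norm (qim x)) *\<^sub>R qim v
      + (- (inverse (norm (qim x)) * (v \<bullet> sgn (qim x)) * inverse (norm (qim x)))) *\<^sub>R qim x)) (at x)"
    using assms by (intro derivative_intros has_derivative_inverse norm_qim_has_derivative) auto
  moreover have "inverse (norm (qim x)) *\<^sub>R qim v
      + (- (inverse (norm (qim x)) * (v \<bullet> sgn (qim x)) * inverse (norm (qim x)))) *\<^sub>R qim x
    = (1 / norm (qim x)) *\<^sub>R (qim v - (v \<bullet> sgn (qim x)) *\<^sub>R sgn (qim x))" for v
    by (simp add: sgn_div_norm[of "qim x"] scaleR_diff_right divide_inverse mult.commute mult.left_commute)
  ultimately show ?thesis
    by (simp add: sgn_div_norm[abs_def])
qed

lemma slice_coord_has_derivative: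
  assumes "qim x \<noteq> 0"
  shows "(slice_coord has_derivative (\<lambda>v. Complex (qRe v) (v \<bullet> sgn (qim x)))) (at x)"
proof -
  have "((\<lambda>x. of_real (qRe x) + \<i> * of_real (norm (qim x))) has_derivative
      (\<lambda>v. of_real (qRe v) + \<i> * of_real (v \<bullet> sgn (qim x)))) (at x)"
    by (intro derivative_intros norm_qim_has_derivative assms)
  then show ?thesis
    by (simp add: slice_coord_def[abs_def] Complex_eq)
qed

text \<open>The last summand comes from the motion of the unit \<open>sgn (qim x)\<close>:
  directions orthogonal to the slice turn it at a rate of one over the radius of the sphere.\<close>

lemma axial_has_derivative:
  assumes x: "qim x \<noteq> 0"
    and U: "(U has_derivative (\<lambda>w. Re w * u0 + Im w * u1)) (at (slice_coord x))"
    and V: "(V has_derivative (\<lambda>w. Re w * v0 + Im w * v1)) (at (slice_coord x))"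
  shows "(axial U V has_derivative (\<lambda>v. of_real (qRe v * u0 + (v \<bullet> sgn (qim x)) * u1)
    + ((qRe v * v0 + (v \<bullet> sgn (qim x)) * v1) *\<^sub>R sgn (qim x)
    + (V (slice_coord x) / norm (qim x)) *\<^sub>R (qim v - (v \<bullet> sgn (qim x)) *\<^sub>R sgn (qim x))))) (at x)"
proof -
  have U': "((\<lambda>x. U (slice_coord x)) has_derivative (\<lambda>v. qRe v * u0 + (v \<bullet> sgn (qim x)) * u1)) (at x)"
    using has_derivative_compose[OF slice_coord_has_derivative[OF x] U] by simp
  have V': "((\<lambda>x. V (slice_coord x)) has_derivative (\<lambda>v. qRe v * v0 + (v \<bullet> sgn (qim x)) * v1)) (at x)"
    using has_derivative_compose[OF slice_coord_has_derivative[OF x] V] by simp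
  show ?thesis
    unfolding axial_def[abs_def]
    by (rule derivative_eq_intros U' V' sgn_qim_has_derivative[OF x] refl)+ (simp add: algebra_simps)
qed

lemma sgn_qim_squares:
  assumes "qim x \<noteq> 0" and "I = sgn (qim x)"
  shows "qRe I = 0" and "(qI I)\<^sup>2 + (qJ I)\<^sup>2 + (qK I)\<^sup>2 = 1"
proof -
  show *: "qRe I = 0"
    by (simp add: assms(2))
  have "(norm I)\<^sup>2 = 1"
    using assms by (simp add: norm_sgn)
  then show "(qI I)\<^sup>2 + (qJ I)\<^sup>2 + (qK I)\<^sup>2 = 1"
    by (simp add: norm_quat_squared *)
qed

text \<open>The slice directions 1 and \<open>sgn (qim x)\<close> give Cauchy-Riemann combinations
  of the partial derivatives. On the two unit directions \<open>e\<close> orthogonal to the slice,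
  \<open>L e\<close> is \<open>c\<close> times \<open>e\<close>, so \<open>e * L e\<close> is
  \<open>- c\<close>; this accounts for the term \<open>2 * c\<close> and its sign.\<close>

lemma
  assumes x: "qim x \<noteq> 0"
    and L: "L = (\<lambda>v. of_real (qRe v * u0 + (v \<bullet> sgn (qim x)) * u1)
      + ((qRe v * v0 + (v \<bullet> sgn (qim x)) * v1) *\<^sub>R sgn (qim x)
      + c *\<^sub>R (qim v - (v \<bullet> sgn (qim x)) *\<^sub>R sgn (qim x))))"
  shows fueter_axial: "fueter L = of_real (u0 - v1 - 2 * c) + (u1 + v0) *\<^sub>R sgn (qim x)"
    and fueter_cnj_axial: "fueter_cnj L = of_real (u0 + v1 + 2 * c) + (v0 - u1) *\<^sub>R sgn (qim x)"
proof -
  define I where "I = sgn (qim x)"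
  note I = sgn_qim_squares[OF x I_def]
  have "v1 * ((qI I)\<^sup>2 + (qJ I)\<^sup>2 + (qK I)\<^sup>2) = v1" "c * ((qI I)\<^sup>2 + (qJ I)\<^sup>2 + (qK I)\<^sup>2) = c"
    by (simp_all add: I(2))
  then show "fueter L = of_real (u0 - v1 - 2 * c) + (u1 + v0) *\<^sub>R sgn (qim x)"
    "fueter_cnj L = of_real (u0 + v1 + 2 * c) + (v0 - u1) *\<^sub>R sgn (qim x)"
    unfolding L fueter_def fueter_cnj_def I_def[symmetric]
    by (simp_all add: quat_eq_iff inner_quat_def I(1) algebra_simps power2_eq_square)
qed

text \<open>In finite dimension a family of linear maps is continuous once its values on every fixed
  vector are, so explicit formulas for the differential suffice.\<close>

lemma C1_onI:
  assumes "\<And>x. x \<in> N \<Longrightarrow> (F has_derivative F' x) (at x)"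
    and "\<And>v. continuous_on N (\<lambda>x. F' x v)"
  shows "C1_on N F"
proof -
  have app: "blinfun_apply (Blinfun (F' x)) = F' x" if "x \<in> N" for x
    using assms(1)[OF that] by (intro bounded_linear_Blinfun_apply has_derivative_bounded_linear)
  have "continuous_on N (\<lambda>x. Blinfun (F' x))"
  proof (rule continuous_on_blinfun_componentwise)
    show "continuous_on N (\<lambda>x. Blinfun (F' x) i)" for i
      using assms(2)[of i] by (rule continuous_on_eq) (simp add: app)
  qed
  then show ?thesis
    unfolding C1_on_def using assms(1) app by (intro exI[of _ "\<lambda>x. Blinfun (F' x)"]) auto
qed

lemma C1_on_axial:
  assumes N: "\<And>x. x \<in> N \<Longrightarrow> qim x \<noteq> 0" "\<And>x. x \<in> N \<Longrightarrow> slice_coord x \<in> A"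
    and U: "\<And>z. z \<in> A \<Longrightarrow> (U has_derivative (\<lambda>w. Re w * u0 z + Im w * u1 z)) (at z)"
    and V: "\<And>z. z \<in> A \<Longrightarrow> (V has_derivative (\<lambda>w. Re w * v0 z + Im w * v1 z)) (at z)"
    and cont: "continuous_on A u0" "continuous_on A u1" "continuous_on A v0" "continuous_on A v1"
  shows "C1_on N (axial U V)"
proof (rule C1_onI)
  show "(axial U V has_derivative (\<lambda>v. of_real (qRe v * u0 (slice_coord x) + (v \<bullet> sgn (qim x)) * u1 (slice_coord x))
    + ((qRe v * v0 (slice_coord x) + (v \<bullet> sgn (qim x)) * v1 (slice_coord x)) *\<^sub>R sgn (qim x)
    + (V (slice_coord x) / norm (qim x)) *\<^sub>R (qim v - (v \<bullet> sgn (qim x)) *\<^sub>R sgn (qim x))))) (at x)"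
    if "x \<in> N" for x
    using axial_has_derivative[OF N(1)[OF that] U[OF N(2)[OF that]] V[OF N(2)[OF that]]] .
  have V_cont: "continuous_on A V"
    using V has_derivative_continuous by (intro continuous_at_imp_continuous_on) blast
  have comp: "continuous_on N (\<lambda>x. h (slice_coord x))" if "continuous_on A h" for h :: "complex \<Rightarrow> real"
    using N(2) by (intro continuous_on_compose2[OF that continuous_on_zt]) auto
  show "continuous_on N (\<lambda>x. of_real (qRe v * u0 (slice_coord x) + (v \<bullet> sgn (qim x)) * u1 (slice_coord x))
    + ((qRe v * v0 (slice_coord x) + (v \<bullet> sgn (qim x)) * v1 (slice_coord x)) *\<^sub>R sgn (qim x)
    + (V (slice_coord x) / norm (qim x)) *\<^sub>R (qim v - (v \<bullet> sgn (qim x)) *\<^sub>R sgn (qim x))))" for v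
    using N(1) by (intro continuous_intros comp cont V_cont) auto
qed

section \<open>Chains f, g, k generated by a holomorphic function\<close>

text \<open>The relations are asked only off the real axis, where explicit formulas exist;
  \<open>continuous_eq_off_real\<close> later carries them to real points.\<close>

definition fueter_chain :: "quat set \<Rightarrow> (quat \<Rightarrow> quat) \<Rightarrow> (quat \<Rightarrow> quat) \<Rightarrow> (quat \<Rightarrow> quat) \<Rightarrow> bool" where
  "fueter_chain N F G K \<longleftrightarrow> C1_on N G \<and> C1_on N K \<and> (\<forall>x\<in>N. qim x \<noteq> 0 \<longrightarrow>
    (\<exists>L. (F has_derivative L) (at x) \<and> fueter L = 2 *\<^sub>R G x) \<and>
    (\<exists>L. (G has_derivative L) (at x) \<and> fueter_cnj L = K x) \<and>
    (\<exists>L. (K has_derivative L) (at x) \<and> fueter L = 0))"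

text \<open>The slice function induced by the stem function \<phi>, read in the upper
  half-plane.\<close>

definition stem :: "(complex \<Rightarrow> complex) \<Rightarrow> quat \<Rightarrow> quat" where
  "stem \<phi> = axial (\<lambda>z. Re (\<phi> z)) (\<lambda>z. Im (\<phi> z))"

text \<open>For holomorphic \<phi> this is \<open>dbar (stem \<phi>)\<close> off the real axis: the
  Cauchy-Riemann equations leave only the term in \<open>c\<close> of
  \<open>fueter_axial\<close>.\<close>

definition stem1 :: "(complex \<Rightarrow> complex) \<Rightarrow> quat \<Rightarrow> quat" where
  "stem1 \<phi> = axial (\<lambda>z. - (Im (\<phi> z) / Im z)) (\<lambda>z. 0)"

text \<open>The result of \<open>fueter_cnj_axial\<close> for \<open>stem1 \<phi>\<close>.\<close>

definition stem2 :: "(complex \<Rightarrow> complex) \<Rightarrow> quat \<Rightarrow> quat" where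
  "stem2 \<phi> = axial (\<lambda>z. - (Im (deriv \<phi> z) / Im z)) (\<lambda>z. Re (deriv \<phi> z) / Im z - Im (\<phi> z) / (Im z)\<^sup>2)"

lemma
  assumes "\<phi> holomorphic_on A" "open A" "z \<in> A"
  shows holomorphic_Re_has_derivative:
      "((\<lambda>z. Re (\<phi> z)) has_derivative (\<lambda>w. Re w * Re (deriv \<phi> z) + Im w * - Im (deriv \<phi> z))) (at z)"
    and holomorphic_Im_has_derivative:
      "((\<lambda>z. Im (\<phi> z)) has_derivative (\<lambda>w. Re w * Im (deriv \<phi> z) + Im w * Re (deriv \<phi> z))) (at z)"
proof -
  have "(\<phi> has_derivative (\<lambda>w. deriv \<phi> z * w)) (at z)"
    using holomorphic_derivI[OF assms] by (simp add: has_field_derivative_def)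
  from has_derivative_Re[OF this] has_derivative_Im[OF this]
  show "((\<lambda>z. Re (\<phi> z)) has_derivative (\<lambda>w. Re w * Re (deriv \<phi> z) + Im w * - Im (deriv \<phi> z))) (at z)"
    "((\<lambda>z. Im (\<phi> z)) has_derivative (\<lambda>w. Re w * Im (deriv \<phi> z) + Im w * Re (deriv \<phi> z))) (at z)"
    by (simp_all add: mult.commute add.commute)
qed

text \<open>The coefficients of \<open>Re w\<close> and \<open>Im w\<close> are the partial
  derivatives required by \<open>axial_has_derivative\<close>, with those of \<phi> rewritten by the
  Cauchy-Riemann equations.\<close>

lemma stem_derivatives:
  assumes hol: "\<phi> holomorphic_on A" "open A" and A: "\<forall>z\<in>A. Im z > 0" and z: "z \<in> A"
  shows "((\<lambda>z. - (Im (\<phi> z) / Im z)) has_derivative (\<lambda>w. Re w * - (Im (deriv \<phi> z) / Im z)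
      + Im w * (Im (\<phi> z) / (Im z)\<^sup>2 - Re (deriv \<phi> z) / Im z))) (at z)"
    and "((\<lambda>z. Re (deriv \<phi> z) / Im z - Im (\<phi> z) / (Im z)\<^sup>2) has_derivative
      (\<lambda>w. Re w * (Re (deriv (deriv \<phi>) z) / Im z - Im (deriv \<phi> z) / (Im z)\<^sup>2)
      + Im w * (2 * Im (\<phi> z) / (Im z) ^ 3 - 2 * Re (deriv \<phi> z) / (Im z)\<^sup>2 - Im (deriv (deriv \<phi>) z) / Im z))) (at z)"
proof -
  have hol': "deriv \<phi> holomorphic_on A"
    using hol by (rule holomorphic_deriv)
  have Im: "(Im has_derivative Im) (at z)"
    by (rule bounded_linear_imp_has_derivative[OF bounded_linear_Im])
  have nz: "Im z \<noteq> 0"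
    using A z by auto
  show "((\<lambda>z. - (Im (\<phi> z) / Im z)) has_derivative (\<lambda>w. Re w * - (Im (deriv \<phi> z) / Im z)
      + Im w * (Im (\<phi> z) / (Im z)\<^sup>2 - Re (deriv \<phi> z) / Im z))) (at z)"
    by (rule has_derivative_eq_rhs[OF has_derivative_minus[OF has_derivative_divide'[OF
            holomorphic_Im_has_derivative[OF hol z] Im nz]]])
      (use nz in \<open>simp add: fun_eq_iff field_simps power2_eq_square\<close>)
  have Im2: "((\<lambda>z. (Im z)\<^sup>2) has_derivative (\<lambda>w. 2 * Im w * Im z)) (at z)"
    by (rule has_derivative_eq_rhs[OF has_derivative_power[OF Im]]) simp
  have nz2: "(Im z)\<^sup>2 \<noteq> 0"
    using nz by simp
  show "((\<lambda>z. Re (deriv \<phi> z) / Im z - Im (\<phi> z) / (Im z)\<^sup>2) has_derivative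
      (\<lambda>w. Re w * (Re (deriv (deriv \<phi>) z) / Im z - Im (deriv \<phi> z) / (Im z)\<^sup>2)
      + Im w * (2 * Im (\<phi> z) / (Im z) ^ 3 - 2 * Re (deriv \<phi> z) / (Im z)\<^sup>2 - Im (deriv (deriv \<phi>) z) / Im z))) (at z)"
    by (rule has_derivative_eq_rhs[OF has_derivative_diff[OF
            has_derivative_divide'[OF holomorphic_Re_has_derivative[OF hol' hol(2) z] Im nz]
            has_derivative_divide'[OF holomorphic_Im_has_derivative[OF hol z] Im2 nz2]]])
      (use nz in \<open>simp add: fun_eq_iff field_simps power2_eq_square power3_eq_cube\<close>)
qed

text \<open>Each relation is \<open>fueter_axial\<close> or \<open>fueter_cnj_axial\<close>
  evaluated on explicit partial derivatives; in the last one the terms in \<phi> and its first two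
  derivatives cancel.\<close>

lemma
  assumes hol: "\<phi> holomorphic_on A" "open A" and A: "\<And>z. z \<in> A \<Longrightarrow> Im z > 0"
    and N: "\<And>x. x \<in> N \<Longrightarrow> slice_coord x \<in> A"
  shows fueter_chain_stem: "fueter_chain N (stem \<phi>) (stem1 \<phi>) (stem2 \<phi>)"
    and C1_on_stem: "C1_on N (stem \<phi>)"
proof -
  have N': "qim x \<noteq> 0" if "x \<in> N" for x
    using A[OF N[OF that]] by auto
  have hol': "deriv \<phi> holomorphic_on A" and hol'': "deriv (deriv \<phi>) holomorphic_on A"
    using hol by (auto intro!: holomorphic_deriv)
  note cont = holomorphic_on_imp_continuous_on[OF hol(1)] holomorphic_on_imp_continuous_on[OF hol']
    holomorphic_on_imp_continuous_on[OF hol'']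
  have nz: "Im z \<noteq> 0" if "z \<in> A" for z
    using A[OF that] by simp
  have A': "\<forall>z\<in>A. Im z > 0"
    using A by blast
  note ders = stem_derivatives[OF hol A']
  \<comment> \<open>The real part of \<open>stem2 \<phi>\<close> is that of
    \<open>stem1 (deriv \<phi>)\<close>, so the first formula is reused for
    \<open>deriv \<phi>\<close>.\<close>
  note ders' = stem_derivatives(1)[OF hol' hol(2) A']
  have zero: "((\<lambda>z. 0) has_derivative (\<lambda>w. Re w * 0 + Im w * 0)) (at z)" for z
    by simp
  show "C1_on N (stem \<phi>)"
    unfolding stem_def
    by (rule C1_on_axial[OF N' N holomorphic_Re_has_derivative[OF hol] holomorphic_Im_has_derivative[OF hol]])
      (auto intro!: continuous_intros cont)
  show "fueter_chain N (stem \<phi>) (stem1 \<phi>) (stem2 \<phi>)"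
    unfolding fueter_chain_def
  proof (intro conjI ballI impI)
    show "C1_on N (stem1 \<phi>)"
      unfolding stem1_def
      by (rule C1_on_axial[OF N' N ders(1) zero]) (auto intro!: continuous_intros cont dest: nz)
    show "C1_on N (stem2 \<phi>)"
      unfolding stem2_def
      by (rule C1_on_axial[OF N' N ders' ders(2)]) (auto intro!: continuous_intros cont dest: nz)
    fix x assume x: "x \<in> N"
    note n = N'[OF x] and z = N[OF x]
    show "\<exists>L. (stem \<phi> has_derivative L) (at x) \<and> fueter L = 2 *\<^sub>R stem1 \<phi> x"
      unfolding stem_def
      by (rule exI, rule conjI, rule axial_has_derivative[OF n holomorphic_Re_has_derivative[OF hol z]
          holomorphic_Im_has_derivative[OF hol z]], subst fueter_axial[OF n refl])
        (simp add: stem1_def axial_def scaleR_conv_of_real)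
    show "\<exists>L. (stem1 \<phi> has_derivative L) (at x) \<and> fueter_cnj L = stem2 \<phi> x"
      unfolding stem1_def
      by (rule exI, rule conjI, rule axial_has_derivative[OF n ders(1)[OF z] zero],
          subst fueter_cnj_axial[OF n refl])
        (simp add: stem2_def axial_def)
    show "\<exists>L. (stem2 \<phi> has_derivative L) (at x) \<and> fueter L = 0"
      unfolding stem2_def
      by (rule exI, rule conjI, rule axial_has_derivative[OF n ders'[OF z] ders(2)[OF z]],
          subst fueter_axial[OF n refl])
        (use n in \<open>simp add: field_simps power2_eq_square power3_eq_cube\<close>)
  qed
qed

section \<open>Intrinsic functions near the real axis\<close>

text \<open>Imaginary units in coordinate form, convenient for computation;
  \<open>imag_unit_in_imag_units\<close> leads back to the definition by squares.\<close>

definition imag_unit :: "quat \<Rightarrow> bool" where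
  "imag_unit I \<longleftrightarrow> qRe I = 0 \<and> norm I = 1"

text \<open>Schwarz reflection symmetry. It makes the transported function on a slice independent of
  whether the slice is parametrised by \<open>I\<close> or by \<open>- I\<close>.\<close>

definition intrinsic_on :: "complex set \<Rightarrow> (complex \<Rightarrow> complex) \<Rightarrow> bool" where
  "intrinsic_on A \<phi> \<longleftrightarrow> (\<forall>z\<in>A. cnj z \<in> A \<and> \<phi> (cnj z) = cnj (\<phi> z))"

lemma imag_unit_square: "imag_unit I \<Longrightarrow> I * I = - 1"
proof -
  assume I: "imag_unit I"
  then have "(norm I)\<^sup>2 = 1" by (simp add: imag_unit_def)
  then have "qI I * qI I + qJ I * qJ I + qK I * qK I = 1"
    using I by (simp only: norm_quat_squared) (simp add: imag_unit_def power2_eq_square)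
  with I show ?thesis
    by (simp add: quat_eq_iff imag_unit_def)
qed

lemma slice_emb_mult: "imag_unit I \<Longrightarrow> slice_emb I (z * w) = slice_emb I z * slice_emb I w"
  by (simp add: slice_emb_def of_real_def algebra_simps imag_unit_square)

lemma slice_emb_add: "slice_emb I (z + w) = slice_emb I z + slice_emb I w"
  and slice_emb_diff: "slice_emb I (z - w) = slice_emb I z - slice_emb I w"
  and slice_emb_scaleR: "slice_emb I (c *\<^sub>R z) = c *\<^sub>R slice_emb I z"
  and slice_emb_of_real [simp]: "slice_emb I (of_real c) = of_real c"
  by (simp_all add: slice_emb_def algebra_simps scaleR_conv_of_real)

lemma qRe_emb [simp]: "imag_unit I \<Longrightarrow> qRe (slice_emb I z) = Re z"
  by (simp add: slice_emb_def imag_unit_def)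

lemma qim_emb: "imag_unit I \<Longrightarrow> qim (slice_emb I z) = Im z *\<^sub>R I"
  by (simp add: qim_def) (simp add: slice_emb_def)

lemma norm_qim_emb [simp]: "imag_unit I \<Longrightarrow> norm (qim (slice_emb I z)) = \<bar>Im z\<bar>"
  by (simp add: qim_emb) (simp add: imag_unit_def)

lemma norm_emb: "imag_unit I \<Longrightarrow> norm (slice_emb I z) = norm z"
proof -
  assume I: "imag_unit I"
  then have "(norm I)\<^sup>2 = 1" by (simp add: imag_unit_def)
  have "(norm (slice_emb I z))\<^sup>2 = (Re z)\<^sup>2 + (Im z)\<^sup>2 * (norm I)\<^sup>2"
    using I unfolding norm_quat_squared
    by (simp add: slice_emb_def imag_unit_def distrib_left power_mult_distrib)
  also have "\<dots> = (norm z)\<^sup>2"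
    using \<open>(norm I)\<^sup>2 = 1\<close> by (simp add: cmod_power2)
  finally show ?thesis
    by (rule power2_eq_imp_eq) simp_all
qed

lemma bounded_linear_emb: "imag_unit I \<Longrightarrow> bounded_linear (slice_emb I)"
  by (rule bounded_linear_intro[where K = 1]) (simp_all add: slice_emb_add slice_emb_scaleR norm_emb)

lemma qcnj_emb: "imag_unit I \<Longrightarrow> qcnj (slice_emb I z) = slice_emb I (cnj z)"
  by (simp add: quat_eq_iff slice_emb_def imag_unit_def)

lemma imag_unit_sgn_qim: "qim x \<noteq> 0 \<Longrightarrow> imag_unit (sgn (qim x))"
  by (simp add: imag_unit_def norm_sgn)

lemma imag_unit_ii: "imag_unit ii"
  by (simp add: imag_unit_def)

text \<open>A nonreal \<open>x\<close> determines its unit. For real \<open>x\<close> every unit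
  works, and \<open>ii\<close> is taken.\<close>

lemma ex_emb: "\<exists>I. imag_unit I \<and> slice_emb I (slice_coord x) = x \<and> (qim x \<noteq> 0 \<longrightarrow> I = sgn (qim x))"
proof (cases "qim x = 0")
  case True
  then show ?thesis
    by (intro exI[of _ ii]) (simp add: imag_unit_ii slice_emb_def qim_eq_0_iff)
next
  case False
  then have "slice_emb (sgn (qim x)) (slice_coord x) = x"
    by (simp add: slice_emb_def sgn_div_norm) (simp add: qim_def)
  with False show ?thesis
    using imag_unit_sgn_qim by blast
qed

text \<open>In the lower half-plane \<open>slice_coord\<close> reflects \<open>z\<close> and the
  unit changes sign; reflection symmetry compensates for both. For real \<open>z\<close> it forces
  \<phi> to be real there.\<close>

lemma stem_emb:
  assumes "imag_unit I" "intrinsic_on A \<phi>" "z \<in> A"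
  shows "stem \<phi> (slice_emb I z) = slice_emb I (\<phi> z)"
proof -
  have slice_coord: "slice_coord (slice_emb I z) = Complex (Re z) \<bar>Im z\<bar>"
    using assms(1) by (simp add: slice_coord_def)
  have I: "sgn I = I"
    using assms(1) by (simp add: sgn_div_norm imag_unit_def)
  consider "Im z > 0" | "Im z < 0" | "Im z = 0" by linarith
  then show ?thesis
  proof cases
    case 1
    then have "slice_coord (slice_emb I z) = z" by (simp add: slice_coord complex_eq_iff)
    with 1 show ?thesis
      using assms(1) by (simp add: stem_def axial_def slice_emb_def[of I "\<phi> z"] qim_emb sgn_scaleR I)
  next
    case 2
    then have "slice_coord (slice_emb I z) = cnj z" by (simp add: slice_coord complex_eq_iff)
    moreover have "\<phi> (cnj z) = cnj (\<phi> z)"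
      using assms by (simp add: intrinsic_on_def)
    ultimately show ?thesis
      using assms(1) 2 by (simp add: stem_def axial_def slice_emb_def[of I "\<phi> z"] qim_emb sgn_scaleR I)
  next
    case 3
    then have "cnj z = z" "slice_coord (slice_emb I z) = z" by (simp_all add: slice_coord complex_eq_iff)
    moreover have "\<phi> (cnj z) = cnj (\<phi> z)"
      using assms by (simp add: intrinsic_on_def)
    ultimately have "Im (\<phi> z) = 0"
      by (metis cnj.simps(2) equation_minus_iff neg_equal_zero)
    then show ?thesis
      using 3 assms(1) \<open>slice_coord (slice_emb I z) = z\<close> by (simp add: stem_def axial_def slice_emb_def[of I "\<phi> z"] qim_emb)
  qed
qed

lemma intrinsic_on_deriv:
  assumes "intrinsic_on A \<phi>" "\<phi> holomorphic_on A" "open A"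
  shows "intrinsic_on A (deriv \<phi>)"
  unfolding intrinsic_on_def
proof (intro ballI conjI)
  fix z assume z: "z \<in> A"
  show cz: "cnj z \<in> A"
    using assms z by (auto simp: intrinsic_on_def)
  have "(\<phi> has_field_derivative deriv \<phi> z) (at z)"
    by (rule holomorphic_derivI[OF assms(2,3) z])
  then have "((\<lambda>w. cnj (\<phi> (cnj w))) has_field_derivative cnj (deriv \<phi> z)) (at (cnj z))"
    by (intro has_field_derivative_cnj_cnj[unfolded o_def]) simp
  moreover have "cnj (\<phi> (cnj w)) = \<phi> w" if "w \<in> A" for w
    using assms(1) that by (auto simp: intrinsic_on_def)
  ultimately have "(\<phi> has_field_derivative cnj (deriv \<phi> z)) (at (cnj z))"
    by (rule has_field_derivative_transform_within_open[OF _ assms(3) cz])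
  then show "deriv \<phi> (cnj z) = cnj (deriv \<phi> z)"
    by (rule DERIV_imp_deriv)
qed

section \<open>Averages over the segment from \<open>qcnj x\<close> to \<open>x\<close>\<close>

text \<open>The segment depends linearly on \<open>x\<close> and degenerates harmlessly at real
  points, so these averages stay regular where a quotient by the imaginary part is
  undefined.\<close>

definition conj_mean :: "(real \<Rightarrow> real) \<Rightarrow> (quat \<Rightarrow> quat) \<Rightarrow> quat \<Rightarrow> quat" where
  "conj_mean w F x = integral (cbox 0 1) (\<lambda>t. w t *\<^sub>R F (t *\<^sub>R x + (1 - t) *\<^sub>R qcnj x))"

lemma conj_segment_emb:
  "imag_unit I \<Longrightarrow> t *\<^sub>R slice_emb I z + (1 - t) *\<^sub>R qcnj (slice_emb I z) = slice_emb I (t *\<^sub>R z + (1 - t) *\<^sub>R cnj z)"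
  by (simp add: qcnj_emb slice_emb_add slice_emb_scaleR)

text \<open>The segment lies in the slice of \<open>I\<close>, where \<open>stem \<psi>\<close> is
  \<psi> transported by the bounded linear map \<open>slice_emb I\<close>; this map passes through
  the integral.\<close>

lemma conj_mean_emb:
  assumes I: "imag_unit I" and \<psi>: "intrinsic_on A \<psi>" and A: "convex A" and z: "z \<in> A"
    and int: "((\<lambda>t. w t *\<^sub>R \<psi> (t *\<^sub>R z + (1 - t) *\<^sub>R cnj z)) has_integral c) {0..1}"
  shows "conj_mean w (stem \<psi>) (slice_emb I z) = slice_emb I c"
proof -
  have "((\<lambda>t. slice_emb I (w t *\<^sub>R \<psi> (t *\<^sub>R z + (1 - t) *\<^sub>R cnj z))) has_integral slice_emb I c) {0..1}"
    using has_integral_linear[OF int bounded_linear_emb[OF I]] by (simp add: o_def)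
  moreover have "slice_emb I (w t *\<^sub>R \<psi> (t *\<^sub>R z + (1 - t) *\<^sub>R cnj z)) =
      w t *\<^sub>R stem \<psi> (t *\<^sub>R slice_emb I z + (1 - t) *\<^sub>R qcnj (slice_emb I z))" if "t \<in> {0..1}" for t
  proof -
    have "t *\<^sub>R z + (1 - t) *\<^sub>R cnj z \<in> A"
      using A z \<psi> that by (auto simp: intrinsic_on_def intro!: convexD)
    then show ?thesis
      by (simp only: conj_segment_emb[OF I] stem_emb[OF I \<psi>] slice_emb_scaleR)
  qed
  ultimately have "((\<lambda>t. w t *\<^sub>R stem \<psi> (t *\<^sub>R slice_emb I z + (1 - t) *\<^sub>R qcnj (slice_emb I z))) has_integral slice_emb I c) {0..1}"
    by (rule has_integral_eq[rotated])
  then show ?thesis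
    unfolding conj_mean_def by (simp add: integral_unique)
qed

text \<open>The first formula is the fundamental theorem along the segment, with \<phi>(z) -
  \<phi>(cnj z) evaluated by reflection symmetry. The second is integration by parts. Together they
  turn the divisions by \<open>Im z\<close> in \<open>stem1\<close> and \<open>stem2\<close> into
  averages.\<close>

lemma
  assumes hol: "\<phi> holomorphic_on A" "open A" and A: "convex A" and \<phi>: "intrinsic_on A \<phi>" and z: "z \<in> A" "Im z \<noteq> 0"
  shows has_integral_conj_segment_deriv:
      "((\<lambda>t. deriv \<phi> (t *\<^sub>R z + (1 - t) *\<^sub>R cnj z)) has_integral of_real (Im (\<phi> z) / Im z)) {0..1}" (is ?A)
    and has_integral_conj_segment_deriv2:
      "((\<lambda>t. t *\<^sub>R deriv (deriv \<phi>) (t *\<^sub>R z + (1 - t) *\<^sub>R cnj z)) has_integral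
        (deriv \<phi> z - of_real (Im (\<phi> z) / Im z)) / (2 * \<i> * of_real (Im z))) {0..1}" (is ?B)
proof -
  let ?\<gamma> = "\<lambda>t. t *\<^sub>R z + (1 - t) *\<^sub>R cnj z"
  have zc: "z - cnj z = 2 * \<i> * of_real (Im z)"
    by (simp add: complex_eq_iff)
  have \<gamma>A: "?\<gamma> t \<in> A" if "t \<in> {0..1}" for t
    using A z \<phi> that by (auto simp: intrinsic_on_def intro!: convexD)
  have \<gamma>': "(?\<gamma> has_vector_derivative (z - cnj z)) (at t within {0..1})" for t
    by (auto intro!: derivative_eq_intros)
  have chain: "((\<lambda>t. \<psi> (?\<gamma> t)) has_vector_derivative (z - cnj z) * deriv \<psi> (?\<gamma> t)) (at t within {0..1})"
    if "\<psi> holomorphic_on A" "t \<in> {0..1}" for \<psi> t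
    using field_vector_diff_chain_within[OF \<gamma>' has_field_derivative_at_within[OF holomorphic_derivI[OF that(1) hol(2) \<gamma>A[OF that(2)]]]]
    by (simp add: o_def)
  have "((\<lambda>t. (z - cnj z) * deriv \<phi> (?\<gamma> t)) has_integral \<phi> (?\<gamma> 1) - \<phi> (?\<gamma> 0)) {0..1}"
    by (rule fundamental_theorem_of_calculus) (use chain[OF hol(1)] in auto)
  moreover have "\<phi> (?\<gamma> 1) - \<phi> (?\<gamma> 0) = 2 * \<i> * of_real (Im (\<phi> z))"
    using \<phi> z by (simp add: intrinsic_on_def complex_eq_iff)
  ultimately have "((\<lambda>t. (z - cnj z) * deriv \<phi> (?\<gamma> t)) has_integral 2 * \<i> * of_real (Im (\<phi> z))) {0..1}"
    by simp
  from has_integral_mult_right[OF this, of "1 / (z - cnj z)"]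
  show A: ?A
    using z by (simp add: zc)
  have hol': "deriv \<phi> holomorphic_on A"
    using hol by (rule holomorphic_deriv)
  have "((\<lambda>t. t *\<^sub>R deriv \<phi> (?\<gamma> t)) has_vector_derivative
      t *\<^sub>R ((z - cnj z) * deriv (deriv \<phi>) (?\<gamma> t)) + deriv \<phi> (?\<gamma> t)) (at t within {0..1})"
    if "t \<in> {0..1}" for t
    using has_vector_derivative_scaleR[OF DERIV_ident chain[OF hol' that]] by simp
  then have "((\<lambda>t. t *\<^sub>R ((z - cnj z) * deriv (deriv \<phi>) (?\<gamma> t)) + deriv \<phi> (?\<gamma> t)) has_integral
      1 *\<^sub>R deriv \<phi> (?\<gamma> 1) - 0 *\<^sub>R deriv \<phi> (?\<gamma> 0)) {0..1}"
    by (intro fundamental_theorem_of_calculus) auto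
  from has_integral_mult_right[OF has_integral_diff[OF this A], of "1 / (z - cnj z)"]
  show ?B
    using z by (simp add: zc)
qed

lemma conj_segment_in:
  assumes "convex N" "\<And>x. x \<in> N \<Longrightarrow> qcnj x \<in> N" "x \<in> N" "0 \<le> t" "t \<le> 1"
  shows "t *\<^sub>R x + (1 - t) *\<^sub>R qcnj x \<in> N"
  using assms(3-5) by (intro convexD[OF assms(1)] assms(2)) simp_all

lemma continuous_on_conj_mean:
  assumes F: "continuous_on N F" and N: "convex N" "\<And>x. x \<in> N \<Longrightarrow> qcnj x \<in> N"
    and w: "continuous_on {0..1} w"
  shows "continuous_on N (conj_mean w F)"
  unfolding conj_mean_def
proof (rule integral_continuous_on_param)
  have "continuous_on (N \<times> cbox 0 1) (\<lambda>p. w (snd p) *\<^sub>R F (snd p *\<^sub>R fst p + (1 - snd p) *\<^sub>R qcnj (fst p)))"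
    by (intro continuous_intros continuous_on_compose2[OF w] continuous_on_compose2[OF F])
      (auto intro: conj_segment_in[OF N])
  then show "continuous_on (N \<times> cbox 0 1) (\<lambda>(x, t). w t *\<^sub>R F (t *\<^sub>R x + (1 - t) *\<^sub>R qcnj x))"
    by (simp add: case_prod_unfold)
qed

text \<open>Differentiation under the integral with values in the bounded linear maps: the
  differential is itself a parameter integral, hence continuous.\<close>

lemma C1_on_conj_mean:
  assumes F: "C1_on N F" and N: "open N" "convex N" "\<And>x. x \<in> N \<Longrightarrow> qcnj x \<in> N"
    and w: "continuous_on {0..1} w"
  shows "C1_on N (conj_mean w F)"
proof -
  obtain F' :: "quat \<Rightarrow> quat \<Rightarrow>\<^sub>L quat" where F': "\<And>x. x \<in> N \<Longrightarrow> (F has_derivative F' x) (at x)"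
    "continuous_on N F'"
    using F unfolding C1_on_def by blast
  have contF: "continuous_on N F"
    using F'(1) has_derivative_continuous by (intro continuous_at_imp_continuous_on) blast
  define y where "y x t = t *\<^sub>R x + (1 - t) *\<^sub>R qcnj x" for x and t :: real
  have yN: "y x t \<in> N" if "x \<in> N" "t \<in> cbox 0 1" for x t
    using that unfolding y_def by (intro conj_segment_in[OF N(2,3)]) auto
  have bl: "bounded_linear (\<lambda>v. y v t)" for t
    unfolding y_def by (intro bounded_linear_add bounded_linear_const_scaleR bounded_linear_ident bounded_linear_qcnj)
  define D where "D x t = Blinfun (\<lambda>v. w t *\<^sub>R F' (y x t) (y v t))" for x t
  have D: "blinfun_apply (D x t) = (\<lambda>v. w t *\<^sub>R F' (y x t) (y v t))" for x t
    unfolding D_def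
    by (intro bounded_linear_Blinfun_apply bounded_linear_const_scaleR
        bounded_linear_compose[OF blinfun.bounded_linear_right bl])
  have conty: "continuous_on (N \<times> cbox 0 1) (\<lambda>p. y (fst p) (snd p))"
    unfolding y_def by (intro continuous_intros)
  have contD: "continuous_on (N \<times> cbox 0 1) (\<lambda>p. D (fst p) (snd p))"
  proof (rule continuous_on_blinfun_componentwise)
    fix i :: quat
    show "continuous_on (N \<times> cbox 0 1) (\<lambda>p. D (fst p) (snd p) i)"
      unfolding D using yN
      by (intro continuous_intros continuous_on_compose2[OF w] continuous_on_compose2[OF F'(2) conty])
        (auto simp: y_def intro!: continuous_intros)
  qed
  have der: "(conj_mean w F has_derivative integral (cbox 0 1) (D x)) (at x)" if x: "x \<in> N" for x
  proof -
    have "((\<lambda>x. integral (cbox 0 1) (\<lambda>t. w t *\<^sub>R F (y x t))) has_derivative integral (cbox 0 1) (D x)) (at x within N)"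
    proof (rule leibniz_rule[OF _ _ _ x N(2)])
      show "((\<lambda>x. w t *\<^sub>R F (y x t)) has_derivative blinfun_apply (D x t)) (at x within N)"
        if "x \<in> N" "t \<in> cbox 0 1" for x t
      proof -
        have "((\<lambda>x. F (y x t)) has_derivative (\<lambda>v. F' (y x t) (y v t))) (at x within N)"
          by (rule has_derivative_compose[OF bounded_linear_imp_has_derivative[OF bl] F'(1)[OF yN[OF that]]])
        then show ?thesis
          unfolding D by (rule has_derivative_scaleR_right)
      qed
      show "(\<lambda>t. w t *\<^sub>R F (y x t)) integrable_on cbox 0 1" if "x \<in> N" for x
        using that yN w
        by (intro integrable_continuous continuous_intros continuous_on_compose2[OF contF])
          (auto simp: y_def intro!: continuous_intros)
      show "continuous_on (N \<times> cbox 0 1) (\<lambda>(x, t). D x t)"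
        using contD by (simp add: case_prod_unfold)
    qed
    then show ?thesis
      unfolding conj_mean_def[abs_def] y_def at_within_open[OF x N(1)] .
  qed
  have "continuous_on N (\<lambda>x. integral (cbox 0 1) (D x))"
    by (rule integral_continuous_on_param) (use contD in \<open>simp add: case_prod_unfold\<close>)
  with der show ?thesis
    unfolding C1_on_def by (intro exI[of _ "\<lambda>x. integral (cbox 0 1) (D x)"]) auto
qed

section \<open>Regularity of intrinsic stem functions across the real axis\<close>

lemma norm_zt_diff_of_real: "norm (slice_coord x - of_real p) = norm (x - of_real p)"
proof -
  obtain I where I: "imag_unit I" "slice_emb I (slice_coord x) = x"
    using ex_emb by blast
  then have "x - of_real p = slice_emb I (slice_coord x - of_real p)"
    by (simp add: slice_emb_diff)
  then show ?thesis
    by (simp add: norm_emb[OF I(1)])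
qed

lemma slice_coord_in_ball_iff: "slice_coord x \<in> ball (of_real p) \<delta> \<longleftrightarrow> x \<in> ball (of_real p) \<delta>"
  by (simp add: dist_norm norm_minus_commute[of "of_real p"] norm_zt_diff_of_real)

lemma intrinsic_real:
  assumes "intrinsic_on A \<phi>" "of_real q \<in> A"
  shows "\<phi> (of_real q) = of_real (Re (\<phi> (of_real q)))"
proof -
  have "\<phi> (of_real q) = cnj (\<phi> (of_real q))"
    using assms unfolding intrinsic_on_def by (metis complex_cnj_complex_of_real)
  then show ?thesis
    by (simp add: complex_eq_iff)
qed

text \<open>A real point and any \<open>y\<close> lie in a common slice, on which
  \<open>stem \<psi>\<close> is \<psi> transported isometrically. The values of \<psi> and its
  derivative there are real, hence the same for all slices, so one \<delta> from the complex
  derivative serves every direction.\<close>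

lemma stem_has_derivative_real:
  assumes hol: "\<psi> holomorphic_on A" "open A" and \<psi>: "intrinsic_on A \<psi>" and x: "qim x = 0" "slice_coord x \<in> A"
  shows "(stem \<psi> has_derivative (\<lambda>v. v * stem (deriv \<psi>) x)) (at x)"
proof -
  define q where "q = qRe x"
  have xq: "x = of_real q" and zq: "slice_coord x = of_real q"
    using x by (simp_all add: q_def qim_eq_0_iff complex_eq_iff)
  note \<psi>' = intrinsic_on_deriv[OF \<psi> hol]
  note d = holomorphic_derivI[OF hol x(2), unfolded zq]
  have A: "of_real q \<in> A" using x zq by simp
  have sx: "stem \<psi> x = of_real (Re (\<psi> (of_real q)))" "stem (deriv \<psi>) x = of_real (Re (deriv \<psi> (of_real q)))"
    using x(1) by (simp_all add: stem_def axial_def zq)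
  obtain c where c: "\<psi> (of_real q) = of_real c"
    using intrinsic_real[OF \<psi> A] by blast
  obtain c' where c': "deriv \<psi> (of_real q) = of_real c'"
    using intrinsic_real[OF \<psi>' A] by blast
  have eq: "norm (stem \<psi> y - stem \<psi> x - (y - x) * stem (deriv \<psi>) x) =
      norm (\<psi> (slice_coord y) - \<psi> (of_real q) - (slice_coord y - of_real q) * deriv \<psi> (of_real q))"
    if "slice_coord y \<in> A" for y
  proof -
    obtain I where I: "imag_unit I" "slice_emb I (slice_coord y) = y"
      using ex_emb by blast
    have "stem \<psi> y = slice_emb I (\<psi> (slice_coord y))"
      using stem_emb[OF I(1) \<psi> that] I by simp
    then have "stem \<psi> y - stem \<psi> x - (y - x) * stem (deriv \<psi>) x =
        slice_emb I (\<psi> (slice_coord y) - \<psi> (of_real q) - (slice_coord y - of_real q) * deriv \<psi> (of_real q))"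
      unfolding sx by (simp add: slice_emb_diff slice_emb_mult I c c' xq)
    then show ?thesis
      by (simp add: norm_emb[OF I(1)])
  qed
  show ?thesis
    unfolding has_derivative_at_alt
  proof (intro conjI allI impI)
    show "bounded_linear (\<lambda>v. v * stem (deriv \<psi>) x)"
      by (rule bounded_linear_mult_left)
    fix e :: real assume "0 < e"
    moreover have "(\<psi> has_derivative (\<lambda>w. w * deriv \<psi> (of_real q))) (at (of_real q))"
      using d unfolding has_field_derivative_def
      by (rule has_derivative_eq_rhs) (simp add: fun_eq_iff)
    ultimately obtain d where d: "0 < d" "\<And>w. norm (w - of_real q) < d \<Longrightarrow>
        norm (\<psi> w - \<psi> (of_real q) - (w - of_real q) * deriv \<psi> (of_real q)) \<le> e * norm (w - of_real q)"
      unfolding has_derivative_at_alt by blast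
    obtain d' where d': "0 < d'" "ball (of_real q) d' \<subseteq> A"
      using hol(2) A open_contains_ball by blast
    show "\<exists>d>0. \<forall>y. norm (y - x) < d \<longrightarrow>
        norm (stem \<psi> y - stem \<psi> x - (y - x) * stem (deriv \<psi>) x) \<le> e * norm (y - x)"
    proof (intro exI[of _ "min d d'"] conjI allI impI)
      fix y assume y: "norm (y - x) < min d d'"
      have n: "norm (y - x) = norm (slice_coord y - of_real q)"
        by (simp add: xq norm_zt_diff_of_real)
      have "slice_coord y \<in> A"
        using y d'(2) unfolding n by (auto simp: dist_norm norm_minus_commute)
      from eq[OF this] show "norm (stem \<psi> y - stem \<psi> x - (y - x) * stem (deriv \<psi>) x) \<le> e * norm (y - x)"
        using d(2)[of "slice_coord y"] y unfolding n by simp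
    qed (use d d' in auto)
  qed
qed

lemma C1_on_stem_off_real:
  assumes hol: "\<psi> holomorphic_on A" "open A"
  shows "C1_on {x. slice_coord x \<in> A \<and> qim x \<noteq> 0} (stem \<psi>)"
  by (rule C1_on_stem[where A = "A \<inter> {z. Im z > 0}"])
    (use hol in \<open>auto intro: holomorphic_on_subset open_Int open_halfspace_Im_gt\<close>)

lemma continuous_on_stem:
  assumes hol: "\<psi> holomorphic_on A" "open A" and \<psi>: "intrinsic_on A \<psi>" and N: "slice_coord ` N \<subseteq> A"
  shows "continuous_on N (stem \<psi>)"
proof (rule continuous_at_imp_continuous_on, rule ballI)
  fix x assume "x \<in> N"
  then have x: "slice_coord x \<in> A" using N by blast
  show "isCont (stem \<psi>) x"
  proof (cases "qim x = 0")
    case True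
    from stem_has_derivative_real[OF hol \<psi> True x] show ?thesis
      by (rule has_derivative_continuous)
  next
    case False
    then obtain L where "(stem \<psi> has_derivative blinfun_apply L) (at x)"
      using C1_on_stem_off_real[OF hol] x unfolding C1_on_def by blast
    then show ?thesis
      by (rule has_derivative_continuous)
  qed
qed

context
  fixes \<phi> :: "complex \<Rightarrow> complex" and p \<delta> :: real and A :: "complex set" and N :: "quat set"
  defines "A \<equiv> ball (of_real p) \<delta>" and "N \<equiv> ball (of_real p) \<delta>"
  assumes hol: "\<phi> holomorphic_on A" and \<phi>: "intrinsic_on A \<phi>"
begin

lemma real_ball_props:
  "open A" "convex A" "open N" "convex N" "\<And>x. x \<in> N \<Longrightarrow> slice_coord x \<in> A" "\<And>x. x \<in> N \<Longrightarrow> qcnj x \<in> N"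
proof -
  show "qcnj x \<in> N" if "x \<in> N" for x
  proof -
    have "qcnj x - of_real p = qcnj (x - of_real p)"
      by (simp add: quat_eq_iff)
    then have "norm (qcnj x - of_real p) = norm (x - of_real p)"
      by simp
    then show ?thesis
      using that by (simp add: N_def dist_norm norm_minus_commute[of "of_real p"])
  qed
qed (simp_all add: A_def N_def slice_coord_in_ball_iff del: mem_ball)

text \<open>The quotient of the imaginary part of \<phi> by the distance to the real axis is
  continued across the axis by the derivative; a single average represents both cases.\<close>

lemma conj_mean_stem_deriv:
  assumes "x \<in> N"
  shows "conj_mean (\<lambda>t. 1) (stem (deriv \<phi>)) x =
    (if qim x = 0 then stem (deriv \<phi>) x else of_real (Im (\<phi> (slice_coord x)) / norm (qim x)))"
proof (cases "qim x = 0")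
  case True
  then have "x = of_real (qRe x)"
    by (simp add: qim_eq_0_iff)
  then have "qcnj x = x"
    by (metis quat_of_real_sel(2-4) qcnj.simps quat_eq_iff minus_zero)
  with True show ?thesis
    by (simp add: conj_mean_def flip: scaleR_add_left)
next
  case False
  obtain I where I: "imag_unit I" "slice_emb I (slice_coord x) = x"
    using ex_emb by blast
  have z: "slice_coord x \<in> A" "Im (slice_coord x) \<noteq> 0"
    using assms False real_ball_props by auto
  note hi = has_integral_conj_segment_deriv[OF hol real_ball_props(1,2) \<phi> z]
  have "conj_mean (\<lambda>t. 1) (stem (deriv \<phi>)) (slice_emb I (slice_coord x)) = slice_emb I (of_real (Im (\<phi> (slice_coord x)) / Im (slice_coord x)))"
    by (rule conj_mean_emb[OF I(1) intrinsic_on_deriv[OF \<phi> hol real_ball_props(1)] real_ball_props(2) z(1)])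
      (use hi in simp)
  then show ?thesis
    using False by (simp only: I slice_emb_of_real slice_coord_sel if_False)
qed

text \<open>The differential multiplies the slice component of \<open>v\<close> by
  \<open>stem (deriv \<phi>) x\<close> and the orthogonal component by \<open>\<theta> x\<close>.
  The two factors agree at real points, where the splitting itself is discontinuous.\<close>

lemma C1_on_stem_real_ball: "C1_on N (stem \<phi>)"
proof (rule C1_onI)
  note props = real_ball_props
  define \<theta> where "\<theta> = conj_mean (\<lambda>t. 1) (stem (deriv \<phi>))"
  \<comment> \<open>The component of \<open>v\<close> in the slice of \<open>x\<close>; at real
    \<open>x\<close> it is only the real part of \<open>v\<close>.\<close>
  define par where "par x v = of_real (qRe v) + (v \<bullet> sgn (qim x)) *\<^sub>R sgn (qim x)" for x v
  have hol': "deriv \<phi> holomorphic_on A" and \<phi>': "intrinsic_on A (deriv \<phi>)"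
    using holomorphic_deriv[OF hol props(1)] intrinsic_on_deriv[OF \<phi> hol props(1)] by auto
  have cont': "continuous_on N (stem (deriv \<phi>))"
    using props by (intro continuous_on_stem[OF hol' props(1) \<phi>']) auto
  have cont\<theta>: "continuous_on N \<theta>"
    unfolding \<theta>_def using props by (intro continuous_on_conj_mean cont') auto
  show "(stem \<phi> has_derivative (\<lambda>v. v * \<theta> x + par x v * (stem (deriv \<phi>) x - \<theta> x))) (at x)"
    if x: "x \<in> N" for x
  proof (cases "qim x = 0")
    case True
    then have "stem (deriv \<phi>) x = \<theta> x"
      using x by (simp add: \<theta>_def conj_mean_stem_deriv)
    then show ?thesis
      using stem_has_derivative_real[OF hol props(1) \<phi> True props(5)[OF x]] by simp
  next
    case False
    have I2: "sgn (qim x) * sgn (qim x) = - 1"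
      using imag_unit_square[OF imag_unit_sgn_qim[OF False]] .
    have "v * \<theta> x + par x v * (stem (deriv \<phi>) x - \<theta> x) =
      of_real (qRe v * Re (deriv \<phi> (slice_coord x)) + (v \<bullet> sgn (qim x)) * - Im (deriv \<phi> (slice_coord x)))
      + ((qRe v * Im (deriv \<phi> (slice_coord x)) + (v \<bullet> sgn (qim x)) * Re (deriv \<phi> (slice_coord x))) *\<^sub>R sgn (qim x)
      + (Im (\<phi> (slice_coord x)) / norm (qim x)) *\<^sub>R (qim v - (v \<bullet> sgn (qim x)) *\<^sub>R sgn (qim x)))" for v
    proof -
      define c where "c = Im (\<phi> (slice_coord x)) / norm (qim x)"
      have \<theta>x: "\<theta> x = c *\<^sub>R 1"
        using False x by (simp add: \<theta>_def conj_mean_stem_deriv c_def of_real_def)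
      show ?thesis
        unfolding \<theta>x c_def[symmetric] par_def stem_def axial_def qim_def[of v] of_real_def
        by (simp add: algebra_simps I2)
    qed
    then show ?thesis
      using axial_has_derivative[OF False holomorphic_Re_has_derivative[OF hol props(1) props(5)[OF x]]
          holomorphic_Im_has_derivative[OF hol props(1) props(5)[OF x]]]
      by (simp add: stem_def[of \<phi>])
  qed
  fix v
  have "continuous_on N (\<lambda>x. par x v * (stem (deriv \<phi>) x - \<theta> x))"
  proof (rule continuous_at_imp_continuous_on, rule ballI)
    fix x assume x: "x \<in> N"
    have c: "isCont (stem (deriv \<phi>)) x" "isCont \<theta> x"
      using cont' cont\<theta> x props(3) continuous_on_eq_continuous_at by blast+
    show "isCont (\<lambda>x. par x v * (stem (deriv \<phi>) x - \<theta> x)) x"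
    proof (cases "qim x = 0")
      case True
      \<comment> \<open>The bounded but discontinuous factor \<open>par\<close> is multiplied by a
        continuous one that vanishes at \<open>x\<close>.\<close>
      then have 0: "stem (deriv \<phi>) x - \<theta> x = 0"
        using x by (simp add: \<theta>_def conj_mean_stem_deriv)
      have bd: "norm (par y v * (stem (deriv \<phi>) y - \<theta> y)) \<le> norm (stem (deriv \<phi>) y - \<theta> y) * (2 * norm v)" for y
      proof -
        have "\<bar>v \<bullet> sgn (qim y)\<bar> * norm (sgn (qim y)) \<le> norm v"
          using Cauchy_Schwarz_ineq2[of v "sgn (qim y)"] by (cases "qim y = 0") (auto simp: norm_sgn)
        moreover have "\<bar>qRe v\<bar> \<le> norm v"
          by (simp add: norm_quat_def real_le_rsqrt)
        ultimately have "norm (par y v) \<le> 2 * norm v"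
          unfolding par_def by (intro norm_triangle_le) simp
        then show ?thesis
          by (simp add: norm_mult mult.commute mult_right_mono)
      qed
      have "((\<lambda>y. stem (deriv \<phi>) y - \<theta> y) \<longlongrightarrow> 0) (at x)"
        using tendsto_diff[OF c[unfolded isCont_def]] 0 by simp
      then have "((\<lambda>y. par y v * (stem (deriv \<phi>) y - \<theta> y)) \<longlongrightarrow> 0) (at x)"
        by (rule tendsto_0_le[where K = "2 * norm v"]) (use bd in \<open>simp add: always_eventually\<close>)
      then show ?thesis
        by (simp add: isCont_def 0)
    next
      case False
      have "isCont qim x"
        using bounded_linear_qim by (rule linear_continuous_at)
      then have "isCont (\<lambda>x. par x v) x"
        unfolding par_def using False by (intro continuous_intros)
      then show ?thesis
        using c by (intro continuous_intros)
    qed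
  qed
  then show "continuous_on N (\<lambda>x. v * \<theta> x + par x v * (stem (deriv \<phi>) x - \<theta> x))"
    by (intro continuous_on_add continuous_on_mult_left cont\<theta>)
qed

end

text \<open>Off the axis the averages equal \<open>stem1 \<phi>\<close> and
  \<open>stem2 \<phi>\<close>, so the relations are inherited. Their smoothness across the axis
  comes from that of \<open>stem (deriv \<phi>)\<close> and
  \<open>stem (deriv (deriv \<phi>))\<close>.\<close>

lemma fueter_chain_stem_real_ball:
  assumes hol: "\<phi> holomorphic_on ball (of_real p) \<delta>" and \<phi>: "intrinsic_on (ball (of_real p) \<delta>) \<phi>"
  shows "fueter_chain (ball (of_real p) \<delta>) (stem \<phi>)
    (conj_mean (\<lambda>t. - 1) (stem (deriv \<phi>))) (conj_mean (\<lambda>t. - (2 * t)) (stem (deriv (deriv \<phi>))))"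
proof -
  let ?A = "ball (of_real p :: complex) \<delta>" and ?N = "ball (of_real p :: quat) \<delta>"
  define G where "G = conj_mean (\<lambda>t. - 1) (stem (deriv \<phi>))"
  define K where "K = conj_mean (\<lambda>t. - (2 * t)) (stem (deriv (deriv \<phi>)))"
  note props = real_ball_props[OF hol \<phi>]
  note hol' = holomorphic_deriv[OF hol open_ball] and \<phi>' = intrinsic_on_deriv[OF \<phi> hol open_ball]
  note hol'' = holomorphic_deriv[OF hol' open_ball] and \<phi>'' = intrinsic_on_deriv[OF \<phi>' hol' open_ball]
  let ?M = "?N \<inter> {x. qim x \<noteq> 0}"
  have "open {x. qim x \<noteq> 0}"
    by (intro open_Collect_neq continuous_intros)
  then have oM: "open ?M"
    by (intro open_Int open_ball)
  have eqs: "stem1 \<phi> x = G x \<and> stem2 \<phi> x = K x" if x: "x \<in> ?M" for x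
  proof -
    obtain I where I: "imag_unit I" "slice_emb I (slice_coord x) = x" "I = sgn (qim x)"
      using ex_emb x by blast
    have z: "slice_coord x \<in> ?A" "Im (slice_coord x) \<noteq> 0"
      using x props by auto
    note hi = has_integral_conj_segment_deriv[OF hol open_ball convex_ball \<phi> z]
    note hi2 = has_integral_conj_segment_deriv2[OF hol open_ball convex_ball \<phi> z]
    have "G (slice_emb I (slice_coord x)) = slice_emb I (- of_real (Im (\<phi> (slice_coord x)) / Im (slice_coord x)))"
      unfolding G_def
      by (rule conj_mean_emb[OF I(1) \<phi>' convex_ball z(1)]) (use has_integral_neg[OF hi] in simp)
    moreover have "K (slice_emb I (slice_coord x)) = slice_emb I ((-2) *\<^sub>R ((deriv \<phi> (slice_coord x) - of_real (Im (\<phi> (slice_coord x)) / Im (slice_coord x))) / (2 * \<i> * of_real (Im (slice_coord x)))))"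
      unfolding K_def
      by (rule conj_mean_emb[OF I(1) \<phi>'' convex_ball z(1)]) (use has_integral_cmul[OF hi2, of "-2"] in simp)
    \<comment> \<open>The prefactor -2 / (2 i Im z) equals i / Im z, which swaps real and imaginary
      parts up to sign.\<close>
    moreover have "(-2) *\<^sub>R ((deriv \<phi> (slice_coord x) - of_real (Im (\<phi> (slice_coord x)) / Im (slice_coord x))) / (2 * \<i> * of_real (Im (slice_coord x))))
      = Complex (- (Im (deriv \<phi> (slice_coord x)) / Im (slice_coord x))) (Re (deriv \<phi> (slice_coord x)) / Im (slice_coord x) - Im (\<phi> (slice_coord x)) / (Im (slice_coord x))\<^sup>2)"
      using z(2) by (simp add: complex_eq_iff Re_divide Im_divide field_simps power2_eq_square)
    ultimately have "G x = slice_emb I (- of_real (Im (\<phi> (slice_coord x)) / Im (slice_coord x)))"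
      and "K x = slice_emb I (Complex (- (Im (deriv \<phi> (slice_coord x)) / Im (slice_coord x)))
        (Re (deriv \<phi> (slice_coord x)) / Im (slice_coord x) - Im (\<phi> (slice_coord x)) / (Im (slice_coord x))\<^sup>2))"
      by (simp_all only: I(2))
    then show ?thesis
      by (simp add: stem1_def stem2_def axial_def slice_emb_def I(3))
  qed
  have chain: "fueter_chain ?M (stem \<phi>) (stem1 \<phi>) (stem2 \<phi>)"
    by (rule fueter_chain_stem[where A = "?A \<inter> {z. Im z > 0}"])
      (use props hol in \<open>auto intro: holomorphic_on_subset open_Int open_halfspace_Im_gt\<close>)
  show ?thesis
    unfolding fueter_chain_def G_def[symmetric] K_def[symmetric]
  proof (intro conjI ballI impI)
    show "C1_on ?N G"
      unfolding G_def
      using C1_on_stem_real_ball[OF hol' \<phi>'] props by (intro C1_on_conj_mean continuous_intros) auto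
    show "C1_on ?N K"
      unfolding K_def
      using C1_on_stem_real_ball[OF hol'' \<phi>''] props by (intro C1_on_conj_mean continuous_intros) auto
    fix x assume xN: "x \<in> ?N" and nz: "qim x \<noteq> 0"
    then have x: "x \<in> ?M" by simp
    note c = chain[unfolded fueter_chain_def, THEN conjunct2, THEN conjunct2, rule_format, OF x nz]
    show "\<exists>L. (stem \<phi> has_derivative L) (at x) \<and> fueter L = 2 *\<^sub>R G x"
      using c unfolding eqs[OF x, THEN conjunct1] by blast
    obtain L where "(stem1 \<phi> has_derivative L) (at x)" "fueter_cnj L = stem2 \<phi> x"
      using c by blast
    then show "\<exists>L. (G has_derivative L) (at x) \<and> fueter_cnj L = K x"
      using has_derivative_transform_within_open[OF _ oM x, of "stem1 \<phi>" L UNIV G] eqs x by auto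
    obtain L where "(stem2 \<phi> has_derivative L) (at x)" "fueter L = 0"
      using c by blast
    then show "\<exists>L. (K has_derivative L) (at x) \<and> fueter L = 0"
      using has_derivative_transform_within_open[OF _ oM x, of "stem2 \<phi>" L UNIV K] eqs by auto
  qed
qed

section \<open>Consequences of local slice regularity\<close>

lemma dbar_eq_fueter:
  assumes "(f has_derivative L) (at x)"
  shows "dbar f x = (1 / 2) *\<^sub>R fueter L"
proof -
  have "partial_deriv v f x = L v" for v
  proof -
    have "((\<lambda>t. x + t *\<^sub>R v) has_derivative (\<lambda>t. t *\<^sub>R v)) (at 0)"
      by (auto intro!: derivative_eq_intros)
    then have "((\<lambda>t. f (x + t *\<^sub>R v)) has_derivative (\<lambda>t. L (t *\<^sub>R v))) (at 0)"
      by (rule has_derivative_compose) (use assms in simp)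
    then show ?thesis
      unfolding partial_deriv_def
      by (intro vector_derivative_at)
        (simp add: has_vector_derivative_def linear_scale[OF has_derivative_linear[OF assms]])
  qed
  then show ?thesis
    by (simp add: dbar_def fueter_def)
qed

lemma slice_emb_i [simp]: "slice_emb I \<i> = I"
  by (simp add: slice_emb_def)

lemma slice_emb_in_slice_plane: "slice_emb I w \<in> slice_plane I"
proof -
  have "slice_emb I w = Re w *\<^sub>R 1 + Im w *\<^sub>R I"
    by (simp add: slice_emb_def of_real_def)
  also have "\<dots> \<in> span {1, I}"
    by (intro span_add span_scale span_base) auto
  finally show ?thesis
    by (simp add: slice_plane_def)
qed

text \<open>The witness \<open>D\<close> is a derivative only within the slice. Along lines in the
  slice both \<open>D\<close> and the full differential \<open>L\<close> are the directional
  derivative of \<open>f\<close>, so they agree there and \<open>L\<close> inherits the commutation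
  with \<open>I\<close>.\<close>

lemma slice_holomorphic_derivative:
  assumes hol: "slice_holomorphic_on I (\<Omega> \<inter> slice_plane I) f" and I: "imag_unit I" and \<Omega>: "open \<Omega>"
    and x: "slice_emb I z \<in> \<Omega>" and L: "(f has_derivative L) (at (slice_emb I z))"
  shows "L (slice_emb I (\<i> * w)) = I * L (slice_emb I w)"
proof -
  let ?x = "slice_emb I z" and ?S = "\<Omega> \<inter> slice_plane I"
  have "?x \<in> ?S"
    using x slice_emb_in_slice_plane by simp
  then obtain D where D: "(f has_derivative D) (at ?x within ?S)"
    and DI: "\<And>v. v \<in> slice_plane I \<Longrightarrow> D (I * v) = I * D v"
    using hol unfolding slice_holomorphic_on_def by blast
  have eq: "D (slice_emb I u) = L (slice_emb I u)" for u
  proof -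
    let ?y = "\<lambda>t::real. ?x + t *\<^sub>R slice_emb I u"
    define T where "T = ?y -` \<Omega>"
    have "open T"
      unfolding T_def by (intro open_vimage \<Omega> continuous_intros)
    have "0 \<in> T"
      using x by (simp add: T_def)
    have y': "(?y has_derivative (\<lambda>t. t *\<^sub>R slice_emb I u)) (at 0 within T)"
      by (auto intro!: derivative_eq_intros)
    have "?y t \<in> slice_plane I" for t
      using slice_emb_in_slice_plane[of I "z + t *\<^sub>R u"] by (simp add: slice_emb_add slice_emb_scaleR)
    then have "?y ` T \<subseteq> ?S"
      by (auto simp: T_def)
    then have "((\<lambda>t. f (?y t)) has_derivative (\<lambda>t. D (t *\<^sub>R slice_emb I u))) (at 0 within T)"
      using D by (intro has_derivative_in_compose[OF y']) (auto intro: has_derivative_subset)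
    then have 1: "((\<lambda>t. f (?y t)) has_vector_derivative D (slice_emb I u)) (at 0)"
      unfolding has_vector_derivative_def at_within_open[OF \<open>0 \<in> T\<close> \<open>open T\<close>]
      by (simp add: linear_scale[OF has_derivative_linear[OF D]])
    have "((\<lambda>t. f (?y t)) has_derivative (\<lambda>t. L (t *\<^sub>R slice_emb I u))) (at 0 within T)"
      using L by (intro has_derivative_in_compose[OF y']) (auto intro: has_derivative_at_withinI)
    then have "((\<lambda>t. f (?y t)) has_vector_derivative L (slice_emb I u)) (at 0)"
      unfolding has_vector_derivative_def at_within_open[OF \<open>0 \<in> T\<close> \<open>open T\<close>]
      by (simp add: linear_scale[OF has_derivative_linear[OF L]])
    with 1 show ?thesis
      by (rule vector_derivative_unique_at)
  qed
  have "slice_emb I (\<i> * w) = I * slice_emb I w"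
    by (simp add: slice_emb_mult[OF I])
  then show ?thesis
    using eq[of "\<i> * w"] eq[of w] DI[OF slice_emb_in_slice_plane, of w] by simp
qed

lemma imag_unit_in_imag_units: "imag_unit I \<Longrightarrow> I \<in> imag_units"
  by (simp add: imag_units_def power2_eq_square imag_unit_square)

lemma SR_loc_slice_derivative:
  assumes f: "f \<in> SR_loc \<Omega>" and \<Omega>: "open \<Omega>" and I: "imag_unit I"
    and x: "slice_emb I z \<in> \<Omega>" and L: "(f has_derivative L) (at (slice_emb I z))"
  shows "L (slice_emb I (\<i> * w)) = I * L (slice_emb I w)"
proof (rule slice_holomorphic_derivative[OF _ I \<Omega> x L])
  have "\<Omega> \<inter> slice_plane I \<noteq> {}"
    using x slice_emb_in_slice_plane by blast
  then show "slice_holomorphic_on I (\<Omega> \<inter> slice_plane I) f"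
    using f imag_unit_in_imag_units[OF I] by (simp add: SR_loc_def)
qed

text \<open>Directions \<open>v\<close> orthogonal to the slice of \<open>x\<close> satisfy \<open>v * x = qcnj x * v\<close>, while the slice itself
  contributes nothing to \<open>dbar\<close> by holomorphy.\<close>
lemma SR_loc_decomposition:
  assumes f: "f \<in> SR_loc \<Omega>" and \<Omega>: "open \<Omega>" and x: "x \<in> \<Omega>"
  shows "f x = qcnj x * dbar f x - dbar (\<lambda>x. x * f x) x"
proof -
  obtain L where L: "(f has_derivative L) (at x)"
    using f x by (auto simp: SR_loc_def C1_on_def)
  obtain I where I: "imag_unit I" "slice_emb I (slice_coord x) = x"
    using ex_emb by blast
  have LI: "L I = I * L 1"
    using SR_loc_slice_derivative[OF f \<Omega> I(1), of "slice_coord x" L 1] x L I by (simp add: slice_emb_def[of I 1])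
  have "qim x = norm (qim x) *\<^sub>R I"
    using qim_emb[OF I(1), of "slice_coord x"] I(2) by simp
  then have "L (qim x) = norm (qim x) *\<^sub>R (I * L 1)"
    using LI linear_scale[OF has_derivative_linear[OF L]] by metis
  also have "\<dots> = (norm (qim x) *\<^sub>R I) * L 1"
    by simp
  finally have "L (qim x) = qim x * L 1"
    using \<open>qim x = norm (qim x) *\<^sub>R I\<close> by simp
  then have key: "qI x *\<^sub>R L ii + qJ x *\<^sub>R L jj + qK x *\<^sub>R L kk = qim x * L 1"
    using linear_quat_expand[OF has_derivative_linear[OF L], of "qim x"] by simp
  have L2: "((\<lambda>x. x * f x) has_derivative (\<lambda>v. x * L v + v * f x)) (at x)"
    by (rule has_derivative_mult[OF has_derivative_ident L])
  have "fueter (\<lambda>v. x * L v + v * f x) = qcnj x * fueter L - 2 *\<^sub>R f x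
      + 2 *\<^sub>R (qim x * L 1 - (qI x *\<^sub>R L ii + qJ x *\<^sub>R L jj + qK x *\<^sub>R L kk))"
    unfolding fueter_def by (simp add: quat_eq_iff algebra_simps)
  then have "fueter (\<lambda>v. x * L v + v * f x) = qcnj x * fueter L - 2 *\<^sub>R f x"
    unfolding key by simp
  then show ?thesis
    unfolding dbar_eq_fueter[OF L] dbar_eq_fueter[OF L2] by (simp add: scaleR_diff_right)
qed

section \<open>Constancy on the part of a sphere inside a ball\<close>

lemma locally_constant_on_connected:
  assumes g: "locally_constant_on S g" and T: "connected T" "T \<subseteq> S" "x \<in> T" "y \<in> T"
  shows "g x = g y"
proof (rule connected_local_const[OF T(1,3,4)], rule ballI)
  fix a assume a: "a \<in> T"
  then obtain U where U: "openin (top_of_set S) U" "a \<in> U" "g constant_on U"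
    using g T(2) unfolding locally_constant_on_def by blast
  then obtain W where W: "open W" "U = S \<inter> W"
    by (auto simp: openin_open)
  show "eventually (\<lambda>b. g a = g b) (at a within T)"
    unfolding eventually_at_topological
  proof (intro exI[of _ W] conjI ballI impI)
    fix b assume "b \<in> W" "b \<in> T"
    then have "b \<in> U" using W T(2) by blast
    then show "g a = g b" using U unfolding constant_on_def by auto
  qed (use W U in auto)
qed

lemma sphere_throughI:
  assumes "slice_coord x = slice_coord y"
  shows "x \<in> sphere_through y"
proof -
  obtain I J where I: "imag_unit I" "slice_emb I (slice_coord x) = x" and J: "imag_unit J" "slice_emb J (slice_coord y) = y"
    using ex_emb by meson
  have "x = of_real (qRe y) + norm (qim y) *\<^sub>R I" "y = of_real (qRe y) + norm (qim y) *\<^sub>R J"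
    using I(2) J(2) assms by (simp_all add: slice_emb_def)
  then show ?thesis
    using imag_unit_in_imag_units[OF I(1)] imag_unit_in_imag_units[OF J(1)]
    unfolding sphere_through_def by blast
qed

lemma slice_coord_sphere_point:
  assumes "qRe v = 0" "v \<noteq> 0" "0 \<le> \<beta>"
  shows "slice_coord (of_real \<alpha> + \<beta> *\<^sub>R sgn v) = Complex \<alpha> \<beta>"
proof -
  have "imag_unit (sgn v)"
    using assms by (simp add: imag_unit_def norm_sgn sgn_quat_def)
  then show ?thesis
    using assms(3) norm_qim_emb[of "sgn v" "Complex \<alpha> \<beta>"] qRe_emb[of "sgn v" "Complex \<alpha> \<beta>"]
    by (simp add: complex_eq_iff slice_emb_def)
qed

lemma sphere_point_qim: "of_real (qRe x) + norm (qim x) *\<^sub>R sgn (qim x) = x"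
proof -
  have "norm (qim x) *\<^sub>R sgn (qim x) = qim x"
    by (cases "qim x = 0") (simp_all add: sgn_div_norm)
  then show ?thesis
    by (simp only:) (simp add: qim_def)
qed

text \<open>Points of the sphere are parametrised by directions. Normalisation is continuous on
  \<open>K\<close>, which avoids zero, so a convex set of directions has a connected image on the
  sphere.\<close>

lemma constant_on_sphere_cone:
  assumes g: "locally_constant_on (sphere_through x \<inter> \<Omega>) g"
    and K: "convex K" "\<And>v. v \<in> K \<Longrightarrow> qRe v = 0 \<and> v \<noteq> 0 \<and> of_real (qRe x) + norm (qim x) *\<^sub>R sgn v \<in> \<Omega>"
    and xy: "slice_coord x = slice_coord y" "qim x \<in> K" "qim y \<in> K"
  shows "g x = g y"
proof (rule locally_constant_on_connected[OF g])
  let ?p = "\<lambda>v. of_real (qRe x) + norm (qim x) *\<^sub>R sgn v"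
  show "connected (?p ` K)"
    using K by (intro connected_continuous_image convex_connected continuous_intros) auto
  have "slice_coord (?p v) = slice_coord x" if "v \<in> K" for v
    using slice_coord_sphere_point[of v "norm (qim x)" "qRe x"] K(2)[OF that] by (simp add: slice_coord_def)
  then show "?p ` K \<subseteq> sphere_through x \<inter> \<Omega>"
    using K(2) by (auto intro: sphere_throughI)
  show "x \<in> ?p ` K"
    using xy(2) sphere_point_qim[of x] by (intro image_eqI[of _ _ "qim x"]) simp_all
  have "y = ?p (qim y)"
    using sphere_point_qim[of y] xy(1) by (simp add: slice_coord_def)
  then show "y \<in> ?p ` K"
    using xy(3) by (rule image_eqI)
qed

lemma norm_diff_squared_qim: "(norm (x - y))\<^sup>2 = (qRe x - qRe y)\<^sup>2 + (norm (qim x - qim y))\<^sup>2"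
  by (simp add: norm_quat_squared)

text \<open>The ball misses the real axis, and it meets a sphere in a cap of at most half the
  sphere. The directions belonging to such a cap form a convex cone.\<close>

lemma constant_on_sphere_ball_off_real:
  assumes g: "\<And>y. y \<in> \<Omega> \<Longrightarrow> locally_constant_on (sphere_through y \<inter> \<Omega>) g"
    and ball: "ball x0 \<delta> \<subseteq> \<Omega>" "\<delta> \<le> norm (qim x0)"
    and xy: "x \<in> ball x0 \<delta>" "y \<in> ball x0 \<delta>" "slice_coord x = slice_coord y"
  shows "g x = g y"
proof -
  define c \<alpha> \<beta> where "c = qim x0" and "\<alpha> = qRe x" and "\<beta> = norm (qim x)"
  have norm_less: "norm (z - x0) < \<delta> \<longleftrightarrow> (norm (z - x0))\<^sup>2 < \<delta>\<^sup>2" for z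
    using xy(1) zero_le_dist[of x0 x] norm_ge_zero[of "z - x0"]
    by (metis (no_types, lifting) abs_le_square_iff abs_norm_cancel abs_of_pos linorder_not_less mem_ball order_le_less_trans)
  have \<delta>: "0 < \<delta>"
    using xy(1) by (metis ball_eq_empty empty_iff linorder_not_less)
  have \<beta>: "\<beta> > 0"
  proof (rule ccontr)
    assume "\<not> \<beta> > 0"
    then have "qim x = 0" by (simp add: \<beta>_def)
    then have "(norm (qim x0))\<^sup>2 \<le> (norm (x - x0))\<^sup>2"
      unfolding norm_diff_squared_qim[of x x0] by simp
    then have "norm (qim x0) \<le> norm (x - x0)"
      by (rule power2_le_imp_le) simp
    then show False
      using xy(1) ball(2) by (simp add: dist_norm norm_minus_commute)
  qed
  \<comment> \<open>Expanding the squared distance to \<open>x0\<close> shows that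
    \<open>of_real \<alpha> + \<beta> *\<^sub>R sgn v\<close> lies in the ball exactly when
    \<open>sgn v \<bullet> c\<close> exceeds \<open>s\<close>.\<close>
  define s where "s = ((\<alpha> - qRe x0)\<^sup>2 + \<beta>\<^sup>2 + (norm c)\<^sup>2 - \<delta>\<^sup>2) / (2 * \<beta>)"
  have "\<delta>\<^sup>2 \<le> (norm c)\<^sup>2"
    using ball(2) \<delta> by (intro power_mono) (auto simp: c_def)
  then have "0 \<le> (\<alpha> - qRe x0)\<^sup>2 + \<beta>\<^sup>2 + (norm c)\<^sup>2 - \<delta>\<^sup>2"
    using zero_le_power2[of "\<alpha> - qRe x0"] zero_le_power2[of \<beta>] by linarith
  then have s: "s \<ge> 0"
    unfolding s_def using \<beta> by simp
  have s2: "2 * \<beta> * s = (\<alpha> - qRe x0)\<^sup>2 + \<beta>\<^sup>2 + (norm c)\<^sup>2 - \<delta>\<^sup>2"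
    using \<beta> by (simp add: s_def)
  define K where "K = {v. qRe v = 0 \<and> v \<bullet> c > s * norm v}"
  have mem: "v \<in> K \<longleftrightarrow> of_real \<alpha> + \<beta> *\<^sub>R sgn v \<in> ball x0 \<delta>" if v: "qRe v = 0" "v \<noteq> 0" for v
  proof -
    let ?z = "of_real \<alpha> + \<beta> *\<^sub>R sgn v"
    have re: "qRe ?z = \<alpha>" and im: "qim ?z = \<beta> *\<^sub>R sgn v"
      using v by (simp_all add: qim_def sgn_quat_def)
    have "(norm (\<beta> *\<^sub>R sgn v - c))\<^sup>2 = \<beta>\<^sup>2 + (norm c)\<^sup>2 - 2 * \<beta> * (sgn v \<bullet> c)"
    proof -
      have "norm (\<beta> *\<^sub>R sgn v) = \<beta>"
        using v \<beta> by (simp add: norm_sgn)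
      then show ?thesis
        using dot_norm_neg[of "\<beta> *\<^sub>R sgn v" c] by (simp only: inner_scaleR_left) simp
    qed
    then have "(norm (?z - x0))\<^sup>2 < \<delta>\<^sup>2 \<longleftrightarrow> 2 * \<beta> * s < 2 * \<beta> * (sgn v \<bullet> c)"
      unfolding norm_diff_squared_qim[of ?z x0] re im s2 c_def[symmetric] by linarith
    also have "\<dots> \<longleftrightarrow> s < sgn v \<bullet> c"
      using \<beta> by simp
    also have "\<dots> \<longleftrightarrow> s * norm v < v \<bullet> c"
      using v(2) by (simp add: sgn_div_norm field_simps)
    finally show ?thesis
      using v(1) norm_less[of ?z] by (simp add: K_def dist_norm norm_minus_commute)
  qed
  have nz: "v \<noteq> 0" if "v \<in> K" for v
    using that by (auto simp: K_def)
  have xK: "qim x \<in> K"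
    using mem[of "qim x"] \<beta> xy(1) sphere_point_qim[of x] by (simp add: \<alpha>_def \<beta>_def)
  have yK: "qim y \<in> K"
  proof -
    have eq: "\<alpha> = qRe y" "\<beta> = norm (qim y)"
      using xy(3) by (simp_all add: \<alpha>_def \<beta>_def slice_coord_def)
    then have "qim y \<noteq> 0"
      using \<beta> by auto
    then show ?thesis
      using mem[of "qim y"] xy(2) sphere_point_qim[of y] by (simp add: eq)
  qed
  \<comment> \<open>This uses \<open>s \<ge> 0\<close>: then \<open>s * norm v\<close> is a convex
    function of \<open>v\<close>.\<close>
  have "convex K"
  proof (rule convexI)
    fix u v and a b :: real
    assume uv: "u \<in> K" "v \<in> K" and ab: "0 \<le> a" "0 \<le> b" "a + b = 1"
    have "s * norm (a *\<^sub>R u + b *\<^sub>R v) \<le> s * (a * norm u + b * norm v)"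
      using norm_triangle_ineq[of "a *\<^sub>R u" "b *\<^sub>R v"] ab s by (intro mult_left_mono) auto
    also have "\<dots> = a * (s * norm u) + b * (s * norm v)"
      by (simp add: algebra_simps)
    also have "\<dots> < a * (u \<bullet> c) + b * (v \<bullet> c)"
    proof (cases "a = 0")
      case True
      then show ?thesis using uv ab by (simp add: K_def)
    next
      case False
      then show ?thesis
        using uv ab by (intro add_less_le_mono mult_strict_left_mono mult_left_mono) (auto simp: K_def)
    qed
    finally show "a *\<^sub>R u + b *\<^sub>R v \<in> K"
      using uv by (simp add: K_def inner_add_left)
  qed
  have K2: "qRe v = 0 \<and> v \<noteq> 0 \<and> of_real (qRe x) + norm (qim x) *\<^sub>R sgn v \<in> \<Omega>" if "v \<in> K" for v
  proof -
    have v: "qRe v = 0" "v \<noteq> 0"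
      using that nz by (auto simp: K_def)
    then show ?thesis
      using mem[OF v] that ball(1) unfolding \<alpha>_def \<beta>_def by blast
  qed
  have "x \<in> \<Omega>"
    using xy(1) ball(1) by blast
  then show ?thesis
    by (rule constant_on_sphere_cone[OF g \<open>convex K\<close> K2 xy(3) xK yK])
qed

text \<open>A ball with real centre contains the whole sphere through each of its points. Two points
  that are not antipodal have directions in a common open half-space; antipodal points are joined
  through a third.\<close>

lemma constant_on_sphere_ball_real:
  assumes g: "\<And>y. y \<in> \<Omega> \<Longrightarrow> locally_constant_on (sphere_through y \<inter> \<Omega>) g"
    and ball: "ball (of_real p) \<delta> \<subseteq> \<Omega>"
    and xy: "x \<in> ball (of_real p) \<delta>" "slice_coord x = slice_coord y"
  shows "g x = g y"
proof -
  have step: "g u = g v" if u: "slice_coord u = slice_coord x" "slice_coord v = slice_coord x" "qim u + qim v \<noteq> 0" for u v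
  proof -
    \<comment> \<open>As \<open>qim u\<close> and \<open>qim v\<close> have equal norm, each has
      inner product half of \<open>(norm c)\<^sup>2\<close> with \<open>c\<close>, which is
      positive.\<close>
    define c where "c = qim u + qim v"
    define K where "K = {w. qRe w = 0 \<and> w \<bullet> c > 0}"
    have "K = {w. w \<bullet> 1 = 0} \<inter> {w. c \<bullet> w > 0}"
      by (auto simp: K_def inner_quat_def[of _ 1] inner_commute)
    moreover have "convex {w :: quat. w \<bullet> 1 = 0}"
      using convex_hyperplane[of 1 "0::real"] by (simp add: inner_commute)
    ultimately have "convex K"
      by (simp add: convex_Int convex_halfspace_gt)
    have n: "norm (qim u) = norm (qim v)"
      using u by (metis slice_coord_sel(2))
    have "0 < (norm c)\<^sup>2"
      using u(3) by (simp add: c_def)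
    moreover have "qim u \<bullet> c = (norm c)\<^sup>2 / 2" "qim v \<bullet> c = (norm c)\<^sup>2 / 2"
    proof -
      have uv: "qim u \<bullet> qim v = ((norm c)\<^sup>2 - (norm (qim v))\<^sup>2 - (norm (qim v))\<^sup>2) / 2"
        unfolding c_def dot_norm n ..
      have "qim u \<bullet> c = (norm (qim v))\<^sup>2 + qim u \<bullet> qim v"
        unfolding c_def inner_add_right dot_square_norm n ..
      then show "qim u \<bullet> c = (norm c)\<^sup>2 / 2"
        unfolding uv by (simp add: field_simps)
      have "qim v \<bullet> c = (norm (qim v))\<^sup>2 + qim u \<bullet> qim v"
        unfolding c_def inner_add_right dot_square_norm inner_commute[of "qim v" "qim u"] by simp
      then show "qim v \<bullet> c = (norm c)\<^sup>2 / 2"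
        unfolding uv by (simp add: field_simps)
    qed
    ultimately have "0 < qim u \<bullet> c" "0 < qim v \<bullet> c"
      by linarith+
    then have uv: "qim u \<in> K" "qim v \<in> K"
      by (simp_all add: K_def)
    have inb: "w \<in> \<Omega>" if "slice_coord w = slice_coord x" for w
      using that xy(1) ball slice_coord_in_ball_iff by (metis subsetD)
    have K2: "qRe w = 0 \<and> w \<noteq> 0 \<and> of_real (qRe u) + norm (qim u) *\<^sub>R sgn w \<in> \<Omega>" if "w \<in> K" for w
    proof -
      have w: "qRe w = 0" "w \<noteq> 0"
        using that by (auto simp: K_def)
      then have "slice_coord (of_real (qRe u) + norm (qim u) *\<^sub>R sgn w) = slice_coord x"
        using slice_coord_sphere_point[OF w norm_ge_zero, of "qRe u" "qim u"] u(1) unfolding slice_coord_def[of u] by simp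
      with w inb show ?thesis by blast
    qed
    show ?thesis
      by (rule constant_on_sphere_cone[OF g[OF inb] \<open>convex K\<close> K2]) (use u uv in auto)
  qed
  show ?thesis
  proof (cases "qim x = 0")
    case True
    then have "qim y = 0"
      using xy(2) by (metis norm_eq_zero slice_coord_sel(2))
    then have "x = y"
      using True xy(2) sphere_point_qim[of x] sphere_point_qim[of y] by (simp add: slice_coord_def)
    then show ?thesis by simp
  next
    case False
    define \<beta> where "\<beta> = norm (qim x)"
    have \<beta>: "\<beta> > 0" using False by (simp add: \<beta>_def)
    \<comment> \<open>For antipodal points, \<open>ii\<close> or \<open>jj\<close> supplies a
      direction different from both.\<close>
    have ex: "\<exists>e. imag_unit e \<and> qim x + \<beta> *\<^sub>R e \<noteq> 0 \<and> \<beta> *\<^sub>R e + qim y \<noteq> 0" if "qim x + qim y = 0"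
    proof (rule ccontr)
      assume no: "\<not> ?thesis"
      have "qim y = - qim x"
        using that by (simp add: eq_neg_iff_add_eq_0 add.commute)
      then have "qim x = - \<beta> *\<^sub>R e \<or> qim x = \<beta> *\<^sub>R e" if "imag_unit e" for e
        using no that by (metis add.commute diff_eq_eq eq_iff_diff_eq_0 diff_0 scaleR_minus_left uminus_add_conv_diff)
      from this[of ii] this[of jj] show False
        using \<beta> by (auto simp: imag_unit_def quat_eq_iff)
    qed
    show ?thesis
    proof (cases "qim x + qim y = 0")
      case True
      then obtain e where e: "imag_unit e" "qim x + \<beta> *\<^sub>R e \<noteq> 0" "\<beta> *\<^sub>R e + qim y \<noteq> 0"
        using ex by blast
      let ?w = "slice_emb e (slice_coord x)"
      have w: "slice_coord ?w = slice_coord x" "qim ?w = \<beta> *\<^sub>R e"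
        using e(1) e(1)[unfolded imag_unit_def] by (simp_all add: complex_eq_iff qim_emb[OF e(1)] \<beta>_def)
      have "g x = g ?w"
        by (rule step) (use w e(2) in simp_all)
      moreover have "g ?w = g y"
        by (rule step) (use w e(3) xy(2) in simp_all)
      ultimately show ?thesis by simp
    next
      case False
      show ?thesis
        by (rule step) (use False xy(2) in simp_all)
    qed
  qed
qed

section \<open>Holomorphic stem functions of a locally slice-regular function\<close>

text \<open>\<open>A\<close> and \<open>B\<close> solve \<open>f = A + I * B\<close> and
  \<open>f = A + J * B\<close> on the two slices. Holomorphy on both slices gives the Cauchy-Riemann
  equations for the pair (A, B), hence for each real component along \<open>e\<close>.\<close>

lemma two_slice_stem_holomorphic:
  assumes f: "f \<in> SR_loc \<Omega>" and \<Omega>: "open \<Omega>" and I: "imag_unit I" and J: "imag_unit J" and "I \<noteq> J"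
    and V: "open V" "\<And>z. z \<in> V \<Longrightarrow> slice_emb I z \<in> \<Omega>" "\<And>z. z \<in> V \<Longrightarrow> slice_emb J z \<in> \<Omega>"
    and B: "B = (\<lambda>z. inverse (I - J) * (f (slice_emb I z) - f (slice_emb J z)))"
    and A: "A = (\<lambda>z. f (slice_emb I z) - I * B z)"
  shows "(\<lambda>z. Complex (A z \<bullet> e) (B z \<bullet> e)) holomorphic_on V"
  unfolding holomorphic_on_open[OF V(1)]
proof (rule ballI)
  fix z assume z: "z \<in> V"
  obtain LI where LI: "(f has_derivative LI) (at (slice_emb I z))"
    using f V(2)[OF z] by (auto simp: SR_loc_def C1_on_def)
  obtain LJ where LJ: "(f has_derivative LJ) (at (slice_emb J z))"
    using f V(3)[OF z] by (auto simp: SR_loc_def C1_on_def)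
  define dB where "dB w = inverse (I - J) * (LI (slice_emb I w) - LJ (slice_emb J w))" for w
  define dA where "dA w = LI (slice_emb I w) - I * dB w" for w
  have dI: "((\<lambda>z. f (slice_emb I z)) has_derivative (\<lambda>w. LI (slice_emb I w))) (at z)"
    by (rule has_derivative_compose[OF bounded_linear_imp_has_derivative[OF bounded_linear_emb[OF I]] LI])
  have dJ: "((\<lambda>z. f (slice_emb J z)) has_derivative (\<lambda>w. LJ (slice_emb J w))) (at z)"
    by (rule has_derivative_compose[OF bounded_linear_imp_has_derivative[OF bounded_linear_emb[OF J]] LJ])
  have B': "(B has_derivative dB) (at z)"
    unfolding B dB_def by (intro has_derivative_mult_right has_derivative_diff dI dJ)
  have A': "(A has_derivative dA) (at z)"
    unfolding A dA_def by (intro has_derivative_diff has_derivative_mult_right dI B')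
  have CRI: "LI (slice_emb I (\<i> * w)) = I * LI (slice_emb I w)" and CRJ: "LJ (slice_emb J (\<i> * w)) = J * LJ (slice_emb J w)" for w
    using SR_loc_slice_derivative[OF f \<Omega>] I J V z LI LJ by blast+
  have nz: "I - J \<noteq> 0" using \<open>I \<noteq> J\<close> by simp
  \<comment> \<open>With \<open>p\<close>, \<open>q\<close> the derivatives along the two slices,
    \<open>q\<close> is eliminated through \<open>(I - J) * b = p - q\<close>, after which a left
    factor \<open>I - J\<close> can be cancelled.\<close>
  have dBi: "dB \<i> = dA 1"
  proof -
    define b where "b = dB 1"
    define p where "p = LI (slice_emb I 1)"
    define q where "q = LJ (slice_emb J 1)"
    have "(I - J) * b = p - q"
      using nz unfolding b_def dB_def p_def q_def by (simp add: mult.assoc[symmetric])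
    then have q: "q = p - (I - J) * b" by simp
    have II: "I * (I * b) = - b" and JJ: "J * (J * b) = - b"
      using imag_unit_square[OF I] imag_unit_square[OF J] by (simp_all add: mult.assoc[symmetric])
    have "I * p - J * q = (I - J) * (p - I * b)"
      unfolding q by (simp add: algebra_simps II JJ)
    then have "inverse (I - J) * (I * p - J * q) = inverse (I - J) * (I - J) * (p - I * b)"
      by (simp add: mult.assoc)
    also have "\<dots> = p - I * b"
      using nz by simp
    also have "inverse (I - J) * (I * p - J * q) = dB \<i>"
      using CRI[of 1] CRJ[of 1] unfolding dB_def p_def q_def by simp
    finally show ?thesis
      unfolding dA_def p_def b_def .
  qed
  have dAi: "dA \<i> = - dB 1"
  proof -
    have "dA \<i> = I * LI (slice_emb I 1) - I * dA 1"
      using CRI[of 1] by (simp add: dA_def[of \<i>] dBi)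
    also have "\<dots> = I * I * dB 1"
      unfolding dA_def by (simp add: algebra_simps)
    finally show ?thesis
      by (simp add: imag_unit_square[OF I])
  qed
  have exp: "L w = Re w *\<^sub>R L 1 + Im w *\<^sub>R L \<i>" if "linear L" for L :: "complex \<Rightarrow> quat" and w
  proof -
    have "w = Re w *\<^sub>R 1 + Im w *\<^sub>R \<i>"
      by (simp add: complex_eq_iff)
    then have "L w = L (Re w *\<^sub>R 1 + Im w *\<^sub>R \<i>)" by simp
    then show ?thesis
      by (simp add: linear_add[OF that] linear_scale[OF that])
  qed
  have "((\<lambda>z. complex_of_real (A z \<bullet> e) + \<i> * complex_of_real (B z \<bullet> e)) has_derivative
      (\<lambda>w. complex_of_real (dA w \<bullet> e) + \<i> * complex_of_real (dB w \<bullet> e))) (at z)"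
    by (intro has_derivative_add has_derivative_mult_right has_derivative_of_real has_derivative_inner_left A' B')
  moreover have "complex_of_real (dA w \<bullet> e) + \<i> * complex_of_real (dB w \<bullet> e) = Complex (dA 1 \<bullet> e) (dB 1 \<bullet> e) * w" for w
  proof -
    have "dA w = Re w *\<^sub>R dA 1 + Im w *\<^sub>R (- dB 1)"
      using exp[OF has_derivative_linear[OF A'], of w] unfolding dAi .
    then have "dA w \<bullet> e = Re w * (dA 1 \<bullet> e) - Im w * (dB 1 \<bullet> e)"
      by (simp add: inner_diff_left)
    moreover have "dB w = Re w *\<^sub>R dB 1 + Im w *\<^sub>R dA 1"
      using exp[OF has_derivative_linear[OF B'], of w] unfolding dBi .
    then have "dB w \<bullet> e = Re w * (dB 1 \<bullet> e) + Im w * (dA 1 \<bullet> e)"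
      by (simp add: inner_add_left)
    ultimately show ?thesis
      by (simp add: complex_eq_iff)
  qed
  ultimately have "((\<lambda>z. complex_of_real (A z \<bullet> e) + \<i> * complex_of_real (B z \<bullet> e)) has_derivative
      (\<lambda>w. Complex (dA 1 \<bullet> e) (dB 1 \<bullet> e) * w)) (at z)"
    by (simp only:)
  then have "((\<lambda>z. Complex (A z \<bullet> e) (B z \<bullet> e)) has_field_derivative Complex (dA 1 \<bullet> e) (dB 1 \<bullet> e)) (at z)"
    unfolding has_field_derivative_def Complex_eq .
  then show "\<exists>f'. ((\<lambda>z. Complex (A z \<bullet> e) (B z \<bullet> e)) has_field_derivative f') (at z)" ..
qed

text \<open>Quaternion-valued \<open>A\<close> and \<open>B\<close> are split into real components.
  The basis vector stands on the right because the imaginary unit of the slice multiplies from the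
  left.\<close>

lemma stem_sum_Basis:
  "(\<Sum>e\<in>Basis. stem (\<lambda>z. Complex (A z \<bullet> e) (B z \<bullet> e)) x * e) = A (slice_coord x) + sgn (qim x) * B (slice_coord x)"
proof -
  have "(\<Sum>e\<in>Basis. stem (\<lambda>z. Complex (A z \<bullet> e) (B z \<bullet> e)) x * e) =
      (\<Sum>e\<in>Basis. (A (slice_coord x) \<bullet> e) *\<^sub>R e) + sgn (qim x) * (\<Sum>e\<in>Basis. (B (slice_coord x) \<bullet> e) *\<^sub>R e)"
    unfolding sum_distrib_left sum.distrib[symmetric]
    by (rule sum.cong) (simp_all add: stem_def axial_def distrib_right scaleR_conv_of_real[symmetric] of_real_def)
  then show ?thesis
    by (simp add: euclidean_representation)
qed

text \<open>By \<open>SR_loc_decomposition\<close> the three values of \<open>f\<close> are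
  \<open>qcnj y * g - h\<close> at the respective points, with common \<open>g\<close> and
  \<open>h\<close>. On one sphere this is affine in the imaginary unit, hence determined by two
  units; the coefficient is \<open>B = - \<beta> g\<close>.\<close>

lemma two_slice_representation:
  assumes f: "f \<in> SR_loc \<Omega>" and \<Omega>: "open \<Omega>" and I: "imag_unit I" and J: "imag_unit J" and "I \<noteq> J"
    and x: "x \<in> \<Omega>" "slice_emb I (slice_coord x) \<in> \<Omega>" "slice_emb J (slice_coord x) \<in> \<Omega>"
    and g: "dbar f x = dbar f (slice_emb I (slice_coord x))" "dbar f x = dbar f (slice_emb J (slice_coord x))"
    and h: "dbar (\<lambda>x. x * f x) x = dbar (\<lambda>x. x * f x) (slice_emb I (slice_coord x))"
      "dbar (\<lambda>x. x * f x) x = dbar (\<lambda>x. x * f x) (slice_emb J (slice_coord x))"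
    and B: "B = (\<lambda>z. inverse (I - J) * (f (slice_emb I z) - f (slice_emb J z)))"
    and A: "A = (\<lambda>z. f (slice_emb I z) - I * B z)"
  shows "f x = A (slice_coord x) + sgn (qim x) * B (slice_coord x)"
proof -
  define \<beta> where "\<beta> = norm (qim x)"
  let ?I = "sgn (qim x)" and ?g = "dbar f x" and ?h = "dbar (\<lambda>x. x * f x) x"
  have q: "qcnj (of_real a + b *\<^sub>R u) = of_real a - b *\<^sub>R u" if "qRe u = 0" for a b u
    using that by (simp add: quat_eq_iff)
  have re: "qRe ?I = 0" "qRe I = 0" "qRe J = 0"
    using I J by (simp_all add: imag_unit_def)
  have fx: "f x = (of_real (qRe x) - \<beta> *\<^sub>R ?I) * ?g - ?h"
    using SR_loc_decomposition[OF f \<Omega> x(1)] q[OF re(1), of "qRe x" \<beta>] sphere_point_qim[of x]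
    unfolding \<beta>_def by simp
  have fI: "f (slice_emb I (slice_coord x)) = (of_real (qRe x) - \<beta> *\<^sub>R I) * ?g - ?h"
    using SR_loc_decomposition[OF f \<Omega> x(2)] q[OF re(2), of "qRe x" \<beta>] g(1) h(1)
    by (simp add: slice_emb_def \<beta>_def)
  have fJ: "f (slice_emb J (slice_coord x)) = (of_real (qRe x) - \<beta> *\<^sub>R J) * ?g - ?h"
    using SR_loc_decomposition[OF f \<Omega> x(3)] q[OF re(3), of "qRe x" \<beta>] g(2) h(2)
    by (simp add: slice_emb_def \<beta>_def)
  have nz: "I - J \<noteq> 0" using \<open>I \<noteq> J\<close> by simp
  have "f (slice_emb I (slice_coord x)) - f (slice_emb J (slice_coord x)) = (I - J) * (- \<beta> *\<^sub>R ?g)"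
    unfolding fI fJ by (simp add: algebra_simps)
  then have "B (slice_coord x) = inverse (I - J) * (I - J) * (- \<beta> *\<^sub>R ?g)"
    by (simp add: B mult.assoc)
  then have Bx: "B (slice_coord x) = - \<beta> *\<^sub>R ?g"
    using nz by simp
  show ?thesis
    unfolding A Bx fI fx by (simp add: algebra_simps)
qed

section \<open>Assembling a chain from components\<close>

lemma C1_on_sum_mult_right:
  fixes P :: "quat \<Rightarrow> quat \<Rightarrow> quat"
  assumes "finite E" "\<And>e. e \<in> E \<Longrightarrow> C1_on N (P e)"
  shows "C1_on N (\<lambda>x. \<Sum>e\<in>E. P e x * e)"
  using assms
proof (induction E rule: finite_induct)
  case empty
  show ?case
    by (rule C1_onI[where F' = "\<lambda>x v. 0"]) simp_all
next
  case (insert e E)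
  obtain P' :: "quat \<Rightarrow> quat \<Rightarrow>\<^sub>L quat" where P': "\<And>x. x \<in> N \<Longrightarrow> (P e has_derivative P' x) (at x)"
    "continuous_on N P'"
    using insert.prems[of e] unfolding C1_on_def by blast
  obtain S' :: "quat \<Rightarrow> quat \<Rightarrow>\<^sub>L quat" where S': "\<And>x. x \<in> N \<Longrightarrow> ((\<lambda>x. \<Sum>e\<in>E. P e x * e) has_derivative S' x) (at x)"
    "continuous_on N S'"
    using insert.IH insert.prems unfolding C1_on_def by blast
  have "C1_on N (\<lambda>x. P e x * e + (\<Sum>e\<in>E. P e x * e))"
  proof (rule C1_onI[where F' = "\<lambda>x v. P' x v * e + S' x v"])
    show "((\<lambda>x. P e x * e + (\<Sum>e\<in>E. P e x * e)) has_derivative (\<lambda>v. P' x v * e + S' x v)) (at x)"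
      if "x \<in> N" for x
      by (intro has_derivative_add has_derivative_mult_left P'(1) S'(1) that)
    show "continuous_on N (\<lambda>x. P' x v * e + S' x v)" for v
      by (intro continuous_intros P'(2) S'(2))
  qed
  then show ?case
    using insert.hyps by simp
qed

text \<open>Both operators multiply by units from the left, so they commute with right
  multiplication by constants.\<close>

lemma fueter_chain_sum:
  fixes F G K :: "quat \<Rightarrow> quat \<Rightarrow> quat"
  assumes E: "finite E" and N: "open N" and chain: "\<And>e. e \<in> E \<Longrightarrow> fueter_chain N (F e) (G e) (K e)"
    and F: "\<And>x. x \<in> N \<Longrightarrow> H x = (\<Sum>e\<in>E. F e x * e)"
  shows "fueter_chain N H (\<lambda>x. \<Sum>e\<in>E. G e x * e) (\<lambda>x. \<Sum>e\<in>E. K e x * e)"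
proof -
  have fueter_sum: "fueter (\<lambda>v. \<Sum>e\<in>E. L e v * e) = (\<Sum>e\<in>E. fueter (L e) * e)"
    "fueter_cnj (\<lambda>v. \<Sum>e\<in>E. L e v * e) = (\<Sum>e\<in>E. fueter_cnj (L e) * e)" for L
    by (simp_all add: fueter_def fueter_cnj_def sum.distrib sum_subtractf sum_distrib_left distrib_right
        left_diff_distrib mult.assoc)
  have der: "\<exists>L. ((\<lambda>x. \<Sum>e\<in>E. P e x * e) has_derivative L) (at x) \<and> D L = (\<Sum>e\<in>E. r e * e)"
    if "\<And>e. e \<in> E \<Longrightarrow> \<exists>L. (P e has_derivative L) (at x) \<and> D L = r e"
      and D: "\<And>L. D (\<lambda>v. \<Sum>e\<in>E. L e v * e) = (\<Sum>e\<in>E. D (L e) * e)"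
    for P :: "quat \<Rightarrow> quat \<Rightarrow> quat" and D and r x
  proof -
    have "\<forall>e\<in>E. \<exists>L. (P e has_derivative L) (at x) \<and> D L = r e"
      using that(1) by blast
    from bchoice[OF this] obtain L where "\<forall>e\<in>E. (P e has_derivative L e) (at x) \<and> D (L e) = r e" ..
    then have L: "\<And>e. e \<in> E \<Longrightarrow> (P e has_derivative L e) (at x)" "\<And>e. e \<in> E \<Longrightarrow> D (L e) = r e"
      by simp_all
    have "((\<lambda>x. \<Sum>e\<in>E. P e x * e) has_derivative (\<lambda>v. \<Sum>e\<in>E. L e v * e)) (at x)"
      by (intro has_derivative_sum has_derivative_mult_left L(1))
    moreover have "D (\<lambda>v. \<Sum>e\<in>E. L e v * e) = (\<Sum>e\<in>E. r e * e)"
      unfolding D by (rule sum.cong) (simp_all add: L(2))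
    ultimately show ?thesis by blast
  qed
  note c = chain[unfolded fueter_chain_def]
  show ?thesis
    unfolding fueter_chain_def
  proof (intro conjI ballI impI)
    show "C1_on N (\<lambda>x. \<Sum>e\<in>E. G e x * e)" "C1_on N (\<lambda>x. \<Sum>e\<in>E. K e x * e)"
      using chain by (auto simp: fueter_chain_def intro!: C1_on_sum_mult_right[OF E])
    fix x assume x: "x \<in> N" "qim x \<noteq> 0"
    have "\<exists>L. ((\<lambda>x. \<Sum>e\<in>E. F e x * e) has_derivative L) (at x) \<and> fueter L = (\<Sum>e\<in>E. 2 *\<^sub>R G e x * e)"
      by (rule der[OF _ fueter_sum(1)]) (use c x in blast)
    then obtain L where L: "((\<lambda>x. \<Sum>e\<in>E. F e x * e) has_derivative L) (at x)" "fueter L = (\<Sum>e\<in>E. 2 *\<^sub>R G e x * e)"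
      by blast
    have "(H has_derivative L) (at x)"
      by (rule has_derivative_transform_within_open[OF L(1) N x(1)]) (simp add: F)
    then show "\<exists>L. (H has_derivative L) (at x) \<and> fueter L = 2 *\<^sub>R (\<Sum>e\<in>E. G e x * e)"
      using L(2) by (auto simp: scaleR_sum_right)
    show "\<exists>L. ((\<lambda>x. \<Sum>e\<in>E. G e x * e) has_derivative L) (at x) \<and> fueter_cnj L = (\<Sum>e\<in>E. K e x * e)"
      by (rule der[OF _ fueter_sum(2)]) (use c x in blast)
    have "\<exists>L. ((\<lambda>x. \<Sum>e\<in>E. K e x * e) has_derivative L) (at x) \<and> fueter L = (\<Sum>e\<in>E. 0 * e)"
      by (rule der[OF _ fueter_sum(1)]) (use c x in blast)
    then show "\<exists>L. ((\<lambda>x. \<Sum>e\<in>E. K e x * e) has_derivative L) (at x) \<and> fueter L = 0"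
      by simp
  qed
qed

text \<open>Perturb \<open>I\<close> by a small multiple of an imaginary direction not parallel to
  it, and normalise.\<close>

lemma ex_near_imag_unit:
  assumes I: "imag_unit I" and "0 < \<eta>"
  shows "\<exists>J. imag_unit J \<and> J \<noteq> I \<and> norm (J - I) < \<eta>"
proof -
  have "\<exists>e. qRe e = 0 \<and> (\<forall>c. e \<noteq> c *\<^sub>R I)"
  proof (rule ccontr)
    assume "\<not> ?thesis"
    then obtain c d where "ii = c *\<^sub>R I" "jj = d *\<^sub>R I"
      by (metis quat_unit_sel(1,5))
    then have "1 = c * qI I" "0 = c * qJ I" "1 = d * qJ I"
      by (metis quat_unit_sel(2,3,7) scaleR_quat.sel(2,3))+
    then show False by auto
  qed
  then obtain e where e: "qRe e = 0" "\<And>c. e \<noteq> c *\<^sub>R I"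
    by blast
  have ne: "I + s *\<^sub>R e \<noteq> c *\<^sub>R I" if "s \<noteq> 0" for s c
  proof
    assume "I + s *\<^sub>R e = c *\<^sub>R I"
    then have "s *\<^sub>R e = (c - 1) *\<^sub>R I"
      by (simp add: algebra_simps)
    then have "(1 / s) *\<^sub>R s *\<^sub>R e = ((c - 1) / s) *\<^sub>R I"
      by simp
    then show False
      using e(2) that by simp
  qed
  have nI: "norm I = 1" "I \<noteq> 0" "sgn I = I"
    using I by (auto simp: imag_unit_def sgn_div_norm)
  have "((\<lambda>s. sgn (I + s *\<^sub>R e)) \<longlongrightarrow> sgn (I + 0 *\<^sub>R e)) (at 0)"
    using nI by (intro tendsto_intros) auto
  then have "eventually (\<lambda>s. dist (sgn (I + s *\<^sub>R e)) I < \<eta>) (at 0)"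
    using assms(2) nI tendstoD by fastforce
  then have "eventually (\<lambda>s. dist (sgn (I + s *\<^sub>R e)) I < \<eta> \<and> s \<noteq> 0) (at (0::real))"
    by (rule eventually_conj) (simp add: eventually_at_filter)
  then obtain s where s: "dist (sgn (I + s *\<^sub>R e)) I < \<eta>" "s \<noteq> 0"
    using eventually_happens trivial_limit_at by blast
  have nz: "I + s *\<^sub>R e \<noteq> 0"
    using ne[OF s(2), of 0] by simp
  have "sgn (I + s *\<^sub>R e) \<noteq> I"
  proof
    assume "sgn (I + s *\<^sub>R e) = I"
    then have "I + s *\<^sub>R e = norm (I + s *\<^sub>R e) *\<^sub>R I"
      using nz by (metis divideR_right norm_eq_zero sgn_div_norm)
    then show False using ne[OF s(2)] by blast
  qed
  moreover have "imag_unit (sgn (I + s *\<^sub>R e))"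
    using nz I e(1) by (simp add: imag_unit_def norm_sgn) (simp add: sgn_quat_def)
  ultimately show ?thesis
    using s(1) by (auto simp: dist_norm)
qed

section \<open>Local chains for a locally slice-regular function\<close>

text \<open>The slice through \<open>x0\<close> and one close to it both meet a ball on which the
  \<open>dbar\<close> data are constant along spheres. The two-slice representation then holds near
  \<open>x0\<close>, and its components have explicit chains.\<close>

lemma SR_loc_fueter_chain_off_real:
  assumes f: "f \<in> SR_loc \<Omega>" and \<Omega>: "open \<Omega>" and x0: "x0 \<in> \<Omega>" "qim x0 \<noteq> 0"
  shows "\<exists>N G K. open N \<and> x0 \<in> N \<and> N \<subseteq> \<Omega> \<and> fueter_chain N f G K"
proof -
  obtain \<epsilon>0 where \<epsilon>0: "0 < \<epsilon>0" "ball x0 \<epsilon>0 \<subseteq> \<Omega>"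
    using \<Omega> x0(1) open_contains_ball by blast
  define \<beta> where "\<beta> = norm (qim x0)"
  define \<epsilon> where "\<epsilon> = min \<epsilon>0 \<beta>"
  have \<epsilon>: "0 < \<epsilon>" "ball x0 \<epsilon> \<subseteq> \<Omega>" "\<epsilon> \<le> norm (qim x0)"
    using \<epsilon>0 x0(2) by (auto simp: \<epsilon>_def \<beta>_def)
  obtain I where I: "imag_unit I" "slice_emb I (slice_coord x0) = x0"
    using ex_emb by blast
  \<comment> \<open>On \<open>V\<close> imaginary parts stay below \<open>2 * \<beta>\<close>, so
    this bound keeps the points on the slices of \<open>I\<close> and \<open>J\<close> within half
    of \<epsilon> of each other.\<close>
  obtain J where J: "imag_unit J" "J \<noteq> I" "norm (J - I) < \<epsilon> / 2 / (2 * \<beta>)"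
    using ex_near_imag_unit[OF I(1)] \<epsilon>(1) x0(2) by (metis \<beta>_def divide_pos_pos mult_pos_pos zero_less_norm_iff zero_less_numeral)
  define V where "V = ball (slice_coord x0) (\<epsilon> / 2)"
  \<comment> \<open>Restricting the slice coordinate to \<open>V\<close> keeps both comparison
    points in the ball.\<close>
  define N where "N = slice_coord -` V \<inter> ball x0 \<epsilon>"
  have oN: "open N"
    unfolding N_def V_def by (intro open_Int open_ball open_vimage continuous_on_zt)
  have x0N: "x0 \<in> N"
    using \<epsilon> by (simp add: N_def V_def)
  have Im_V: "0 < Im z \<and> Im z < 2 * \<beta>" if "z \<in> V" for z
  proof -
    have "\<bar>Im (slice_coord x0) - Im z\<bar> < \<epsilon> / 2"
      using abs_Im_le_cmod[of "slice_coord x0 - z"] that by (simp add: V_def dist_norm)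
    then show ?thesis
      using \<epsilon> by (simp add: \<beta>_def abs_if split: if_splits)
  qed
  have VI: "slice_emb I z \<in> ball x0 \<epsilon>" if "z \<in> V" for z
  proof -
    have "dist x0 (slice_emb I z) = norm (slice_coord x0 - z)"
      by (metis I dist_norm slice_emb_diff norm_emb)
    then show ?thesis
      using that \<epsilon>(1) by (simp add: V_def dist_norm)
  qed
  have VJ: "slice_emb J z \<in> ball x0 \<epsilon>" if "z \<in> V" for z
  proof -
    have "slice_emb J z - slice_emb I z = Im z *\<^sub>R (J - I)"
      by (simp add: slice_emb_def algebra_simps)
    then have "norm (slice_emb J z - slice_emb I z) = Im z * norm (J - I)"
      using Im_V[OF that] by simp
    also have "\<dots> \<le> 2 * \<beta> * norm (J - I)"
      using Im_V[OF that] by (intro mult_right_mono) auto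
    also have "\<dots> < \<epsilon> / 2"
      using J(3) x0(2) by (simp add: \<beta>_def field_simps)
    finally have "norm (slice_emb J z - slice_emb I z) < \<epsilon> / 2" .
    moreover have "dist x0 (slice_emb I z) = norm (slice_coord x0 - z)"
      by (metis I dist_norm slice_emb_diff norm_emb)
    then have "norm (slice_emb I z - x0) < \<epsilon> / 2"
      using that by (simp add: V_def dist_norm norm_minus_commute)
    ultimately have "norm ((slice_emb J z - slice_emb I z) + (slice_emb I z - x0)) < \<epsilon>"
      using norm_triangle_ineq[of "slice_emb J z - slice_emb I z" "slice_emb I z - x0"] by linarith
    then show ?thesis
      by (simp add: dist_norm norm_minus_commute)
  qed
  define B where "B = (\<lambda>z. inverse (I - J) * (f (slice_emb I z) - f (slice_emb J z)))"
  define A where "A = (\<lambda>z. f (slice_emb I z) - I * B z)"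
  have hol: "(\<lambda>z. Complex (A z \<bullet> e) (B z \<bullet> e)) holomorphic_on V" for e
    by (rule two_slice_stem_holomorphic[OF f \<Omega> I(1) J(1) J(2)[symmetric] _ _ _ B_def A_def])
      (use VI VJ \<epsilon>(2) in \<open>auto simp: V_def\<close>)
  have lc: "locally_constant_on (sphere_through y \<inter> \<Omega>) (dbar f)"
    "locally_constant_on (sphere_through y \<inter> \<Omega>) (dbar (\<lambda>x. x * f x))" if "y \<in> \<Omega>" for y
    using f that by (auto simp: SR_loc_def)
  have rep: "f x = A (slice_coord x) + sgn (qim x) * B (slice_coord x)" if "x \<in> N" for x
  proof -
    have x: "x \<in> ball x0 \<epsilon>" "slice_coord x \<in> V"
      using that by (auto simp: N_def)
    have slice_coord: "slice_coord x = slice_coord (slice_emb I (slice_coord x))" "slice_coord x = slice_coord (slice_emb J (slice_coord x))"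
      using I(1) J(1) Im_V[OF x(2)] by (simp_all add: complex_eq_iff)
    note eq = constant_on_sphere_ball_off_real[OF _ \<epsilon>(2,3) x(1) VI[OF x(2)] slice_coord(1)]
      constant_on_sphere_ball_off_real[OF _ \<epsilon>(2,3) x(1) VJ[OF x(2)] slice_coord(2)]
    show ?thesis
      by (rule two_slice_representation[OF f \<Omega> I(1) J(1) J(2)[symmetric] _ _ _ _ _ _ _ B_def A_def])
        (use x VI[OF x(2)] VJ[OF x(2)] \<epsilon>(2) eq lc in \<open>blast+\<close>)
  qed
  have "fueter_chain N f (\<lambda>x. \<Sum>e\<in>Basis. stem1 (\<lambda>z. Complex (A z \<bullet> e) (B z \<bullet> e)) x * e)
      (\<lambda>x. \<Sum>e\<in>Basis. stem2 (\<lambda>z. Complex (A z \<bullet> e) (B z \<bullet> e)) x * e)"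
  proof (rule fueter_chain_sum[OF finite_Basis oN])
    show "fueter_chain N (stem (\<lambda>z. Complex (A z \<bullet> e) (B z \<bullet> e))) (stem1 (\<lambda>z. Complex (A z \<bullet> e) (B z \<bullet> e)))
        (stem2 (\<lambda>z. Complex (A z \<bullet> e) (B z \<bullet> e)))" for e
      by (rule fueter_chain_stem[OF hol]) (use Im_V in \<open>auto simp: V_def N_def\<close>)
    show "f x = (\<Sum>e\<in>Basis. stem (\<lambda>z. Complex (A z \<bullet> e) (B z \<bullet> e)) x * e)" if "x \<in> N" for x
      unfolding stem_sum_Basis using rep[OF that] .
  qed
  moreover have "N \<subseteq> \<Omega>"
    using \<epsilon>(2) by (auto simp: N_def)
  ultimately show ?thesis
    using oN x0N by blast
qed

text \<open>The two slices are parametrised by \<open>ii\<close> and \<open>- ii\<close>.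
  Conjugation exchanges the values of \<open>f\<close> on them, which makes the stem components
  intrinsic, as the chain across the real axis requires.\<close>

lemma SR_loc_fueter_chain_real:
  assumes f: "f \<in> SR_loc \<Omega>" and \<Omega>: "open \<Omega>" and x0: "x0 \<in> \<Omega>" "qim x0 = 0"
  shows "\<exists>N G K. open N \<and> x0 \<in> N \<and> N \<subseteq> \<Omega> \<and> fueter_chain N f G K"
proof -
  define p where "p = qRe x0"
  have x0p: "x0 = of_real p"
    using x0(2) by (simp add: p_def qim_eq_0_iff)
  obtain \<epsilon> where \<epsilon>: "0 < \<epsilon>" "ball x0 \<epsilon> \<subseteq> \<Omega>"
    using \<Omega> x0(1) open_contains_ball by blast
  define V where "V = ball (complex_of_real p) \<epsilon>"
  define N where "N = ball (of_real p :: quat) \<epsilon>"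
  have I: "imag_unit ii" and J: "imag_unit (- ii)" and IJ: "ii \<noteq> - ii"
    by (simp_all add: imag_unit_def quat_eq_iff)
  have VI: "slice_emb u z \<in> N" if "z \<in> V" "imag_unit u" for u z
  proof -
    have "of_real p - slice_emb u z = slice_emb u (of_real p - z)"
      by (simp add: slice_emb_diff)
    then show ?thesis
      using that(1) by (simp add: N_def V_def dist_norm norm_emb[OF that(2)])
  qed
  have N\<Omega>: "N \<subseteq> \<Omega>"
    using \<epsilon>(2) by (simp add: N_def x0p)
  define B where "B = (\<lambda>z. inverse (ii - - ii) * (f (slice_emb ii z) - f (slice_emb (- ii) z)))"
  define A where "A = (\<lambda>z. f (slice_emb ii z) - ii * B z)"
  have hol: "(\<lambda>z. Complex (A z \<bullet> e) (B z \<bullet> e)) holomorphic_on V" for e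
    by (rule two_slice_stem_holomorphic[OF f \<Omega> I J IJ _ _ _ B_def A_def])
      (use VI[OF _ I] VI[OF _ J] N\<Omega> in \<open>auto simp: V_def\<close>)
  have intr: "intrinsic_on V (\<lambda>z. Complex (A z \<bullet> e) (B z \<bullet> e))" for e
  proof -
    have cnj_V: "cnj z \<in> V" if "z \<in> V" for z
    proof -
      have "cmod (of_real p - cnj z) = cmod (of_real p - z)"
        by (metis complex_cnj_complex_of_real complex_cnj_diff complex_mod_cnj)
      then show ?thesis
        using that by (simp add: V_def dist_norm)
    qed
    have slice_emb_cnj: "slice_emb ii (cnj z) = slice_emb (- ii) z" "slice_emb (- ii) (cnj z) = slice_emb ii z" for z
      by (simp_all add: slice_emb_def)
    \<comment> \<open>\<open>B\<close> is odd and \<open>A\<close> even under conjugation, which is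
      the reflection symmetry of \<open>A\<close> + i \<open>B\<close>.\<close>
    have Bc: "B (cnj z) = - B z" for z
      unfolding B_def slice_emb_cnj by (simp add: algebra_simps)
    have "(ii - - ii) * B z = f (slice_emb ii z) - f (slice_emb (- ii) z)" for z
    proof -
      have "ii - - ii \<noteq> 0"
        using IJ by (metis right_minus_eq)
      then show ?thesis
        unfolding B_def mult.assoc[symmetric] by (simp only: right_inverse[OF \<open>ii - - ii \<noteq> 0\<close>] mult_1_left)
    qed
    then have "A (cnj z) = A z" for z
      unfolding A_def slice_emb_cnj Bc by (simp add: algebra_simps)
    with Bc cnj_V show ?thesis
      by (simp add: intrinsic_on_def complex_eq_iff)
  qed
  have lc: "locally_constant_on (sphere_through y \<inter> \<Omega>) (dbar f)"
    "locally_constant_on (sphere_through y \<inter> \<Omega>) (dbar (\<lambda>x. x * f x))" if "y \<in> \<Omega>" for y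
    using f that by (auto simp: SR_loc_def)
  have rep: "f x = A (slice_coord x) + sgn (qim x) * B (slice_coord x)" if x: "x \<in> N" for x
  proof -
    have V: "slice_coord x \<in> V"
      using x unfolding N_def V_def slice_coord_in_ball_iff .
    have slice_coord: "slice_coord x = slice_coord (slice_emb ii (slice_coord x))" "slice_coord x = slice_coord (slice_emb (- ii) (slice_coord x))"
      using I J by (simp_all add: complex_eq_iff)
    note eq = constant_on_sphere_ball_real[OF _ N\<Omega>[unfolded N_def] x[unfolded N_def] slice_coord(1)]
      constant_on_sphere_ball_real[OF _ N\<Omega>[unfolded N_def] x[unfolded N_def] slice_coord(2)]
    show ?thesis
      by (rule two_slice_representation[OF f \<Omega> I J IJ _ _ _ _ _ _ _ B_def A_def])
        (use x VI[OF V I] VI[OF V J] N\<Omega> eq lc in \<open>blast+\<close>)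
  qed
  have "\<exists>G K. fueter_chain N (stem (\<lambda>z. Complex (A z \<bullet> e) (B z \<bullet> e))) G K" for e
    using fueter_chain_stem_real_ball[OF hol[of e, unfolded V_def] intr[of e, unfolded V_def]]
    unfolding N_def by blast
  then obtain G K where GK: "\<And>e. fueter_chain N (stem (\<lambda>z. Complex (A z \<bullet> e) (B z \<bullet> e))) (G e) (K e)"
    by metis
  have "fueter_chain N f (\<lambda>x. \<Sum>e\<in>Basis. G e x * e) (\<lambda>x. \<Sum>e\<in>Basis. K e x * e)"
    by (rule fueter_chain_sum[OF finite_Basis _ GK])
      (use rep in \<open>simp_all add: N_def stem_sum_Basis\<close>)
  then show ?thesis
    using N\<Omega> \<epsilon>(1) by (intro exI[of _ N]) (auto simp: N_def x0p)
qed

section \<open>Gluing, and the conclusion\<close>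

text \<open>A real point is the limit of the nonreal points obtained by moving in direction
  \<open>ii\<close>.\<close>

lemma continuous_eq_off_real:
  fixes F G :: "quat \<Rightarrow> quat"
  assumes N: "open N" and F: "continuous_on N F" and G: "continuous_on N G"
    and eq: "\<And>x. x \<in> N \<Longrightarrow> qim x \<noteq> 0 \<Longrightarrow> F x = G x" and x: "x \<in> N"
  shows "F x = G x"
proof (cases "qim x = 0")
  case True
  have y: "((\<lambda>t. x + t *\<^sub>R ii) \<longlongrightarrow> x + 0 *\<^sub>R ii) (at (0::real))"
    by (intro tendsto_intros)
  have cF: "isCont F x" and cG: "isCont G x"
    using F G N x by (auto simp: continuous_on_eq_continuous_at)
  have lim: "((\<lambda>t. F (x + t *\<^sub>R ii)) \<longlongrightarrow> F x) (at (0::real))" "((\<lambda>t. G (x + t *\<^sub>R ii)) \<longlongrightarrow> G x) (at (0::real))"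
    using isCont_tendsto_compose[OF cF] isCont_tendsto_compose[OF cG] y by simp_all
  have ev: "eventually (\<lambda>t. F (x + t *\<^sub>R ii) = G (x + t *\<^sub>R ii)) (at (0::real))"
  proof -
    have "eventually (\<lambda>t. x + t *\<^sub>R ii \<in> N) (at (0::real))"
      using topological_tendstoD[OF y N] x by simp
    moreover have "eventually (\<lambda>t. t \<noteq> 0) (at (0::real))"
      by (simp add: eventually_at_filter)
    ultimately show ?thesis
    proof eventually_elim
      case (elim t)
      have "qim (x + t *\<^sub>R ii) = t *\<^sub>R ii"
        using True by (simp add: quat_eq_iff)
      then have "qim (x + t *\<^sub>R ii) \<noteq> 0"
        using elim(2) by (simp add: quat_eq_iff)
      with elim(1) show ?case by (rule eq)
    qed
  qed
  show ?thesis
    by (rule tendsto_unique[OF at_neq_bot Lim_transform_eventually[OF lim(1) ev] lim(2)])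
qed (use eq x in auto)

text \<open>On each local neighbourhood \<open>dbar f\<close> and \<open>k\<close> are identified
  with the \<open>G\<close> and \<open>K\<close> of a chain, off the axis by its relations and on
  the axis by continuity. Local smoothness thereby becomes smoothness on all of \<Omega>.\<close>

lemma SR_loc_iterated_fueter:
  assumes f: "f \<in> SR_loc \<Omega>" and \<Omega>: "open \<Omega>"
  shows "\<exists>(f' :: quat \<Rightarrow> quat \<Rightarrow>\<^sub>L quat) (g' :: quat \<Rightarrow> quat \<Rightarrow>\<^sub>L quat) k (k' :: quat \<Rightarrow> quat \<Rightarrow>\<^sub>L quat).
    continuous_on \<Omega> f' \<and> continuous_on \<Omega> g' \<and> continuous_on \<Omega> k' \<and>
    (\<forall>x\<in>\<Omega>. (f has_derivative blinfun_apply (f' x)) (at x) \<and> (dbar f has_derivative blinfun_apply (g' x)) (at x)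
      \<and> (k has_derivative blinfun_apply (k' x)) (at x)
      \<and> fueter (f' x) = 2 *\<^sub>R dbar f x \<and> fueter_cnj (g' x) = k x \<and> fueter (k' x) = 0)"
proof -
  obtain f' :: "quat \<Rightarrow> quat \<Rightarrow>\<^sub>L quat" where f': "\<And>x. x \<in> \<Omega> \<Longrightarrow> (f has_derivative f' x) (at x)" "continuous_on \<Omega> f'"
    using f unfolding SR_loc_def C1_on_def by blast
  have cont_fueter: "continuous_on N (\<lambda>x. fueter (P x))" "continuous_on N (\<lambda>x. fueter_cnj (P x))"
    if "continuous_on N P" for N and P :: "quat \<Rightarrow> quat \<Rightarrow>\<^sub>L quat"
    using that unfolding fueter_def fueter_cnj_def by (auto intro!: continuous_intros)
  have dbar: "dbar f x = (1 / 2) *\<^sub>R fueter (f' x)" if "x \<in> \<Omega>" for x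
    by (rule dbar_eq_fueter[OF f'(1)[OF that]])
  have cont_dbar: "continuous_on \<Omega> (dbar f)"
    using cont_fueter(1)[OF f'(2)] dbar by (subst continuous_on_cong[OF refl dbar]) (auto intro!: continuous_intros)
  \<comment> \<open>Defining the derivatives globally through \<open>frechet_derivative\<close>
    makes them independent of the local chains, so no choices need to be glued.\<close>
  define g' where "g' x = Blinfun (frechet_derivative (dbar f) (at x))" for x
  define k where "k x = fueter_cnj (g' x)" for x
  define k' where "k' x = Blinfun (frechet_derivative k (at x))" for x
  have local: "\<exists>N. open N \<and> x0 \<in> N \<and> continuous_on N g' \<and> continuous_on N k' \<and>
    (\<forall>x\<in>N. (dbar f has_derivative g' x) (at x) \<and> (k has_derivative k' x) (at x) \<and> fueter (k' x) = 0)"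
    if x0: "x0 \<in> \<Omega>" for x0
  proof -
    obtain N G K where N: "open N" "x0 \<in> N" "N \<subseteq> \<Omega>" and chain: "fueter_chain N f G K"
      using SR_loc_fueter_chain_real[OF f \<Omega> x0] SR_loc_fueter_chain_off_real[OF f \<Omega> x0] by metis
    obtain G' :: "quat \<Rightarrow> quat \<Rightarrow>\<^sub>L quat" where G': "\<And>x. x \<in> N \<Longrightarrow> (G has_derivative G' x) (at x)" "continuous_on N G'"
      using chain unfolding fueter_chain_def C1_on_def by blast
    obtain K' :: "quat \<Rightarrow> quat \<Rightarrow>\<^sub>L quat" where K': "\<And>x. x \<in> N \<Longrightarrow> (K has_derivative K' x) (at x)" "continuous_on N K'"
      using chain unfolding fueter_chain_def C1_on_def by blast
    have contG: "continuous_on N G" and contK: "continuous_on N K"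
      using G'(1) K'(1) has_derivative_continuous by (blast intro: continuous_at_imp_continuous_on)+
    note c = chain[unfolded fueter_chain_def, THEN conjunct2, THEN conjunct2, rule_format]
    have gG: "dbar f x = G x" if "x \<in> N" for x
    proof (rule continuous_eq_off_real[OF N(1) continuous_on_subset[OF cont_dbar N(3)] contG _ that])
      fix y assume y: "y \<in> N" "qim y \<noteq> 0"
      obtain L where "(f has_derivative L) (at y)" "fueter L = 2 *\<^sub>R G y"
        using c[OF y] by blast
      then show "dbar f y = G y"
        using dbar_eq_fueter by simp
    qed
    have der_g: "(dbar f has_derivative G' x) (at x)" if "x \<in> N" for x
      by (rule has_derivative_transform_within_open[OF G'(1)[OF that] N(1) that]) (simp add: gG)
    have g'_eq: "g' x = G' x" if "x \<in> N" for x
      unfolding g'_def frechet_derivative_at[OF der_g[OF that], symmetric] by (rule blinfun_apply_inverse)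
    have kK: "k x = K x" if "x \<in> N" for x
      unfolding k_def g'_eq[OF that]
    proof (rule continuous_eq_off_real[OF N(1) cont_fueter(2)[OF G'(2)] contK _ that])
      fix y assume y: "y \<in> N" "qim y \<noteq> 0"
      obtain L where L: "(G has_derivative L) (at y)" "fueter_cnj L = K y"
        using c[OF y] by blast
      have "L = blinfun_apply (G' y)"
        by (rule has_derivative_unique[OF L(1) G'(1)[OF y(1)]])
      then show "fueter_cnj (G' y) = K y"
        using L(2) by simp
    qed
    have der_k: "(k has_derivative K' x) (at x)" if "x \<in> N" for x
      by (rule has_derivative_transform_within_open[OF K'(1)[OF that] N(1) that]) (simp add: kK)
    have k'_eq: "k' x = K' x" if "x \<in> N" for x
      unfolding k'_def frechet_derivative_at[OF der_k[OF that], symmetric] by (rule blinfun_apply_inverse)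
    have zero: "fueter (K' x) = 0" if "x \<in> N" for x
    proof (rule continuous_eq_off_real[OF N(1) cont_fueter(1)[OF K'(2)] continuous_on_const _ that])
      fix y assume y: "y \<in> N" "qim y \<noteq> 0"
      obtain L where L: "(K has_derivative L) (at y)" "fueter L = 0"
        using c[OF y] by blast
      have "L = blinfun_apply (K' y)"
        by (rule has_derivative_unique[OF L(1) K'(1)[OF y(1)]])
      then show "fueter (K' y) = 0"
        using L(2) by simp
    qed
    have "continuous_on N g'" "continuous_on N k'"
      by (rule continuous_on_eq[OF G'(2)], simp add: g'_eq)
        (rule continuous_on_eq[OF K'(2)], simp add: k'_eq)
    then show ?thesis
      using N der_g der_k zero by (intro exI[of _ N]) (auto simp: g'_eq k'_eq)
  qed
  have "continuous_on \<Omega> g' \<and> continuous_on \<Omega> k'"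
  proof (intro conjI continuous_at_imp_continuous_on ballI)
    fix x assume "x \<in> \<Omega>"
    then obtain N where "open N" "x \<in> N" "continuous_on N g'" "continuous_on N k'"
      using local by blast
    then show "isCont g' x" "isCont k' x"
      by (simp_all add: continuous_on_eq_continuous_at)
  qed
  moreover have "(dbar f has_derivative g' x) (at x) \<and> (k has_derivative k' x) (at x) \<and> fueter (k' x) = 0"
    if "x \<in> \<Omega>" for x
    using local[OF that] by blast
  moreover have "fueter (f' x) = 2 *\<^sub>R dbar f x" if "x \<in> \<Omega>" for x
    by (simp add: dbar[OF that])
  ultimately show ?thesis
    using f' by (intro exI[of _ f'] exI[of _ g'] exI[of _ k] exI[of _ k']) (simp add: k_def)
qed

text \<open>Compactness gives an \<epsilon> whose closed neighbourhood of the ball stays in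
  \<open>S\<close>. A point outside the ball but within \<open>r + \<epsilon>\<close> of
  \<open>a\<close> is at distance at most \<epsilon> from its radial projection to the sphere of
  radius \<open>r\<close>.\<close>

lemma cball_subset_open_enlarge:
  fixes a :: "'a::{real_normed_vector,heine_borel}"
  assumes "open S" "cball a r \<subseteq> S" "0 < r"
  shows "\<exists>R>r. cball a R \<subseteq> S"
proof -
  obtain \<epsilon> where \<epsilon>: "0 < \<epsilon>" "(\<Union>x\<in>cball a r. cball x \<epsilon>) \<subseteq> S"
    using compact_subset_open_imp_cball_epsilon_subset[OF compact_cball assms(1,2)] .
  have "y \<in> S" if y: "y \<in> cball a (r + \<epsilon>)" for y
  proof (cases "norm (y - a) \<le> r")
    case True
    then show ?thesis using assms(2) by (auto simp: dist_norm norm_minus_commute)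
  next
    case False
    define n where "n = norm (y - a)"
    have n: "n > r" "n \<le> r + \<epsilon>" "n > 0"
      using False y assms(3) by (auto simp: n_def dist_norm norm_minus_commute)
    let ?x = "a + (r / n) *\<^sub>R (y - a)"
    have "?x \<in> cball a r"
      using n assms(3) by (simp add: dist_norm n_def)
    moreover have "y \<in> cball ?x \<epsilon>"
    proof -
      have "y - ?x = (1 - r / n) *\<^sub>R (y - a)"
        by (simp add: algebra_simps)
      then have "norm (y - ?x) = \<bar>1 - r / n\<bar> * n"
        by (simp add: n_def)
      also have "\<dots> = n - r"
        using n by (simp add: field_simps)
      finally show ?thesis
        using n by (simp add: dist_norm norm_minus_commute)
    qed
    ultimately show ?thesis using \<epsilon>(2) by blast
  qed
  then show ?thesis
    using \<epsilon>(1) by (intro exI[of _ "r + \<epsilon>"]) auto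
qed

theorem corollary24:
  fixes \<Omega> :: "quat set" and f :: "quat \<Rightarrow> quat" and a :: quat and r :: real
  assumes "open \<Omega>"
    and "f \<in> SR_loc \<Omega>"
    and "a \<in> \<Omega>"
    and "r > 0"
    and "closure (ball a r) \<subseteq> \<Omega>"
  shows "f a = (\<integral>\<zeta>. f (a + r *\<^sub>R \<zeta>) \<partial>sphere_measure)
             - r *\<^sub>R (\<integral>\<zeta>. qcnj \<zeta> * dbar f (a + r *\<^sub>R \<zeta>) \<partial>sphere_measure)"
proof -
  \<comment> \<open>The means are differentiated in the radius, so \<open>r\<close> has to be
    interior to the admissible range.\<close>
  obtain R where R: "r < R" "cball a R \<subseteq> \<Omega>"
    using cball_subset_open_enlarge[of \<Omega> a r] assms by auto
  obtain f' g' k' :: "quat \<Rightarrow> quat \<Rightarrow>\<^sub>L quat" and k where "continuous_on \<Omega> f'" "continuous_on \<Omega> g'" "continuous_on \<Omega> k'"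
    and D: "\<forall>x\<in>\<Omega>. (f has_derivative blinfun_apply (f' x)) (at x)
      \<and> (dbar f has_derivative blinfun_apply (g' x)) (at x)
      \<and> (k has_derivative blinfun_apply (k' x)) (at x)
      \<and> fueter (f' x) = 2 *\<^sub>R dbar f x \<and> fueter_cnj (g' x) = k x \<and> fueter (k' x) = 0"
    using SR_loc_iterated_fueter[OF assms(2,1)] by blast
  then have cont: "continuous_on (cball a R) f'" "continuous_on (cball a R) g'" "continuous_on (cball a R) k'"
    using R(2) continuous_on_subset by blast+
  show ?thesis
    by (rule fueter_biharmonic_mean_value[where f' = f' and g' = g' and k = k and k' = k' and R = R])
      (use assms(4) R D cont in \<open>auto simp del: mem_cball\<close>)
qed

end
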